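(* Let $A=A(\mathbf q,\mathbf a)$ be a quantum complete intersection over a field $\mathbb K$ which is a symmetric algebra. Then $A$ admits a bi-Frobenius algebra structure with permutation antipode if and only if there is a compatible permutation $\pi\in S_n$ with $\pi^2=\mathrm{Id}$. If this is the case, then, for such $\pi$ and for some $c_i\in\mathbb K$ ($1\le i\le n$) with $c_ic_{\pi(i)}=h_{\mathbf e_i}$ for all $i$ and $q_\pi\prod_{1\le i\le n}c_i^{a_i-1}=1$, the quadruple $(A,\ x_{\mathbf a-\mathbf 1}^*,\ x_{\mathbf a-\mathbf 1},\ S)$ is a bi-Frobenius algebra, where the coalgebra structure $(\Delta,\varepsilon)$ and the map $S$ are those attached to $(\pi,c_1,\dots,c_n)$ as defined in the context; in particular $S(x_i)=c_ix_{\pi(i)}$, $1\le i\le n$.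
   Context: **Quantum complete intersections.** Let $\mathbb K$ be a field, $n\ge 2$ an integer, $\mathbf a=(a_1,\dots,a_n)$ an integer vector with all $a_i\ge 2$, and $\mathbf q=(q_{ij})$ an $n\times n$ matrix over $\mathbb K$ with $q_{ii}=1$ and $q_{ij}q_{ji}=1$ for all $i,j$. The quantum complete intersection $A=A(\mathbf q,\mathbf a)$ is the $\mathbb K$-algebra $\mathbb K\langle x_1,\dots,x_n\rangle/\langle x_i^{a_i},\ x_jx_i-q_{ij}x_ix_j,\ 1\le i,j\le n\rangle$. Put $V=\{\mathbf v=(v_1,\dots,v_n)\in\mathbb N_0^n: v_i\le a_i-1,\ 1\le i\le n\}$ and $x_{\mathbf v}=x_1^{v_1}\cdots x_n^{v_n}$. Then $\{x_{\mathbf v}:\mathbf v\in V\}$ is a $\mathbb K$-basis of $A$ (the standard basis); $\{x_{\mathbf v}^*\}$ denotes the dual basis of $A^*=\mathrm{Hom}_{\mathbb K}(A,\mathbb K)$. Write $\mathbf 0=(0,\dots,0)$, $\mathbf 1=(1,\dots,1)$, and $\mathbf e_i$ for the $i$-th unit vector. $A$ is a symmetric algebra if $A\cong A^*$ as $A$-$A$-bimodules. **Structure coefficients.** For $\mathbf u,\mathbf v\in\mathbb Z^n$: $\mathbf q^{\langle\mathbf u|\mathbf v\rangle}=\prod_{1\le i<j\le n}q_{ij}^{u_jv_i}$ and $h_{\mathbf v}=\mathbf q^{\langle\mathbf a-\mathbf 1-\mathbf v|\mathbf v\rangle}/\mathbf q^{\langle\mathbf v|\mathbf a-\mathbf 1-\mathbf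 v\rangle}$; in particular $h_{\mathbf e_i}=\prod_{1\le j\le n}q_{ij}^{a_j-1}$. **Permutations.** $\pi\in S_n$ acts on $\mathbb Z^n$ by $\pi(\mathbf v)=(v_{\pi^{-1}(1)},\dots,v_{\pi^{-1}(n)})$, so $\pi(\mathbf e_i)=\mathbf e_{\pi(i)}$. It is compatible (with $A$) if $a_{\pi(i)}=a_i$ and $q_{\pi(i)\pi(j)}=q_{ji}$ for all $1\le i,j\le n$ (then $\pi$ maps $V$ to $V$). Put $q_\pi=\prod_{1\le j<k\le n}(\mathbf q^{\langle\pi(\mathbf e_k)|\pi(\mathbf e_j)\rangle})^{(a_k-1)(a_j-1)}$. **Bi-Frobenius algebras.** Let $A$ be a finite-dimensional algebra which is also a coalgebra $(A,\Delta,\varepsilon)$ over $\mathbb K$, let $t\in A$, $\phi\in A^*$, and let $S:A\to A$ be the linear map $S(a)=\sum\phi(t_1a)t_2$ (Sweedler notation $\Delta(t)=\sum t_1\otimes t_2$). $(A,\phi,t,S)$ is a bi-Frobenius algebra (with antipode $S$) if: (i) $\varepsilon$ is an algebra homomorphism and $\Delta(1_A)=1_A\otimes 1_A$; (ii) $(A,\phi)$ is a Frobenius algebra, i.e. every element of $A^*$ has the form $x\mapsto\phi(bx)$ for some $b\in A$, and $(A,t)$ is a Frobenius coalgebra, i.e. $A=\{\sum f(t_1)t_2: f\in A^*\}$; (iii) $S$ is an algebra anti-homomorphism ($S(1)=1$, $S(ab)=S(b)S(a)$) and a coalgebra anti-homomorphism ($\varepsilon\circ S=\varepsilon$, $\Delta(S(a))=\sum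 S(a_2)\otimes S(a_1)$). A bi-Frobenius algebra structure on the algebra $A$ is a choice of coalgebra structure, $\phi$, $t$ making $(A,\phi,t,S)$ a bi-Frobenius algebra. **Permutation antipode.** For a bi-Frobenius algebra structure on $A(\mathbf q,\mathbf a)$, $S$ is a permutation antipode if there are a permutation $\pi$ of the set $V$ and $c_{\mathbf v}\in\mathbb K$ ($\mathbf v\in V$) with $S(x_{\mathbf v})=c_{\mathbf v}x_{\pi(\mathbf v)}$ for all $\mathbf v\in V$. **Structure attached to $(\pi,c_1,\dots,c_n)$.** Let $\pi\in S_n$ be compatible with $\pi^2=\mathrm{Id}$ and $c_i\in\mathbb K$ with $c_ic_{\pi(i)}=h_{\mathbf e_i}$ for all $i$ and $q_\pi\prod_ic_i^{a_i-1}=1$. For $\mathbf v\in V$ put $$g_{\mathbf a-\mathbf 1-\mathbf v,\pi(\mathbf v)}=\frac{1}{\mathbf q^{\langle\mathbf a-\mathbf 1-\mathbf v|\mathbf v\rangle}}\prod_{1\le i\le n}c_i^{v_i}\prod_{1\le j<k\le n}(\mathbf q^{\langle\pi(\mathbf e_k)|\pi(\mathbf e_j)\rangle})^{v_jv_k}.$$ Define linear maps: $\varepsilon(x_{\mathbf v})=\delta_{\mathbf v,\mathbf 0}$; $\Delta(1_A)=1_A\otimes1_A$; $\Delta(x_{\mathbf v})=1_A\otimes x_{\mathbf v}+x_{\mathbf v}\otimes1_A$ for $\mathbf v\in V\setminus\{\mathbf 0,\mathbf a-\mathbf 1\}$; $\Delta(x_{\mathbf a-\mathbf 1})=\sum_{\mathbf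 v\in V}g_{\mathbf a-\mathbf 1-\mathbf v,\pi(\mathbf v)}\,x_{\mathbf a-\mathbf 1-\mathbf v}\otimes x_{\pi(\mathbf v)}$; and $$S(x_{\mathbf v})=\prod_{1\le i\le n}c_i^{v_i}\prod_{1\le j<k\le n}(\mathbf q^{\langle\pi(\mathbf e_k)|\pi(\mathbf e_j)\rangle})^{v_jv_k}\,x_{\pi(\mathbf v)},\quad\mathbf v\in V.$$ *)

theory Defs
  imports "HOL-Library.Poly_Mapping" "HOL-Library.FuncSet" "HOL-Combinatorics.Permutations"
    "HOL-Algebra.QuotRing" "HOL-Algebra.Module"
begin

section \<open>Vector spaces and associative algebras over a field\<close>

text \<open>
  The ground field is a type \<open>'k\<close> of class \<open>field\<close>. Spaces and algebras over it are
  HOL-Algebra records of type \<open>('k, 'a) module\<close>. For a mere vector space the fields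
  \<open>mult\<close> and \<open>one\<close> carry no meaning.
\<close>

definition scalars :: "('k::field, 'k) module" where
  "scalars = \<lparr>carrier = UNIV, mult = (*), one = 1, zero = 0, add = (+), smult = (*)\<rparr>"

text \<open>The locale \<^locale>\<open>algebra\<close> of the library requires commutativity, hence this definition.\<close>

definition assoc_algebra :: "('k::field, 'a) module \<Rightarrow> bool" where
  "assoc_algebra A \<longleftrightarrow> module scalars A \<and> ring A \<and>
     (\<forall>c. \<forall>x\<in>carrier A. \<forall>y\<in>carrier A.
        (c \<odot>\<^bsub>A\<^esub> x) \<otimes>\<^bsub>A\<^esub> y = c \<odot>\<^bsub>A\<^esub> (x \<otimes>\<^bsub>A\<^esub> y) \<and>
        x \<otimes>\<^bsub>A\<^esub> (c \<odot>\<^bsub>A\<^esub> y) = c \<odot>\<^bsub>A\<^esub> (x \<otimes>\<^bsub>A\<^esub> y))"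

definition fin_dim :: "('k::field, 'a) module \<Rightarrow> bool" where
  "fin_dim M \<longleftrightarrow> (\<exists>B. finite B \<and> B \<subseteq> carrier M \<and>
     (\<forall>x\<in>carrier M. \<exists>c. x = (\<Oplus>\<^bsub>M\<^esub>b\<in>B. c b \<odot>\<^bsub>M\<^esub> b)))"

definition lin_map :: "('k::field, 'a) module \<Rightarrow> ('k, 'b) module \<Rightarrow> ('a \<Rightarrow> 'b) \<Rightarrow> bool" where
  "lin_map M N f \<longleftrightarrow> f \<in> carrier M \<rightarrow> carrier N \<and>
     (\<forall>x\<in>carrier M. \<forall>y\<in>carrier M. f (x \<oplus>\<^bsub>M\<^esub> y) = f x \<oplus>\<^bsub>N\<^esub> f y) \<and>
     (\<forall>c. \<forall>x\<in>carrier M. f (c \<odot>\<^bsub>M\<^esub> x) = c \<odot>\<^bsub>N\<^esub> f x)"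

text \<open>
  Functionals in the dual space are \<open>undefined\<close> outside the carrier, so that equal
  functionals are equal as HOL functions.
\<close>

definition dual_space :: "('k::field, 'a) module \<Rightarrow> ('a \<Rightarrow> 'k) set" where
  "dual_space M = {f \<in> carrier M \<rightarrow>\<^sub>E UNIV. lin_map M scalars f}"

text \<open>The bimodule structure on the dual is \<open>(b f)(z) = f (z b)\<close> and \<open>(f b)(z) = f (b z)\<close>.\<close>

definition symmetric_algebra :: "('k::field, 'a) module \<Rightarrow> bool" where
  "symmetric_algebra A \<longleftrightarrow> assoc_algebra A \<and> fin_dim A \<and>
     (\<exists>\<Phi>. bij_betw \<Phi> (carrier A) (dual_space A) \<and>
       (\<forall>x\<in>carrier A. \<forall>y\<in>carrier A. \<forall>z\<in>carrier A. \<Phi> (x \<oplus>\<^bsub>A\<^esub> y) z = \<Phi> x z + \<Phi> y z) \<and>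
       (\<forall>c. \<forall>x\<in>carrier A. \<forall>z\<in>carrier A. \<Phi> (c \<odot>\<^bsub>A\<^esub> x) z = c * \<Phi> x z) \<and>
       (\<forall>b\<in>carrier A. \<forall>x\<in>carrier A. \<forall>z\<in>carrier A.
          \<Phi> (b \<otimes>\<^bsub>A\<^esub> x) z = \<Phi> x (z \<otimes>\<^bsub>A\<^esub> b) \<and>
          \<Phi> (x \<otimes>\<^bsub>A\<^esub> b) z = \<Phi> x (b \<otimes>\<^bsub>A\<^esub> z)))"

text \<open>
  Quotient by a subspace \<open>H\<close>: the library quotient by the additive subgroup \<open>H\<close>, with scalar
  multiplication \<open>c (H + x) = H + c x\<close> added. If \<open>H\<close> is a two-sided ideal this is the
  quotient algebra.
\<close>

definition quot_module :: "('k::field, 'a) module \<Rightarrow> 'a set \<Rightarrow> ('k, 'a set) module" where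
  "quot_module M H = \<lparr>carrier = carrier (M Quot H), mult = mult (M Quot H), one = one (M Quot H),
     zero = zero (M Quot H), add = add (M Quot H),
     smult = (\<lambda>c X. \<Union>x\<in>X. H +>\<^bsub>M\<^esub> (c \<odot>\<^bsub>M\<^esub> x))\<rparr>"

section \<open>Tensor products\<close>

definition free_space :: "'x set \<Rightarrow> ('k::field, 'x \<Rightarrow>\<^sub>0 'k) module" where
  "free_space X = \<lparr>carrier = {p. Poly_Mapping.keys p \<subseteq> X}, mult = (\<lambda>_ _. 0), one = 0,
     zero = 0, add = (+), smult = (\<lambda>c. Poly_Mapping.map ((*) c))\<rparr>"

definition bilinear_relations ::
    "('k::field, 'a) module \<Rightarrow> ('k, 'b) module \<Rightarrow> ('a \<times> 'b \<Rightarrow>\<^sub>0 'k) set" where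
  "bilinear_relations M N =
     {Poly_Mapping.single (x \<oplus>\<^bsub>M\<^esub> x', y) 1 - Poly_Mapping.single (x, y) 1
        - Poly_Mapping.single (x', y) 1 | x x' y.
        x \<in> carrier M \<and> x' \<in> carrier M \<and> y \<in> carrier N} \<union>
     {Poly_Mapping.single (x, y \<oplus>\<^bsub>N\<^esub> y') 1 - Poly_Mapping.single (x, y) 1
        - Poly_Mapping.single (x, y') 1 | x y y'.
        x \<in> carrier M \<and> y \<in> carrier N \<and> y' \<in> carrier N} \<union>
     {Poly_Mapping.single (c \<odot>\<^bsub>M\<^esub> x, y) 1 - Poly_Mapping.single (x, y) c | c x y.
        x \<in> carrier M \<and> y \<in> carrier N} \<union>
     {Poly_Mapping.single (x, c \<odot>\<^bsub>N\<^esub> y) 1 - Poly_Mapping.single (x, y) c | c x y.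
        x \<in> carrier M \<and> y \<in> carrier N}"

definition tensor_kernel ::
    "('k::field, 'a) module \<Rightarrow> ('k, 'b) module \<Rightarrow> ('a \<times> 'b \<Rightarrow>\<^sub>0 'k) set" where
  "tensor_kernel M N =
     \<Inter>{H. submodule H (scalars :: ('k, 'k) module) (free_space (carrier M \<times> carrier N)) \<and>
         bilinear_relations M N \<subseteq> H}"

definition tensor ::
    "('k::field, 'a) module \<Rightarrow> ('k, 'b) module \<Rightarrow> ('k, ('a \<times> 'b \<Rightarrow>\<^sub>0 'k) set) module" where
  "tensor M N = quot_module (free_space (carrier M \<times> carrier N)) (tensor_kernel M N)"

definition pure_tensor ::
    "('k::field, 'a) module \<Rightarrow> ('k, 'b) module \<Rightarrow> 'a \<Rightarrow> 'b \<Rightarrow> ('a \<times> 'b \<Rightarrow>\<^sub>0 'k) set" where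
  "pure_tensor M N x y =
     tensor_kernel M N +>\<^bsub>(free_space (carrier M \<times> carrier N) :: ('k, 'a \<times> 'b \<Rightarrow>\<^sub>0 'k) module)\<^esub>
       Poly_Mapping.single (x, y) 1"

text \<open>
  The linear map \<open>M \<otimes> N \<rightarrow> P\<close> induced by a bilinear map \<open>\<beta>\<close>. Thus
  \<open>tensor_lift M N P \<beta> T\<close> is the sum of \<open>\<beta> (t\<^sub>1, t\<^sub>2)\<close> when
  \<open>T\<close> is the sum of the pure tensors \<open>t\<^sub>1 \<otimes> t\<^sub>2\<close> (Sweedler notation).
\<close>

definition tensor_lift ::
    "('k::field, 'a) module \<Rightarrow> ('k, 'b) module \<Rightarrow> ('k, 'c) module \<Rightarrow> ('a \<Rightarrow> 'b \<Rightarrow> 'c) \<Rightarrow>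
     ('a \<times> 'b \<Rightarrow>\<^sub>0 'k) set \<Rightarrow> 'c" where
  "tensor_lift M N P \<beta> T = the_elem
     ((\<lambda>p. \<Oplus>\<^bsub>P\<^esub>z\<in>Poly_Mapping.keys p. Poly_Mapping.lookup p z \<odot>\<^bsub>P\<^esub> \<beta> (fst z) (snd z)) ` T)"

definition tensor_map ::
    "('k::field, 'a) module \<Rightarrow> ('k, 'b) module \<Rightarrow> ('k, 'c) module \<Rightarrow> ('k, 'd) module \<Rightarrow>
     ('a \<Rightarrow> 'c) \<Rightarrow> ('b \<Rightarrow> 'd) \<Rightarrow> ('a \<times> 'b \<Rightarrow>\<^sub>0 'k) set \<Rightarrow> ('c \<times> 'd \<Rightarrow>\<^sub>0 'k) set" where
  "tensor_map M N M' N' f g =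
     tensor_lift M N (tensor M' N') (\<lambda>x y. pure_tensor M' N' (f x) (g y))"

text \<open>The canonical isomorphism \<open>(M \<otimes> N) \<otimes> P \<rightarrow> M \<otimes> (N \<otimes> P)\<close>.\<close>

definition tensor_assoc ::
    "('k::field, 'a) module \<Rightarrow> ('k, 'b) module \<Rightarrow> ('k, 'c) module \<Rightarrow>
     (('a \<times> 'b \<Rightarrow>\<^sub>0 'k) set \<times> 'c \<Rightarrow>\<^sub>0 'k) set \<Rightarrow> ('a \<times> ('b \<times> 'c \<Rightarrow>\<^sub>0 'k) set \<Rightarrow>\<^sub>0 'k) set" where
  "tensor_assoc M N P =
     tensor_lift (tensor M N) P (tensor M (tensor N P))
       (\<lambda>T z. tensor_lift M N (tensor M (tensor N P))
          (\<lambda>x y. pure_tensor M (tensor N P) x (pure_tensor N P y z)) T)"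

section \<open>Coalgebras and bi-Frobenius algebras\<close>

definition coalgebra ::
    "('k::field, 'a) module \<Rightarrow> ('a \<Rightarrow> ('a \<times> 'a \<Rightarrow>\<^sub>0 'k) set) \<Rightarrow> ('a \<Rightarrow> 'k) \<Rightarrow> bool" where
  "coalgebra C \<Delta> \<epsilon> \<longleftrightarrow> module scalars C \<and>
     lin_map C (tensor C C) \<Delta> \<and> lin_map C scalars \<epsilon> \<and>
     (\<forall>x\<in>carrier C. tensor_assoc C C C (tensor_map C C (tensor C C) C \<Delta> (\<lambda>y. y) (\<Delta> x)) =
                    tensor_map C C C (tensor C C) (\<lambda>y. y) \<Delta> (\<Delta> x)) \<and>
     (\<forall>x\<in>carrier C. tensor_lift C C C (\<lambda>y z. \<epsilon> y \<odot>\<^bsub>C\<^esub> z) (\<Delta> x) = x \<and>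
                    tensor_lift C C C (\<lambda>y z. \<epsilon> z \<odot>\<^bsub>C\<^esub> y) (\<Delta> x) = x)"

definition frobenius_algebra :: "('k::field, 'a) module \<Rightarrow> ('a \<Rightarrow> 'k) \<Rightarrow> bool" where
  "frobenius_algebra A \<phi> \<longleftrightarrow> \<phi> \<in> dual_space A \<and>
     (\<forall>f\<in>dual_space A. \<exists>b\<in>carrier A. \<forall>x\<in>carrier A. f x = \<phi> (b \<otimes>\<^bsub>A\<^esub> x))"

definition frobenius_coalgebra ::
    "('k::field, 'a) module \<Rightarrow> ('a \<Rightarrow> ('a \<times> 'a \<Rightarrow>\<^sub>0 'k) set) \<Rightarrow> 'a \<Rightarrow> bool" where
  "frobenius_coalgebra C \<Delta> t \<longleftrightarrow> t \<in> carrier C \<and>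
     carrier C = {tensor_lift C C C (\<lambda>y z. f y \<odot>\<^bsub>C\<^esub> z) (\<Delta> t) | f. f \<in> dual_space C}"

definition bi_frobenius ::
    "('k::field, 'a) module \<Rightarrow> ('a \<Rightarrow> ('a \<times> 'a \<Rightarrow>\<^sub>0 'k) set) \<Rightarrow> ('a \<Rightarrow> 'k) \<Rightarrow>
     ('a \<Rightarrow> 'k) \<Rightarrow> 'a \<Rightarrow> ('a \<Rightarrow> 'a) \<Rightarrow> bool" where
  "bi_frobenius A \<Delta> \<epsilon> \<phi> t S \<longleftrightarrow>
     assoc_algebra A \<and> fin_dim A \<and> coalgebra A \<Delta> \<epsilon> \<and>
     \<phi> \<in> dual_space A \<and> t \<in> carrier A \<and>
     lin_map A A S \<and>
     (\<forall>x\<in>carrier A. S x = tensor_lift A A A (\<lambda>y z. \<phi> (y \<otimes>\<^bsub>A\<^esub> x) \<odot>\<^bsub>A\<^esub> z) (\<Delta> t)) \<and>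
     \<epsilon> \<one>\<^bsub>A\<^esub> = 1 \<and>
     (\<forall>x\<in>carrier A. \<forall>y\<in>carrier A. \<epsilon> (x \<otimes>\<^bsub>A\<^esub> y) = \<epsilon> x * \<epsilon> y) \<and>
     \<Delta> \<one>\<^bsub>A\<^esub> = pure_tensor A A \<one>\<^bsub>A\<^esub> \<one>\<^bsub>A\<^esub> \<and>
     frobenius_algebra A \<phi> \<and> frobenius_coalgebra A \<Delta> t \<and>
     S \<one>\<^bsub>A\<^esub> = \<one>\<^bsub>A\<^esub> \<and>
     (\<forall>x\<in>carrier A. \<forall>y\<in>carrier A. S (x \<otimes>\<^bsub>A\<^esub> y) = S y \<otimes>\<^bsub>A\<^esub> S x) \<and>
     (\<forall>x\<in>carrier A. \<epsilon> (S x) = \<epsilon> x) \<and>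
     (\<forall>x\<in>carrier A. \<Delta> (S x) =
        tensor_lift A A (tensor A A) (\<lambda>y z. pure_tensor A A (S z) (S y)) (\<Delta> x))"

section \<open>Quantum complete intersections\<close>

text \<open>
  The free algebra on generators indexed by \<open>{1..n}\<close> is the monoid algebra of words.
  A separate datatype of words is used because \<open>poly_mapping\<close> multiplication takes the
  monoid of exponents from the class \<^class>\<open>monoid_add\<close>; here \<open>+\<close> is concatenation.
\<close>

datatype free_word = Word (letters: "nat list")

instantiation free_word :: monoid_add
begin
definition zero_free_word :: free_word where "0 = Word []"
definition plus_free_word :: "free_word \<Rightarrow> free_word \<Rightarrow> free_word" where
  "u + v = Word (letters u @ letters v)"
instance
  by standard (auto simp: zero_free_word_def plus_free_word_def)
end

definition free_algebra :: "nat \<Rightarrow> ('k::field, free_word \<Rightarrow>\<^sub>0 'k) module" where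
  "free_algebra n =
     \<lparr>carrier = {p. \<forall>w\<in>Poly_Mapping.keys p. set (letters w) \<subseteq> {1..n}}, mult = (*), one = 1,
      zero = 0, add = (+), smult = (\<lambda>c. Poly_Mapping.map ((*) c))\<rparr>"

definition free_gen :: "nat \<Rightarrow> free_word \<Rightarrow>\<^sub>0 'k::field" where
  "free_gen i = Poly_Mapping.single (Word [i]) 1"

definition qci_relations ::
    "nat \<Rightarrow> (nat \<Rightarrow> nat) \<Rightarrow> (nat \<Rightarrow> nat \<Rightarrow> 'k::field) \<Rightarrow> (free_word \<Rightarrow>\<^sub>0 'k) set" where
  "qci_relations n a q =
     {free_gen i ^ a i | i. i \<in> {1..n}} \<union>
     {free_gen j * free_gen i - Poly_Mapping.map ((*) (q i j)) (free_gen i * free_gen j) | i j.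
        i \<in> {1..n} \<and> j \<in> {1..n}}"

definition qci_ideal ::
    "nat \<Rightarrow> (nat \<Rightarrow> nat) \<Rightarrow> (nat \<Rightarrow> nat \<Rightarrow> 'k::field) \<Rightarrow> (free_word \<Rightarrow>\<^sub>0 'k) set" where
  "qci_ideal n a q = Idl\<^bsub>(free_algebra n :: ('k, free_word \<Rightarrow>\<^sub>0 'k) module)\<^esub> (qci_relations n a q)"

definition qci ::
    "nat \<Rightarrow> (nat \<Rightarrow> nat) \<Rightarrow> (nat \<Rightarrow> nat \<Rightarrow> 'k::field) \<Rightarrow> ('k, (free_word \<Rightarrow>\<^sub>0 'k) set) module" where
  "qci n a q = quot_module (free_algebra n) (qci_ideal n a q)"

definition qci_data :: "nat \<Rightarrow> (nat \<Rightarrow> nat) \<Rightarrow> (nat \<Rightarrow> nat \<Rightarrow> 'k::field) \<Rightarrow> bool" where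
  "qci_data n a q \<longleftrightarrow> 2 \<le> n \<and> (\<forall>i\<in>{1..n}. 2 \<le> a i) \<and> (\<forall>i\<in>{1..n}. q i i = 1) \<and>
     (\<forall>i\<in>{1..n}. \<forall>j\<in>{1..n}. q i j * q j i = 1)"

definition qci_gen ::
    "nat \<Rightarrow> (nat \<Rightarrow> nat) \<Rightarrow> (nat \<Rightarrow> nat \<Rightarrow> 'k::field) \<Rightarrow> nat \<Rightarrow> (free_word \<Rightarrow>\<^sub>0 'k) set" where
  "qci_gen n a q i =
     qci_ideal n a q +>\<^bsub>(free_algebra n :: ('k, free_word \<Rightarrow>\<^sub>0 'k) module)\<^esub> free_gen i"

text \<open>
  Vectors in \<open>\<nat>\<^sup>n\<close> are functions vanishing outside \<open>{1..n}\<close>. Only vectors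
  with nonnegative entries are needed, since \<open>a - 1 - v\<close> is formed for \<open>v\<close> in \<open>V\<close>.
\<close>

definition exps :: "nat \<Rightarrow> (nat \<Rightarrow> nat) \<Rightarrow> (nat \<Rightarrow> nat) set" where
  "exps n a = {v. (\<forall>i\<in>{1..n}. v i \<le> a i - 1) \<and> (\<forall>i. i \<notin> {1..n} \<longrightarrow> v i = 0)}"

definition unit_vec :: "nat \<Rightarrow> nat \<Rightarrow> nat" where
  "unit_vec i = (\<lambda>j. if j = i then 1 else 0)"

definition top_vec :: "nat \<Rightarrow> (nat \<Rightarrow> nat) \<Rightarrow> nat \<Rightarrow> nat" where
  "top_vec n a = (\<lambda>i. if i \<in> {1..n} then a i - 1 else 0)"

definition co_vec :: "nat \<Rightarrow> (nat \<Rightarrow> nat) \<Rightarrow> (nat \<Rightarrow> nat) \<Rightarrow> nat \<Rightarrow> nat" where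
  "co_vec n a v = (\<lambda>i. top_vec n a i - v i)"

text \<open>The ordered product \<open>x\<^sub>1\<^bsup>v\<^sub>1\<^esup> \<dots> x\<^sub>n\<^bsup>v\<^sub>n\<^esup>\<close>.\<close>

definition qci_mon ::
    "nat \<Rightarrow> (nat \<Rightarrow> nat) \<Rightarrow> (nat \<Rightarrow> nat \<Rightarrow> 'k::field) \<Rightarrow> (nat \<Rightarrow> nat) \<Rightarrow> (free_word \<Rightarrow>\<^sub>0 'k) set" where
  "qci_mon n a q v =
     foldr (\<lambda>i y. (qci_gen n a q i [^]\<^bsub>qci n a q\<^esub> v i) \<otimes>\<^bsub>qci n a q\<^esub> y) [1..<Suc n] \<one>\<^bsub>qci n a q\<^esub>"

definition qci_coord ::
    "nat \<Rightarrow> (nat \<Rightarrow> nat) \<Rightarrow> (nat \<Rightarrow> nat \<Rightarrow> 'k::field) \<Rightarrow> (free_word \<Rightarrow>\<^sub>0 'k) set \<Rightarrow>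
     (nat \<Rightarrow> nat) \<Rightarrow> 'k" where
  "qci_coord n a q x = (THE c. c \<in> exps n a \<rightarrow>\<^sub>E UNIV \<and>
     x = (\<Oplus>\<^bsub>qci n a q\<^esub>v\<in>exps n a. c v \<odot>\<^bsub>qci n a q\<^esub> qci_mon n a q v))"

text \<open>The element \<open>x\<^sub>v\<^sup>*\<close> of the dual of the standard basis.\<close>

definition qci_dual_basis ::
    "nat \<Rightarrow> (nat \<Rightarrow> nat) \<Rightarrow> (nat \<Rightarrow> nat \<Rightarrow> 'k::field) \<Rightarrow> (nat \<Rightarrow> nat) \<Rightarrow>
     (free_word \<Rightarrow>\<^sub>0 'k) set \<Rightarrow> 'k" where
  "qci_dual_basis n a q v = (\<lambda>x\<in>carrier (qci n a q). qci_coord n a q x v)"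

text \<open>The linear map into \<open>W\<close> with the prescribed value \<open>f v\<close> at each \<open>x\<^sub>v\<close>.\<close>

definition qci_extend ::
    "nat \<Rightarrow> (nat \<Rightarrow> nat) \<Rightarrow> (nat \<Rightarrow> nat \<Rightarrow> 'k::field) \<Rightarrow> ('k, 'w) module \<Rightarrow>
     ((nat \<Rightarrow> nat) \<Rightarrow> 'w) \<Rightarrow> (free_word \<Rightarrow>\<^sub>0 'k) set \<Rightarrow> 'w" where
  "qci_extend n a q W f x = (\<Oplus>\<^bsub>W\<^esub>v\<in>exps n a. qci_coord n a q x v \<odot>\<^bsub>W\<^esub> f v)"

definition perm_antipode ::
    "nat \<Rightarrow> (nat \<Rightarrow> nat) \<Rightarrow> (nat \<Rightarrow> nat \<Rightarrow> 'k::field) \<Rightarrow>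
     ((free_word \<Rightarrow>\<^sub>0 'k) set \<Rightarrow> (free_word \<Rightarrow>\<^sub>0 'k) set) \<Rightarrow> bool" where
  "perm_antipode n a q S \<longleftrightarrow> (\<exists>\<sigma> c. bij_betw \<sigma> (exps n a) (exps n a) \<and>
     (\<forall>v\<in>exps n a. S (qci_mon n a q v) = c v \<odot>\<^bsub>qci n a q\<^esub> qci_mon n a q (\<sigma> v)))"

section \<open>The structure attached to a permutation and scalars\<close>

definition qpair ::
    "nat \<Rightarrow> (nat \<Rightarrow> nat \<Rightarrow> 'k::field) \<Rightarrow> (nat \<Rightarrow> nat) \<Rightarrow> (nat \<Rightarrow> nat) \<Rightarrow> 'k" where
  "qpair n q u v = (\<Prod>(i, j)\<in>{(i, j). 1 \<le> i \<and> i < j \<and> j \<le> n}. q i j ^ (u j * v i))"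

definition h_coeff ::
    "nat \<Rightarrow> (nat \<Rightarrow> nat) \<Rightarrow> (nat \<Rightarrow> nat \<Rightarrow> 'k::field) \<Rightarrow> (nat \<Rightarrow> nat) \<Rightarrow> 'k" where
  "h_coeff n a q v = qpair n q (co_vec n a v) v / qpair n q v (co_vec n a v)"

definition perm_act :: "(nat \<Rightarrow> nat) \<Rightarrow> (nat \<Rightarrow> nat) \<Rightarrow> nat \<Rightarrow> nat" where
  "perm_act \<pi> v = (\<lambda>i. v (inv_into UNIV \<pi> i))"

definition compatible ::
    "nat \<Rightarrow> (nat \<Rightarrow> nat) \<Rightarrow> (nat \<Rightarrow> nat \<Rightarrow> 'k::field) \<Rightarrow> (nat \<Rightarrow> nat) \<Rightarrow> bool" where
  "compatible n a q \<pi> \<longleftrightarrow> (\<forall>i\<in>{1..n}. a (\<pi> i) = a i) \<and>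
     (\<forall>i\<in>{1..n}. \<forall>j\<in>{1..n}. q (\<pi> i) (\<pi> j) = q j i)"

definition q_perm ::
    "nat \<Rightarrow> (nat \<Rightarrow> nat) \<Rightarrow> (nat \<Rightarrow> nat \<Rightarrow> 'k::field) \<Rightarrow> (nat \<Rightarrow> nat) \<Rightarrow> 'k" where
  "q_perm n a q \<pi> = (\<Prod>(j, k)\<in>{(j, k). 1 \<le> j \<and> j < k \<and> k \<le> n}.
     qpair n q (perm_act \<pi> (unit_vec k)) (perm_act \<pi> (unit_vec j)) ^ ((a k - 1) * (a j - 1)))"

definition antipode_coeff ::
    "nat \<Rightarrow> (nat \<Rightarrow> nat \<Rightarrow> 'k::field) \<Rightarrow> (nat \<Rightarrow> nat) \<Rightarrow> (nat \<Rightarrow> 'k) \<Rightarrow> (nat \<Rightarrow> nat) \<Rightarrow> 'k" where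
  "antipode_coeff n q \<pi> c v = (\<Prod>i\<in>{1..n}. c i ^ v i) *
     (\<Prod>(j, k)\<in>{(j, k). 1 \<le> j \<and> j < k \<and> k \<le> n}.
        qpair n q (perm_act \<pi> (unit_vec k)) (perm_act \<pi> (unit_vec j)) ^ (v j * v k))"

text \<open>\<open>g_coeff n a q \<pi> c v\<close> is the coefficient indexed by the pair \<open>(a - 1 - v, \<pi>(v))\<close>.\<close>

definition g_coeff ::
    "nat \<Rightarrow> (nat \<Rightarrow> nat) \<Rightarrow> (nat \<Rightarrow> nat \<Rightarrow> 'k::field) \<Rightarrow> (nat \<Rightarrow> nat) \<Rightarrow> (nat \<Rightarrow> 'k) \<Rightarrow>
     (nat \<Rightarrow> nat) \<Rightarrow> 'k" where
  "g_coeff n a q \<pi> c v = 1 / qpair n q (co_vec n a v) v * antipode_coeff n q \<pi> c v"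

definition qci_counit ::
    "nat \<Rightarrow> (nat \<Rightarrow> nat) \<Rightarrow> (nat \<Rightarrow> nat \<Rightarrow> 'k::field) \<Rightarrow> (free_word \<Rightarrow>\<^sub>0 'k) set \<Rightarrow> 'k" where
  "qci_counit n a q = qci_extend n a q scalars (\<lambda>v. if v = (\<lambda>_. 0) then 1 else 0)"

definition qci_comult ::
    "nat \<Rightarrow> (nat \<Rightarrow> nat) \<Rightarrow> (nat \<Rightarrow> nat \<Rightarrow> 'k::field) \<Rightarrow> (nat \<Rightarrow> nat) \<Rightarrow> (nat \<Rightarrow> 'k) \<Rightarrow>
     (free_word \<Rightarrow>\<^sub>0 'k) set \<Rightarrow> ((free_word \<Rightarrow>\<^sub>0 'k) set \<times> (free_word \<Rightarrow>\<^sub>0 'k) set \<Rightarrow>\<^sub>0 'k) set" where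
  "qci_comult n a q \<pi> c =
     (let A = qci n a q; AA = tensor A A in
      qci_extend n a q AA
        (\<lambda>v. if v = (\<lambda>_. 0) then pure_tensor A A \<one>\<^bsub>A\<^esub> \<one>\<^bsub>A\<^esub>
             else if v = top_vec n a then
               (\<Oplus>\<^bsub>AA\<^esub>w\<in>exps n a. g_coeff n a q \<pi> c w \<odot>\<^bsub>AA\<^esub>
                  pure_tensor A A (qci_mon n a q (co_vec n a w)) (qci_mon n a q (perm_act \<pi> w)))
             else pure_tensor A A \<one>\<^bsub>A\<^esub> (qci_mon n a q v) \<oplus>\<^bsub>AA\<^esub>
                  pure_tensor A A (qci_mon n a q v) \<one>\<^bsub>A\<^esub>))"

definition qci_antipode ::
    "nat \<Rightarrow> (nat \<Rightarrow> nat) \<Rightarrow> (nat \<Rightarrow> nat \<Rightarrow> 'k::field) \<Rightarrow> (nat \<Rightarrow> nat) \<Rightarrow> (nat \<Rightarrow> 'k) \<Rightarrow>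
     (free_word \<Rightarrow>\<^sub>0 'k) set \<Rightarrow> (free_word \<Rightarrow>\<^sub>0 'k) set" where
  "qci_antipode n a q \<pi> c = qci_extend n a q (qci n a q)
     (\<lambda>v. antipode_coeff n q \<pi> c v \<odot>\<^bsub>qci n a q\<^esub> qci_mon n a q (perm_act \<pi> v))"

end

theory Submission
  imports Defs
begin

text \<open>
  Write $x_u x_v = q^{\langle u|v\rangle} x_{u+v}$ for the multiplication of the standard basis, where
  the product is $0$ if $u+v$ leaves $V$. Everything rests on this rule, on the fact that the $x_v$
  are a basis, and on the universal property of the tensor product.

  \<^bold>\<open>Basis.\<close> Sorting the letters of a word costs a scalar, which is a cocycle for concatenation
  (\<open>word_wt_append\<close>). So reading off, for each \<open>v\<close> in \<open>V\<close>, the weighted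
  coefficients of the words with content \<open>v\<close> is a linear map whose kernel is a two-sided
  ideal (\<open>coord_kernel_ideal\<close>). This kernel contains the defining relations, so the
  map descends to the quotient, where it separates the $x_v$.

  \<^bold>\<open>From an antipode to an involution.\<close> Applying $\varepsilon$ to the formula for \<open>S\<close> shows
  that \<open>t\<close> is an integral, hence a multiple of the socle element $x_{a-1}$ (\<open>t_eq\<close>). Then
  \<open>S t = t\<close>, so the tensor $\Delta(t)$ is invariant under flipping and applying \<open>S\<close> to
  both legs. This makes \<open>S\<close> surjective and $S^2$ a Nakayama automorphism:
  $\phi(xw) = \phi(S^2(w)x)$ (\<open>nakayama_S_squared\<close>). If $S(x_v) = c_v x_{\sigma(v)}$ with all
  $c_v \neq 0$, multiplicativity makes $\sigma$ additive, so it permutes the unit vectors, and the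
  resulting permutation $\pi$ of the indices is compatible because \<open>S\<close> reverses products. If
  $\pi^2(i) = k \neq i$, then $\phi(x_{a-1-e_i} x_i)$ is nonzero while it equals a multiple of
  $\phi(x_k x_{a-1-e_i}) = 0$.

  \<^bold>\<open>From an involution to a structure.\<close> Symmetry of \<open>A\<close> gives
  $q^{\langle u|v\rangle} = q^{\langle v|u\rangle}$ for $u+v = a-1$ (\<open>symmetric_qp\<close>), so all
  $h_{e_i}$ are $1$. One has $q_\pi^2 = 1$, and $q_\pi = 1$ unless some index fixed by $\pi$ has odd
  $a_i - 1$; so scalars $c_i \in \{1,-1\}$ with the required properties exist
  (\<open>exists_scalars\<close>). The coefficient $s(v)$ of $S(x_v)$ satisfies
  $q^{\langle u|v\rangle} s(u+v) = s(u) s(v) q^{\langle \pi v|\pi u\rangle}$ and $s(v) s(\pi v) = 1$.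
  Both are checked on unit vectors, since their ingredients are multiplicative in \<open>u\<close> and
  \<open>v\<close>. The first says that \<open>S\<close> reverses products; the second, together with the symmetry of
  \<open>A\<close>, that it reverses the coproduct of $x_{a-1}$. Coassociativity is automatic: the basis
  elements other than $1$ and $x_{a-1}$ are primitive, and $\Delta(x_{a-1})$ has the two outer terms $x_{a-1} \otimes 1$ and $1 \otimes x_{a-1}$ with coefficient $1$.
\<close>

section \<open>Vector spaces and linear maps\<close>

abbreviation vspace :: "('k::field, 'a) module \<Rightarrow> bool" where
  "vspace M \<equiv> module (scalars :: ('k, 'k) module) M"

lemma scalars_simps [simp]:
  "carrier scalars = UNIV" "x \<otimes>\<^bsub>scalars\<^esub> y = x * y" "\<one>\<^bsub>scalars\<^esub> = 1" "\<zero>\<^bsub>scalars\<^esub> = 0"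
  "x \<oplus>\<^bsub>scalars\<^esub> y = x + y" "x \<odot>\<^bsub>scalars\<^esub> y = x * y"
  by (simp_all add: scalars_def)

lemma cring_scalars: "cring (scalars :: ('k::field, 'k) module)"
  by (intro cringI abelian_groupI comm_monoidI)
    (auto simp: algebra_simps intro: exI[of _ "- x" for x] add.left_inverse)

lemma vspaceI:
  fixes M :: "('k::field, 'a) module"
  assumes "\<And>x y. x \<in> carrier M \<Longrightarrow> y \<in> carrier M \<Longrightarrow> x \<oplus>\<^bsub>M\<^esub> y \<in> carrier M"
    and "\<zero>\<^bsub>M\<^esub> \<in> carrier M"
    and "\<And>x y z. x \<in> carrier M \<Longrightarrow> y \<in> carrier M \<Longrightarrow> z \<in> carrier M \<Longrightarrow>
           (x \<oplus>\<^bsub>M\<^esub> y) \<oplus>\<^bsub>M\<^esub> z = x \<oplus>\<^bsub>M\<^esub> (y \<oplus>\<^bsub>M\<^esub> z)"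
    and "\<And>x y. x \<in> carrier M \<Longrightarrow> y \<in> carrier M \<Longrightarrow> x \<oplus>\<^bsub>M\<^esub> y = y \<oplus>\<^bsub>M\<^esub> x"
    and "\<And>x. x \<in> carrier M \<Longrightarrow> \<zero>\<^bsub>M\<^esub> \<oplus>\<^bsub>M\<^esub> x = x"
    and "\<And>x. x \<in> carrier M \<Longrightarrow> (-1) \<odot>\<^bsub>M\<^esub> x \<oplus>\<^bsub>M\<^esub> x = \<zero>\<^bsub>M\<^esub>"
    and "\<And>c x. x \<in> carrier M \<Longrightarrow> c \<odot>\<^bsub>M\<^esub> x \<in> carrier M"
    and "\<And>c d x. x \<in> carrier M \<Longrightarrow> (c + d) \<odot>\<^bsub>M\<^esub> x = c \<odot>\<^bsub>M\<^esub> x \<oplus>\<^bsub>M\<^esub> d \<odot>\<^bsub>M\<^esub> x"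
    and "\<And>c x y. x \<in> carrier M \<Longrightarrow> y \<in> carrier M \<Longrightarrow>
           c \<odot>\<^bsub>M\<^esub> (x \<oplus>\<^bsub>M\<^esub> y) = c \<odot>\<^bsub>M\<^esub> x \<oplus>\<^bsub>M\<^esub> c \<odot>\<^bsub>M\<^esub> y"
    and "\<And>c d x. x \<in> carrier M \<Longrightarrow> (c * d) \<odot>\<^bsub>M\<^esub> x = c \<odot>\<^bsub>M\<^esub> (d \<odot>\<^bsub>M\<^esub> x)"
    and "\<And>x. x \<in> carrier M \<Longrightarrow> 1 \<odot>\<^bsub>M\<^esub> x = x"
  shows "vspace M"
proof (rule moduleI)
  show "abelian_group M"
  proof (rule abelian_groupI)
    show "\<exists>y\<in>carrier M. y \<oplus>\<^bsub>M\<^esub> x = \<zero>\<^bsub>M\<^esub>" if "x \<in> carrier M" for x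
      using assms(6,7)[OF that] by blast
  qed (fact assms(1-5))+
qed (auto simp: cring_scalars assms)

lemma vspace_scalars: "vspace (scalars :: ('k::field, 'k) module)"
  by (rule vspaceI) (auto simp: algebra_simps)

lemma vspace_uminus:
  assumes M: "vspace M" and x: "x \<in> carrier M"
  shows "\<ominus>\<^bsub>M\<^esub> x = (-1) \<odot>\<^bsub>M\<^esub> x"
proof -
  interpret M: module scalars M by fact
  have "(-1) \<odot>\<^bsub>M\<^esub> x \<oplus>\<^bsub>M\<^esub> x = (-1 + 1) \<odot>\<^bsub>M\<^esub> x"
    using M.smult_l_distr[of "-1" 1 x] M.smult_one[of x] x by simp
  also have "\<dots> = \<zero>\<^bsub>M\<^esub>" using M.smult_l_null[of x] x by simp
  finally show ?thesis using x M.smult_closed[of "-1" x] by (intro M.M.minus_equality) auto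
qed

lemma vspace_submoduleI:
  fixes M :: "('k::field, 'a) module"
  assumes M: "vspace M" and "H \<subseteq> carrier M" "\<zero>\<^bsub>M\<^esub> \<in> H"
    and "\<And>x y. x \<in> H \<Longrightarrow> y \<in> H \<Longrightarrow> x \<oplus>\<^bsub>M\<^esub> y \<in> H" "\<And>c x. x \<in> H \<Longrightarrow> c \<odot>\<^bsub>M\<^esub> x \<in> H"
  shows "submodule H (scalars :: ('k, 'k) module) M"
proof -
  interpret M: module scalars M by fact
  show ?thesis
    by (rule M.submoduleI) (use assms in \<open>auto simp: vspace_uminus[OF M]\<close>)
qed

lemma finsum_scalars:
  fixes f :: "'i \<Rightarrow> 'k::field"
  shows "(\<Oplus>\<^bsub>(scalars :: ('k, 'k) module)\<^esub>i\<in>I. f i) = sum f I"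
proof -
  interpret module "scalars :: ('k, 'k) module" "scalars :: ('k, 'k) module" by (rule vspace_scalars)
  show ?thesis
    by (induction I rule: infinite_finite_induct) (simp_all add: R.finsum_infinite)
qed

lemma lin_mapI:
  assumes "\<And>x. x \<in> carrier M \<Longrightarrow> f x \<in> carrier N"
    and "\<And>x y. x \<in> carrier M \<Longrightarrow> y \<in> carrier M \<Longrightarrow> f (x \<oplus>\<^bsub>M\<^esub> y) = f x \<oplus>\<^bsub>N\<^esub> f y"
    and "\<And>c x. x \<in> carrier M \<Longrightarrow> f (c \<odot>\<^bsub>M\<^esub> x) = c \<odot>\<^bsub>N\<^esub> f x"
  shows "lin_map M N f"
  using assms by (auto simp: lin_map_def)

lemma lin_mapD:
  assumes "lin_map M N f" "x \<in> carrier M"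
  shows "f x \<in> carrier N"
    and "y \<in> carrier M \<Longrightarrow> f (x \<oplus>\<^bsub>M\<^esub> y) = f x \<oplus>\<^bsub>N\<^esub> f y"
    and "f (c \<odot>\<^bsub>M\<^esub> x) = c \<odot>\<^bsub>N\<^esub> f x"
  using assms by (auto simp: lin_map_def)

lemma lin_map_ident: "lin_map M M (\<lambda>x. x)"
  by (simp add: lin_map_def)

lemma lin_map_comp:
  assumes "lin_map M N f" "lin_map N P g"
  shows "lin_map M P (\<lambda>x. g (f x))"
  by (rule lin_mapI) (simp_all add: lin_mapD[OF assms(1)] lin_mapD[OF assms(2)])

lemma lin_map_cong:
  assumes "vspace M" "lin_map M N f" "\<And>x. x \<in> carrier M \<Longrightarrow> f x = g x"
  shows "lin_map M N g"
proof -
  interpret M: module scalars M by fact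
  show ?thesis
    by (rule lin_mapI) (use assms lin_mapD[OF assms(2)] in \<open>auto simp flip: assms(3)\<close>)
qed

lemma lin_map_add:
  assumes "vspace N" "lin_map M N f" "lin_map M N g"
  shows "lin_map M N (\<lambda>x. f x \<oplus>\<^bsub>N\<^esub> g x)"
proof -
  interpret N: module scalars N by fact
  show ?thesis
    by (rule lin_mapI) (use lin_mapD[OF assms(2)] lin_mapD[OF assms(3)]
        in \<open>auto simp: N.M.a_ac N.smult_r_distr\<close>)
qed

lemma lin_map_smult:
  assumes "vspace N" "lin_map M N f"
  shows "lin_map M N (\<lambda>x. c \<odot>\<^bsub>N\<^esub> f x)"
proof -
  interpret N: module scalars N by fact
  show ?thesis
    by (rule lin_mapI) (use lin_mapD[OF assms(2)]
        in \<open>auto simp: N.smult_r_distr mult.commute simp flip: N.smult_assoc1[simplified]\<close>)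
qed

lemma lin_map_zero:
  assumes "vspace M" "vspace N" "lin_map M N f"
  shows "f \<zero>\<^bsub>M\<^esub> = \<zero>\<^bsub>N\<^esub>"
proof -
  interpret M: module scalars M by fact
  interpret N: module scalars N by fact
  have "f (0 \<odot>\<^bsub>M\<^esub> \<zero>\<^bsub>M\<^esub>) = 0 \<odot>\<^bsub>N\<^esub> f \<zero>\<^bsub>M\<^esub>"
    by (rule lin_mapD(3)[OF assms(3)]) simp
  thus ?thesis
    using M.smult_l_null[of "\<zero>\<^bsub>M\<^esub>"] N.smult_l_null[of "f \<zero>\<^bsub>M\<^esub>"] lin_mapD(1)[OF assms(3), of "\<zero>\<^bsub>M\<^esub>"] by simp
qed

lemma lin_map_finsum:
  assumes "vspace M" "vspace N" "lin_map M N f" "g \<in> I \<rightarrow> carrier M"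
  shows "f (\<Oplus>\<^bsub>M\<^esub>i\<in>I. g i) = (\<Oplus>\<^bsub>N\<^esub>i\<in>I. f (g i))"
proof -
  interpret M: module scalars M by fact
  interpret N: module scalars N by fact
  note D = lin_mapD[OF assms(3)]
  show ?thesis using assms(4)
  proof (induction I rule: infinite_finite_induct)
    case (infinite I)
    then show ?case
      using lin_map_zero[OF assms(1-3)] by (simp add: M.finsum_infinite N.finsum_infinite)
  next
    case empty
    then show ?case using lin_map_zero[OF assms(1-3)] by simp
  next
    case (insert i I)
    then show ?case
      using D by (subst M.finsum_insert N.finsum_insert; auto)+
  qed
qed

lemma lin_map_finsumI:
  assumes "vspace N" "\<And>i. i \<in> I \<Longrightarrow> lin_map M N (f i)" "finite I"
  shows "lin_map M N (\<lambda>x. \<Oplus>\<^bsub>N\<^esub>i\<in>I. f i x)"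
proof -
  interpret N: module scalars N by fact
  show ?thesis
  proof (rule lin_mapI)
    fix x y c assume x: "x \<in> carrier M"
    have fx: "(\<lambda>i. f i x) \<in> I \<rightarrow> carrier N" using lin_mapD(1)[OF assms(2)] x by auto
    then show "(\<Oplus>\<^bsub>N\<^esub>i\<in>I. f i x) \<in> carrier N" by simp
    show "(\<Oplus>\<^bsub>N\<^esub>i\<in>I. f i (c \<odot>\<^bsub>M\<^esub> x)) = c \<odot>\<^bsub>N\<^esub> (\<Oplus>\<^bsub>N\<^esub>i\<in>I. f i x)"
      using fx x assms
      by (subst N.finsum_smult_ldistr) (auto intro!: N.finsum_cong' simp: lin_mapD(3)[OF assms(2)] Pi_def)
    assume y: "y \<in> carrier M"
    have fy: "(\<lambda>i. f i y) \<in> I \<rightarrow> carrier N" using lin_mapD(1)[OF assms(2)] y by auto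
    show "(\<Oplus>\<^bsub>N\<^esub>i\<in>I. f i (x \<oplus>\<^bsub>M\<^esub> y)) = (\<Oplus>\<^bsub>N\<^esub>i\<in>I. f i x) \<oplus>\<^bsub>N\<^esub> (\<Oplus>\<^bsub>N\<^esub>i\<in>I. f i y)"
    proof -
      have "(\<Oplus>\<^bsub>N\<^esub>i\<in>I. f i (x \<oplus>\<^bsub>M\<^esub> y)) = (\<Oplus>\<^bsub>N\<^esub>i\<in>I. f i x \<oplus>\<^bsub>N\<^esub> f i y)"
        using fx fy x y by (intro N.finsum_cong') (auto simp: lin_mapD(2)[OF assms(2)])
      also have "\<dots> = (\<Oplus>\<^bsub>N\<^esub>i\<in>I. f i x) \<oplus>\<^bsub>N\<^esub> (\<Oplus>\<^bsub>N\<^esub>i\<in>I. f i y)"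
        by (rule N.finsum_addf[OF fx fy])
      finally show ?thesis .
    qed
  qed
qed

lemma lin_map_finsum_coeffs:
  assumes "vspace N" "\<And>i. i \<in> I \<Longrightarrow> lin_map M scalars (\<lambda>x. f x i)" "finite I" "g \<in> I \<rightarrow> carrier N"
  shows "lin_map M N (\<lambda>x. \<Oplus>\<^bsub>N\<^esub>i\<in>I. f x i \<odot>\<^bsub>N\<^esub> g i)"
proof (rule lin_map_finsumI[OF assms(1) _ assms(3)])
  interpret N: module scalars N by fact
  fix i assume i: "i \<in> I"
  note D = lin_mapD[OF assms(2)[OF i], simplified]
  have g: "g i \<in> carrier N" using assms(4) i by auto
  show "lin_map M N (\<lambda>x. f x i \<odot>\<^bsub>N\<^esub> g i)"
    by (rule lin_mapI)
       (auto simp: D g N.smult_l_distr[simplified] N.smult_assoc1[simplified])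
qed

section \<open>Quotients of vector spaces\<close>

context
  fixes M :: "('k::field, 'a) module" and H :: "'a set"
  assumes M: "vspace M" and H: "submodule H (scalars :: ('k, 'k) module) M"
begin

interpretation M: module scalars M by (rule M)

interpretation S: submodule H scalars M by (rule H)

interpretation A: abelian_subgroup H M
  by (rule abelian_subgroupI3) (use H M.abelian_group_axioms in
     \<open>auto simp: additive_subgroup_def submodule_def\<close>)

lemma quot_mem_coset:
  assumes "x \<in> carrier M"
  shows "y \<in> H +>\<^bsub>M\<^esub> x \<longleftrightarrow> y \<in> carrier M \<and> H +>\<^bsub>M\<^esub> y = H +>\<^bsub>M\<^esub> x"
proof
  assume y: "y \<in> H +>\<^bsub>M\<^esub> x"
  have "H +>\<^bsub>M\<^esub> x = H +>\<^bsub>M\<^esub> y"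
    by (rule M.a_repr_independence[OF y assms A.a_subgroup])
  with y show "y \<in> carrier M \<and> H +>\<^bsub>M\<^esub> y = H +>\<^bsub>M\<^esub> x"
    using M.a_r_coset_subset_G[OF A.a_subset assms] by auto
next
  assume "y \<in> carrier M \<and> H +>\<^bsub>M\<^esub> y = H +>\<^bsub>M\<^esub> x"
  thus "y \<in> H +>\<^bsub>M\<^esub> x" using A.a_rcos_self[of y] by auto
qed

lemma quot_coset_eq_iff:
  assumes "x \<in> carrier M" "y \<in> carrier M"
  shows "H +>\<^bsub>M\<^esub> x = H +>\<^bsub>M\<^esub> y \<longleftrightarrow> x \<ominus>\<^bsub>M\<^esub> y \<in> H"
proof -
  have "x \<in> H +>\<^bsub>M\<^esub> y \<longleftrightarrow> x \<ominus>\<^bsub>M\<^esub> y \<in> H"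
    using A.a_rcos_module[OF assms(2,1)] by (simp add: a_minus_def)
  thus ?thesis using quot_mem_coset[OF assms(2), of x] assms(1) by auto
qed

lemma quot_carrier: "carrier (quot_module M H) = (\<lambda>x. H +>\<^bsub>M\<^esub> x) ` carrier M"
  by (auto simp: quot_module_def FactRing_def A_RCOSETS_defs a_r_coset_def)

lemma quot_coset_closed: "x \<in> carrier M \<Longrightarrow> H +>\<^bsub>M\<^esub> x \<in> carrier (quot_module M H)"
  by (simp add: quot_carrier)

lemma quot_add:
  "x \<in> carrier M \<Longrightarrow> y \<in> carrier M \<Longrightarrow>
     (H +>\<^bsub>M\<^esub> x) \<oplus>\<^bsub>quot_module M H\<^esub> (H +>\<^bsub>M\<^esub> y) = H +>\<^bsub>M\<^esub> (x \<oplus>\<^bsub>M\<^esub> y)"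
  by (simp add: quot_module_def FactRing_def A.a_rcos_sum)

lemma quot_zero: "\<zero>\<^bsub>quot_module M H\<^esub> = H +>\<^bsub>M\<^esub> \<zero>\<^bsub>M\<^esub>"
  by (simp add: quot_module_def FactRing_def M.a_coset_add_zero A.a_subset)

lemma quot_smult:
  assumes x: "x \<in> carrier M"
  shows "c \<odot>\<^bsub>quot_module M H\<^esub> (H +>\<^bsub>M\<^esub> x) = H +>\<^bsub>M\<^esub> (c \<odot>\<^bsub>M\<^esub> x)"
proof -
  have "H +>\<^bsub>M\<^esub> (c \<odot>\<^bsub>M\<^esub> y) = H +>\<^bsub>M\<^esub> (c \<odot>\<^bsub>M\<^esub> x)" if "y \<in> H +>\<^bsub>M\<^esub> x" for y
  proof -
    have y: "y \<in> carrier M" and e: "H +>\<^bsub>M\<^esub> y = H +>\<^bsub>M\<^esub> x"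
      using that quot_mem_coset[OF x] by blast+
    from e have "y \<ominus>\<^bsub>M\<^esub> x \<in> H" using quot_coset_eq_iff[OF y x] by blast
    hence "c \<odot>\<^bsub>M\<^esub> (y \<ominus>\<^bsub>M\<^esub> x) \<in> H" by (intro S.smult_closed) simp_all
    moreover have "c \<odot>\<^bsub>M\<^esub> (y \<ominus>\<^bsub>M\<^esub> x) = c \<odot>\<^bsub>M\<^esub> y \<ominus>\<^bsub>M\<^esub> c \<odot>\<^bsub>M\<^esub> x"
      using x y M.smult_r_distr[of c y "\<ominus>\<^bsub>M\<^esub> x"] M.smult_r_minus[of c x]
      unfolding a_minus_def by simp
    ultimately show ?thesis using quot_coset_eq_iff[of "c \<odot>\<^bsub>M\<^esub> y" "c \<odot>\<^bsub>M\<^esub> x"] x y by simp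
  qed
  moreover have "H +>\<^bsub>M\<^esub> x \<noteq> {}" using A.a_rcos_self[OF x] by blast
  ultimately have "(\<Union>y\<in>H +>\<^bsub>M\<^esub> x. H +>\<^bsub>M\<^esub> (c \<odot>\<^bsub>M\<^esub> y)) = H +>\<^bsub>M\<^esub> (c \<odot>\<^bsub>M\<^esub> x)"
    by (intro SUP_eq_const) auto
  thus ?thesis by (simp add: quot_module_def)
qed

lemma vspace_quot: "vspace (quot_module M H)"
proof (rule vspaceI, goal_cases)
  case (6 X)
  then obtain x where x: "x \<in> carrier M" "X = H +>\<^bsub>M\<^esub> x" by (auto simp: quot_carrier)
  have "(-1) \<odot>\<^bsub>M\<^esub> x \<oplus>\<^bsub>M\<^esub> x = (-1 + 1) \<odot>\<^bsub>M\<^esub> x"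
    using M.smult_l_distr[of "-1" 1 x] M.smult_one[of x] x by simp
  then show ?case
    using x M.smult_l_null[of x] by (simp add: quot_add quot_smult quot_zero)
qed (auto simp: quot_carrier quot_add quot_zero quot_smult M.a_ac M.smult_r_distr
        M.smult_l_distr[simplified] M.smult_assoc1[simplified] M.smult_one[simplified])

lemma lin_map_coset: "lin_map M (quot_module M H) (\<lambda>x. H +>\<^bsub>M\<^esub> x)"
  by (rule lin_mapI) (auto simp: quot_coset_closed quot_add quot_smult)

text \<open>A linear map that vanishes on the subspace is constant on each coset, so \<^const>\<open>the_elem\<close> of its
  image on a coset is its value at any representative. This is how both \<^const>\<open>tensor_lift\<close> and the
  coordinates below are computed.\<close>

lemma image_coset:
  assumes N: "vspace N" and f: "lin_map M N f" and z: "\<And>x. x \<in> H \<Longrightarrow> f x = \<zero>\<^bsub>N\<^esub>"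
    and x: "x \<in> carrier M"
  shows "f ` (H +>\<^bsub>M\<^esub> x) = {f x}"
proof -
  interpret N: module scalars N by fact
  have "f y = f x" if "y \<in> H +>\<^bsub>M\<^esub> x" for y
  proof -
    from that obtain h where h: "h \<in> H" "y = h \<oplus>\<^bsub>M\<^esub> x"
      by (auto simp: a_r_coset_def')
    thus ?thesis using z[OF h(1)] lin_mapD[OF f] x N.M.l_zero by (simp add: A.a_Hcarr)
  qed
  moreover have "x \<in> H +>\<^bsub>M\<^esub> x" using x by (rule A.a_rcos_self)
  ultimately show ?thesis by blast
qed

end

section \<open>Spaces of finitely supported functions\<close>

text \<open>A predicate rather than a space, since it is meant to cover \<^const>\<open>free_space\<close> and
  \<^const>\<open>free_algebra\<close> alike: they agree as vector spaces and differ in their multiplication.\<close>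

definition finsupp_space :: "('k::field, 'x \<Rightarrow>\<^sub>0 'k) module \<Rightarrow> 'x set \<Rightarrow> bool" where
  "finsupp_space F X \<longleftrightarrow> carrier F = {p. Poly_Mapping.keys p \<subseteq> X} \<and> add F = (+) \<and> zero F = 0 \<and>
     smult F = (\<lambda>c. Poly_Mapping.map ((*) c))"

lemma lookup_scale [simp]:
  "Poly_Mapping.lookup (Poly_Mapping.map ((*) (c::'k::field)) p) x = c * Poly_Mapping.lookup p x"
  by (simp add: Poly_Mapping.map.rep_eq when_def)

lemma keys_scale: "Poly_Mapping.keys (Poly_Mapping.map ((*) (c::'k::field)) p) \<subseteq> Poly_Mapping.keys p"
  by (auto simp: in_keys_iff)

lemma vspace_finsupp_space:
  assumes "finsupp_space F X"
  shows "vspace F"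
proof -
  note F = assms[unfolded finsupp_space_def]
  show ?thesis
    by (rule vspaceI)
       (use F keys_scale keys_add in \<open>auto simp: algebra_simps lookup_add
          intro!: poly_mapping_eqI subset_trans[OF keys_add] subset_trans[OF keys_scale]\<close>)
qed

lemma finsum_finsupp_space:
  assumes F: "finsupp_space F X" and "g \<in> I \<rightarrow> carrier F"
  shows "(\<Oplus>\<^bsub>F\<^esub>i\<in>I. g i) = sum g I"
proof -
  interpret F: module scalars F by (rule vspace_finsupp_space[OF F])
  have [simp]: "x \<oplus>\<^bsub>F\<^esub> y = x + y" "\<zero>\<^bsub>F\<^esub> = 0" for x y
    using F by (auto simp: finsupp_space_def)
  show ?thesis using assms(2)
  proof (induction I rule: infinite_finite_induct)
    case (insert i I)
    then show ?case by (subst F.finsum_insert) auto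
  qed (auto simp: F.finsum_infinite)
qed

lemma finsupp_space_minus:
  assumes F: "finsupp_space F X" and pr: "p \<in> carrier F" "r \<in> carrier F"
  shows "p \<ominus>\<^bsub>F\<^esub> r = p - r"
proof -
  have "\<ominus>\<^bsub>F\<^esub> r = (-1) \<odot>\<^bsub>F\<^esub> r"
    by (rule vspace_uminus[OF vspace_finsupp_space[OF F] pr(2)])
  also have "\<dots> = - r" using F by (auto simp: finsupp_space_def intro!: poly_mapping_eqI)
  finally show ?thesis using F by (simp add: a_minus_def finsupp_space_def)
qed

lemma sum_single_lookup:
  "(\<Sum>z\<in>Poly_Mapping.keys p. Poly_Mapping.single z (Poly_Mapping.lookup p z)) = p"
  by (rule poly_mapping_eqI)
     (auto simp: lookup_sum lookup_single when_def in_keys_iff sum.delta)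

definition lin_ext :: "('k::field, 'b) module \<Rightarrow> ('x \<Rightarrow> 'b) \<Rightarrow> ('x \<Rightarrow>\<^sub>0 'k) \<Rightarrow> 'b" where
  "lin_ext P \<beta> p = (\<Oplus>\<^bsub>P\<^esub>z\<in>Poly_Mapping.keys p. Poly_Mapping.lookup p z \<odot>\<^bsub>P\<^esub> \<beta> z)"

lemma lin_ext_superset:
  assumes P: "vspace P" and "finite Z" "Poly_Mapping.keys p \<subseteq> Z" "\<beta> \<in> Z \<rightarrow> carrier P"
  shows "lin_ext P \<beta> p = (\<Oplus>\<^bsub>P\<^esub>z\<in>Z. Poly_Mapping.lookup p z \<odot>\<^bsub>P\<^esub> \<beta> z)"
proof -
  interpret P: module scalars P by fact
  have "Poly_Mapping.lookup p z \<odot>\<^bsub>P\<^esub> \<beta> z = \<zero>\<^bsub>P\<^esub>" if "z \<in> Z - Poly_Mapping.keys p" for z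
    using that assms(4) P.smult_l_null by (auto simp: in_keys_iff Pi_def)
  thus ?thesis unfolding lin_ext_def
    using assms by (intro P.add.finprod_mono_neutral_cong_left) (auto simp: Pi_def)
qed

lemma lin_map_lin_ext:
  assumes F: "finsupp_space F X" and P: "vspace P" and \<beta>: "\<beta> \<in> X \<rightarrow> carrier P"
  shows "lin_map F P (lin_ext P \<beta>)"
proof -
  interpret P: module scalars P by fact
  have [simp]: "x \<oplus>\<^bsub>F\<^esub> y = x + y" "c \<odot>\<^bsub>F\<^esub> x = Poly_Mapping.map ((*) c) x"
    "carrier F = {p. Poly_Mapping.keys p \<subseteq> X}" for x y c
    using F by (auto simp: finsupp_space_def)
  show ?thesis
  proof (rule lin_mapI)
    fix x y c assume "x \<in> carrier F"
    hence x: "Poly_Mapping.keys x \<subseteq> X" by simp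
    have \<beta>x: "\<beta> \<in> Poly_Mapping.keys x \<rightarrow> carrier P" using \<beta> x by auto
    thus "lin_ext P \<beta> x \<in> carrier P" unfolding lin_ext_def by (intro P.finsum_closed) auto
    have "lin_ext P \<beta> (c \<odot>\<^bsub>F\<^esub> x) = (\<Oplus>\<^bsub>P\<^esub>z\<in>Poly_Mapping.keys x. (c * Poly_Mapping.lookup x z) \<odot>\<^bsub>P\<^esub> \<beta> z)"
      by (subst lin_ext_superset[OF P finite_keys _ \<beta>x]) (auto dest: subsetD[OF keys_scale])
    also have "\<dots> = (\<Oplus>\<^bsub>P\<^esub>z\<in>Poly_Mapping.keys x. c \<odot>\<^bsub>P\<^esub> (Poly_Mapping.lookup x z \<odot>\<^bsub>P\<^esub> \<beta> z))"
      using \<beta>x P.smult_assoc1 by (intro P.finsum_cong') (auto simp: Pi_def)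
    also have "\<dots> = c \<odot>\<^bsub>P\<^esub> lin_ext P \<beta> x"
      unfolding lin_ext_def using \<beta>x by (intro P.finsum_smult_ldistr[symmetric]) auto
    finally show "lin_ext P \<beta> (c \<odot>\<^bsub>F\<^esub> x) = c \<odot>\<^bsub>P\<^esub> lin_ext P \<beta> x" .
    assume "y \<in> carrier F"
    hence y: "Poly_Mapping.keys y \<subseteq> X" by simp
    let ?Z = "Poly_Mapping.keys x \<union> Poly_Mapping.keys y"
    have \<beta>Z: "\<beta> \<in> ?Z \<rightarrow> carrier P" using \<beta> x y by auto
    have "lin_ext P \<beta> (x \<oplus>\<^bsub>F\<^esub> y) =
        (\<Oplus>\<^bsub>P\<^esub>z\<in>?Z. Poly_Mapping.lookup (x + y) z \<odot>\<^bsub>P\<^esub> \<beta> z)"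
      by (subst lin_ext_superset[OF P _ _ \<beta>Z]) (auto dest: subsetD[OF keys_add])
    also have "\<dots> = (\<Oplus>\<^bsub>P\<^esub>z\<in>?Z. Poly_Mapping.lookup x z \<odot>\<^bsub>P\<^esub> \<beta> z \<oplus>\<^bsub>P\<^esub> Poly_Mapping.lookup y z \<odot>\<^bsub>P\<^esub> \<beta> z)"
      using \<beta>Z P.smult_l_distr by (intro P.finsum_cong') (auto simp: Pi_def lookup_add)
    also have "\<dots> = lin_ext P \<beta> x \<oplus>\<^bsub>P\<^esub> lin_ext P \<beta> y"
      using \<beta>Z by (subst (1 2) lin_ext_superset[OF P _ _ \<beta>Z]) (auto intro!: P.finsum_addf)
    finally show "lin_ext P \<beta> (x \<oplus>\<^bsub>F\<^esub> y) = lin_ext P \<beta> x \<oplus>\<^bsub>P\<^esub> lin_ext P \<beta> y" .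
  qed
qed

lemma lin_ext_single:
  assumes P: "vspace P" and "\<beta> z \<in> carrier P"
  shows "lin_ext P \<beta> (Poly_Mapping.single z c) = c \<odot>\<^bsub>P\<^esub> \<beta> z"
proof -
  interpret P: module scalars P by fact
  have "lin_ext P \<beta> (Poly_Mapping.single z c) =
      (\<Oplus>\<^bsub>P\<^esub>y\<in>{z}. Poly_Mapping.lookup (Poly_Mapping.single z c) y \<odot>\<^bsub>P\<^esub> \<beta> y)"
    by (rule lin_ext_superset[OF P]) (use assms in auto)
  thus ?thesis using assms by simp
qed

lemma lin_map_eq_lin_ext:
  fixes F :: "('k::field, 'x \<Rightarrow>\<^sub>0 'k) module"
  assumes F: "finsupp_space F X" and P: "vspace P" and f: "lin_map F P f" and p: "p \<in> carrier F"
  shows "f p = lin_ext P (\<lambda>z. f (Poly_Mapping.single z 1)) p"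
proof -
  interpret P: module scalars P by fact
  have [simp]: "c \<odot>\<^bsub>F\<^esub> x = Poly_Mapping.map ((*) c) x"
    "carrier F = {p. Poly_Mapping.keys p \<subseteq> X}" for x c
    using F by (auto simp: finsupp_space_def)
  have pX: "Poly_Mapping.keys p \<subseteq> X" using p by simp
  have in_F: "Poly_Mapping.single z c \<in> carrier F" if "z \<in> X" for z and c :: 'k
    using that by auto
  have "f p = f (\<Oplus>\<^bsub>F\<^esub>z\<in>Poly_Mapping.keys p. Poly_Mapping.single z (Poly_Mapping.lookup p z))"
    using pX by (subst finsum_finsupp_space[OF F]) (auto simp: sum_single_lookup split: if_splits)
  also have "\<dots> = (\<Oplus>\<^bsub>P\<^esub>z\<in>Poly_Mapping.keys p. f (Poly_Mapping.single z (Poly_Mapping.lookup p z)))"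
    by (rule lin_map_finsum[OF vspace_finsupp_space[OF F] P f]) (use pX in \<open>auto split: if_splits\<close>)
  also have "\<dots> = lin_ext P (\<lambda>z. f (Poly_Mapping.single z 1)) p"
    unfolding lin_ext_def
  proof (rule P.finsum_cong', goal_cases)
    case (3 z)
    have z: "Poly_Mapping.single z (1::'k) \<in> carrier F" using 3 pX by (intro in_F) auto
    show ?case
      using lin_mapD(3)[OF f z, of "Poly_Mapping.lookup p z"] by simp
  qed (use pX lin_mapD(1)[OF f in_F] in auto)
  finally show ?thesis .
qed

lemma finsupp_space_lin_map_eqI:
  fixes F :: "('k::field, 'x \<Rightarrow>\<^sub>0 'k) module"
  assumes F: "finsupp_space F X" and P: "vspace P" and f: "lin_map F P f" and g: "lin_map F P g"
    and eq: "\<And>z. z \<in> X \<Longrightarrow> f (Poly_Mapping.single z 1) = g (Poly_Mapping.single z 1)"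
    and p: "p \<in> carrier F"
  shows "f p = g p"
proof -
  interpret P: module scalars P by fact
  have keys: "Poly_Mapping.keys p \<subseteq> X" using F p by (auto simp: finsupp_space_def)
  have s: "Poly_Mapping.single z (1::'k) \<in> carrier F" if "z \<in> X" for z
    using F that by (auto simp: finsupp_space_def)
  have "lin_ext P (\<lambda>z. f (Poly_Mapping.single z 1)) p = lin_ext P (\<lambda>z. g (Poly_Mapping.single z 1)) p"
    unfolding lin_ext_def
  proof (rule P.finsum_cong', goal_cases)
    case 2
    show ?case using keys by (auto intro!: P.smult_closed lin_mapD(1)[OF g] s)
  next
    case (3 z)
    then show ?case using keys eq[of z] by auto
  qed simp
  thus ?thesis
    using lin_map_eq_lin_ext[OF F P f p] lin_map_eq_lin_ext[OF F P g p] by simp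
qed

lemma finsupp_space_free_space: "finsupp_space (free_space X) X"
  by (simp add: finsupp_space_def free_space_def)

section \<open>The universal property of the tensor product\<close>

definition bilin ::
    "('k::field, 'a) module \<Rightarrow> ('k, 'b) module \<Rightarrow> ('k, 'c) module \<Rightarrow> ('a \<Rightarrow> 'b \<Rightarrow> 'c) \<Rightarrow> bool" where
  "bilin M N P \<beta> \<longleftrightarrow> (\<forall>x\<in>carrier M. lin_map N P (\<beta> x)) \<and> (\<forall>y\<in>carrier N. lin_map M P (\<lambda>x. \<beta> x y))"

lemma bilinI:
  assumes "\<And>x. x \<in> carrier M \<Longrightarrow> lin_map N P (\<beta> x)"
    and "\<And>y. y \<in> carrier N \<Longrightarrow> lin_map M P (\<lambda>x. \<beta> x y)"
  shows "bilin M N P \<beta>"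
  using assms by (simp add: bilin_def)

lemma bilinD:
  assumes "bilin M N P \<beta>"
  shows "x \<in> carrier M \<Longrightarrow> lin_map N P (\<beta> x)" "y \<in> carrier N \<Longrightarrow> lin_map M P (\<lambda>x. \<beta> x y)"
    and "x \<in> carrier M \<Longrightarrow> y \<in> carrier N \<Longrightarrow> \<beta> x y \<in> carrier P"
  using assms lin_mapD(1) unfolding bilin_def by fast+

context
  fixes M :: "('k::field, 'a) module" and N :: "('k, 'b) module"
  assumes M: "vspace M" and N: "vspace N"
begin

interpretation M: module scalars M by (rule M)
interpretation N: module scalars N by (rule N)

abbreviation (input) pair_space :: "('k, 'a \<times> 'b \<Rightarrow>\<^sub>0 'k) module" where
  "pair_space \<equiv> free_space (carrier M \<times> carrier N)"

interpretation F: module scalars pair_space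
  by (rule vspace_finsupp_space[OF finsupp_space_free_space])

lemmas free_space_minus = finsupp_space_minus[OF finsupp_space_free_space]

lemma bilinear_relations_subset: "bilinear_relations M N \<subseteq> carrier pair_space"
  by (auto simp: bilinear_relations_def free_space_def split: if_splits
      dest!: subsetD[OF keys_diff] intro!: M.smult_closed N.smult_closed)

lemma submodule_tensor_kernel: "submodule (tensor_kernel M N) scalars pair_space"
proof -
  let ?S = "{H. submodule H (scalars :: ('k, 'k) module) pair_space \<and> bilinear_relations M N \<subseteq> H}"
  have 1: "carrier pair_space \<in> ?S"
    using F.carrier_is_submodule bilinear_relations_subset by simp
  show ?thesis unfolding tensor_kernel_def
  proof (rule F.submoduleI)
    show "\<Inter> ?S \<subseteq> carrier pair_space" using 1 by (rule Inter_lower)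
    have "\<zero>\<^bsub>pair_space\<^esub> \<in> H" if "H \<in> ?S" for H
      using that subgroup.one_closed[of H "add_monoid pair_space"] by (auto simp: submodule_def)
    thus "\<zero>\<^bsub>pair_space\<^esub> \<in> \<Inter> ?S" by simp
  qed (use F.submoduleE(3,4,5) in auto)
qed

lemma bilinear_relations_kernel: "bilinear_relations M N \<subseteq> tensor_kernel M N"
  by (auto simp: tensor_kernel_def)

lemma tensor_kernel_least:
  assumes "submodule H (scalars :: ('k, 'k) module) pair_space" "bilinear_relations M N \<subseteq> H"
  shows "tensor_kernel M N \<subseteq> H"
  using assms by (auto simp: tensor_kernel_def)

lemma vspace_tensor: "vspace (tensor M N)"
  unfolding tensor_def by (rule vspace_quot[OF F.module_axioms submodule_tensor_kernel])

lemma bilin_pure_tensor: "bilin M N (tensor M N) (pure_tensor M N)"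
proof -
  note sub = submodule_tensor_kernel
  note Fm = F.module_axioms
  note Kd = subsetD[OF bilinear_relations_kernel]
  have sg: "Poly_Mapping.single (x, y) c \<in> carrier pair_space" if "x \<in> carrier M" "y \<in> carrier N" for x y c
    using that by (simp add: free_space_def)
  have e: "pure_tensor M N x y \<in> carrier (tensor M N)" if "x \<in> carrier M" "y \<in> carrier N" for x y
    unfolding pure_tensor_def tensor_def using that by (intro quot_coset_closed[OF Fm sub] sg)
  have scale: "c \<odot>\<^bsub>tensor M N\<^esub> pure_tensor M N x y = tensor_kernel M N +>\<^bsub>pair_space\<^esub> Poly_Mapping.single (x, y) c"
    if "x \<in> carrier M" "y \<in> carrier N" for x y c
    unfolding pure_tensor_def tensor_def using that
    by (subst quot_smult[OF Fm sub sg]) (auto simp: free_space_def)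
  have plus: "pure_tensor M N x y \<oplus>\<^bsub>tensor M N\<^esub> pure_tensor M N x' y' =
      tensor_kernel M N +>\<^bsub>pair_space\<^esub> (Poly_Mapping.single (x, y) 1 + Poly_Mapping.single (x', y') 1)"
    if "x \<in> carrier M" "y \<in> carrier N" "x' \<in> carrier M" "y' \<in> carrier N" for x y x' y'
    unfolding pure_tensor_def tensor_def using that
    by (subst quot_add[OF Fm sub sg sg]) (auto simp: free_space_def)
  have cl: "p + r \<in> carrier pair_space" if "p \<in> carrier pair_space" "r \<in> carrier pair_space" for p r
    using F.M.a_closed[OF that] by (simp add: free_space_def)
  have eq: "tensor_kernel M N +>\<^bsub>pair_space\<^esub> p = tensor_kernel M N +>\<^bsub>pair_space\<^esub> r"
    if "p \<in> carrier pair_space" "r \<in> carrier pair_space" "p - r \<in> bilinear_relations M N" for p r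
    using quot_coset_eq_iff[OF Fm sub that(1,2)] Kd[OF that(3)] free_space_minus[OF that(1,2)] by simp
  show ?thesis
  proof (rule bilinI; rule lin_mapI)
    fix x y y' c assume x: "x \<in> carrier M" and y: "y \<in> carrier N"
    show "pure_tensor M N x y \<in> carrier (tensor M N)" by (rule e[OF x y])
    show "pure_tensor M N x (c \<odot>\<^bsub>N\<^esub> y) = c \<odot>\<^bsub>tensor M N\<^esub> pure_tensor M N x y"
      unfolding scale[OF x y] unfolding pure_tensor_def
      by (rule eq) (use x y in \<open>auto simp: bilinear_relations_def intro!: sg N.smult_closed\<close>)
    assume y': "y' \<in> carrier N"
    show "pure_tensor M N x (y \<oplus>\<^bsub>N\<^esub> y') = pure_tensor M N x y \<oplus>\<^bsub>tensor M N\<^esub> pure_tensor M N x y'"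
      unfolding plus[OF x y x y'] unfolding pure_tensor_def
      by (rule eq) (use x y y' in \<open>auto simp: bilinear_relations_def diff_diff_eq intro!: sg cl\<close>)
  next
    fix x x' y c assume y: "y \<in> carrier N" and x: "x \<in> carrier M"
    show "pure_tensor M N x y \<in> carrier (tensor M N)" by (rule e[OF x y])
    show "pure_tensor M N (c \<odot>\<^bsub>M\<^esub> x) y = c \<odot>\<^bsub>tensor M N\<^esub> pure_tensor M N x y"
      unfolding scale[OF x y] unfolding pure_tensor_def
      by (rule eq) (use x y in \<open>auto simp: bilinear_relations_def intro!: sg M.smult_closed\<close>)
    assume x': "x' \<in> carrier M"
    show "pure_tensor M N (x \<oplus>\<^bsub>M\<^esub> x') y = pure_tensor M N x y \<oplus>\<^bsub>tensor M N\<^esub> pure_tensor M N x' y"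
      unfolding plus[OF x y x' y] unfolding pure_tensor_def
      by (rule eq) (use x y x' in \<open>auto simp: bilinear_relations_def diff_diff_eq intro!: sg cl\<close>)
  qed
qed

text \<open>Pure tensors span the tensor product, being the cosets of the basis of the free space.\<close>

lemma tensor_lin_map_eqI:
  assumes P: "vspace P" and f: "lin_map (tensor M N) P f" and g: "lin_map (tensor M N) P g"
    and eq: "\<And>x y. x \<in> carrier M \<Longrightarrow> y \<in> carrier N \<Longrightarrow> f (pure_tensor M N x y) = g (pure_tensor M N x y)"
    and T: "T \<in> carrier (tensor M N)"
  shows "f T = g T"
proof -
  let ?c = "\<lambda>p. tensor_kernel M N +>\<^bsub>pair_space\<^esub> p"
  have c: "lin_map pair_space (tensor M N) ?c"
    unfolding tensor_def by (rule lin_map_coset[OF F.module_axioms submodule_tensor_kernel])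
  obtain p where p: "p \<in> carrier pair_space" "T = ?c p"
    using T unfolding tensor_def quot_carrier[OF F.module_axioms submodule_tensor_kernel] by auto
  have "f (?c p) = g (?c p)"
    by (rule finsupp_space_lin_map_eqI[OF finsupp_space_free_space P lin_map_comp[OF c f]
          lin_map_comp[OF c g] _ p(1)])
       (use eq[unfolded pure_tensor_def] in auto)
  thus ?thesis by (simp add: p)
qed

context
  fixes P :: "('k, 'c) module" and \<beta> :: "'a \<Rightarrow> 'b \<Rightarrow> 'c"
  assumes P: "vspace P" and \<beta>: "bilin M N P \<beta>"
begin

interpretation P: module scalars P by (rule P)

abbreviation (input) bilin_ext :: "('a \<times> 'b \<Rightarrow>\<^sub>0 'k) \<Rightarrow> 'c" where
  "bilin_ext \<equiv> lin_ext P (\<lambda>z. \<beta> (fst z) (snd z))"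

lemma lin_map_bilin_ext: "lin_map pair_space P bilin_ext"
  by (rule lin_map_lin_ext[OF finsupp_space_free_space P]) (use bilinD(3)[OF \<beta>] in auto)

lemma bilin_ext_minus:
  assumes "p \<in> carrier pair_space" "r \<in> carrier pair_space"
  shows "bilin_ext (p - r) = bilin_ext p \<ominus>\<^bsub>P\<^esub> bilin_ext r"
proof -
  have pr: "p - r \<in> carrier pair_space" using F.M.minus_closed[OF assms] free_space_minus[OF assms] by simp
  have "bilin_ext ((p - r) \<oplus>\<^bsub>pair_space\<^esub> r) = bilin_ext (p - r) \<oplus>\<^bsub>P\<^esub> bilin_ext r"
    by (rule lin_mapD(2)[OF lin_map_bilin_ext pr assms(2)])
  moreover have "(p - r) \<oplus>\<^bsub>pair_space\<^esub> r = p" by (simp add: free_space_def)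
  ultimately show ?thesis
    using lin_mapD(1)[OF lin_map_bilin_ext pr] lin_mapD(1)[OF lin_map_bilin_ext assms(2)]
    by (simp add: a_minus_def P.M.a_assoc P.M.r_neg)
qed

text \<open>The vectors killed by the linear extension of a bilinear map form a submodule that contains the
  bilinear relations, and the tensor kernel is the least such submodule.\<close>

lemma bilin_ext_kernel:
  assumes "p \<in> tensor_kernel M N"
  shows "bilin_ext p = \<zero>\<^bsub>P\<^esub>"
proof -
  let ?H = "{p \<in> carrier pair_space. bilin_ext p = \<zero>\<^bsub>P\<^esub>}"
  note l = lin_mapD[OF lin_map_bilin_ext]
  note b = lin_mapD[OF bilinD(1)[OF \<beta>]] lin_mapD[OF bilinD(2)[OF \<beta>]] bilinD(3)[OF \<beta>]
  have "submodule ?H scalars pair_space"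
  proof (rule vspace_submoduleI[OF F.module_axioms])
    show "\<zero>\<^bsub>pair_space\<^esub> \<in> ?H"
      using lin_map_zero[OF F.module_axioms P lin_map_bilin_ext] by simp
    fix p r c assume p: "p \<in> ?H"
    show "c \<odot>\<^bsub>pair_space\<^esub> p \<in> ?H" using p l(3)[of p c] F.smult_closed[of c p] P.smult_r_null[of c] by auto
    assume r: "r \<in> ?H"
    show "p \<oplus>\<^bsub>pair_space\<^esub> r \<in> ?H" using p r l(2)[of p r] by auto
  qed auto
  moreover have "bilinear_relations M N \<subseteq> ?H"
  proof
    fix p assume p: "p \<in> bilinear_relations M N"
    have sg: "Poly_Mapping.single (x, y) c \<in> carrier pair_space" if "x \<in> carrier M" "y \<in> carrier N" for x y c
      using that by (simp add: free_space_def)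
    have Ls: "bilin_ext (Poly_Mapping.single (x, y) c) = c \<odot>\<^bsub>P\<^esub> \<beta> x y" if "x \<in> carrier M" "y \<in> carrier N" for x y c
      using that b(7) by (subst lin_ext_single[OF P]) auto
    have mc: "p - r \<in> carrier pair_space" if "p \<in> carrier pair_space" "r \<in> carrier pair_space" for p r
      using F.M.minus_closed[OF that] free_space_minus[OF that] by simp
    have cancel2: "((u \<oplus>\<^bsub>P\<^esub> v) \<ominus>\<^bsub>P\<^esub> u) \<ominus>\<^bsub>P\<^esub> v = \<zero>\<^bsub>P\<^esub>" if "u \<in> carrier P" "v \<in> carrier P" for u v
      using that P.M.r_neg[of "u \<oplus>\<^bsub>P\<^esub> v"] by (simp add: a_minus_def P.M.a_assoc P.M.minus_add)
    have cancel: "u \<ominus>\<^bsub>P\<^esub> u = \<zero>\<^bsub>P\<^esub>" if "u \<in> carrier P" for u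
      using that by (simp add: a_minus_def P.M.r_neg)
    note one = P.smult_one[simplified]
    consider (1) x x' y where "x \<in> carrier M" "x' \<in> carrier M" "y \<in> carrier N"
        "p = Poly_Mapping.single (x \<oplus>\<^bsub>M\<^esub> x', y) 1 - Poly_Mapping.single (x, y) 1
               - Poly_Mapping.single (x', y) 1"
      | (2) x y y' where "x \<in> carrier M" "y \<in> carrier N" "y' \<in> carrier N"
        "p = Poly_Mapping.single (x, y \<oplus>\<^bsub>N\<^esub> y') 1 - Poly_Mapping.single (x, y) 1
               - Poly_Mapping.single (x, y') 1"
      | (3) c x y where "x \<in> carrier M" "y \<in> carrier N"
        "p = Poly_Mapping.single (c \<odot>\<^bsub>M\<^esub> x, y) 1 - Poly_Mapping.single (x, y) c"
      | (4) c x y where "x \<in> carrier M" "y \<in> carrier N"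
        "p = Poly_Mapping.single (x, c \<odot>\<^bsub>N\<^esub> y) 1 - Poly_Mapping.single (x, y) c"
      using p unfolding bilinear_relations_def
      by (elim UnE CollectE exE conjE) (rule that; assumption)+
    then have "bilin_ext p = \<zero>\<^bsub>P\<^esub>"
    proof cases
      case 1
      then show ?thesis by (simp add: bilin_ext_minus mc sg Ls one b cancel2)
    next
      case 2
      then show ?thesis by (simp add: bilin_ext_minus mc sg Ls one b cancel2)
    next
      case 3
      then have "c \<odot>\<^bsub>M\<^esub> x \<in> carrier M" by (intro M.smult_closed) auto
      with 3 show ?thesis
        by (simp add: bilin_ext_minus mc sg Ls one b cancel P.smult_closed)
    next
      case 4
      then have "c \<odot>\<^bsub>N\<^esub> y \<in> carrier N" by (intro N.smult_closed) auto
      with 4 show ?thesis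
        by (simp add: bilin_ext_minus mc sg Ls one b cancel P.smult_closed)
    qed
    with p show "p \<in> ?H" using bilinear_relations_subset by auto
  qed
  ultimately have "tensor_kernel M N \<subseteq> ?H" by (rule tensor_kernel_least)
  thus ?thesis using assms by auto
qed

lemma tensor_lift_coset:
  assumes "p \<in> carrier pair_space"
  shows "tensor_lift M N P \<beta> (tensor_kernel M N +>\<^bsub>pair_space\<^esub> p) = bilin_ext p"
proof -
  have "bilin_ext ` (tensor_kernel M N +>\<^bsub>pair_space\<^esub> p) = {bilin_ext p}"
    by (rule image_coset[OF F.module_axioms submodule_tensor_kernel P lin_map_bilin_ext
          bilin_ext_kernel assms])
  thus ?thesis by (simp add: tensor_lift_def lin_ext_def)
qed

lemma lin_map_tensor_lift: "lin_map (tensor M N) P (tensor_lift M N P \<beta>)"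
proof -
  note l = lin_mapD[OF lin_map_bilin_ext]
  note K = quot_carrier[OF F.module_axioms submodule_tensor_kernel]
    quot_add[OF F.module_axioms submodule_tensor_kernel]
    quot_smult[OF F.module_axioms submodule_tensor_kernel]
  show ?thesis unfolding tensor_def
    by (rule lin_mapI) (auto simp: K tensor_lift_coset l F.smult_closed)
qed

lemma tensor_lift_pure:
  assumes "x \<in> carrier M" "y \<in> carrier N"
  shows "tensor_lift M N P \<beta> (pure_tensor M N x y) = \<beta> x y"
  unfolding pure_tensor_def using assms bilinD(3)[OF \<beta> assms] P.smult_one[of "\<beta> x y"]
  by (subst tensor_lift_coset) (auto simp: free_space_def lin_ext_single[OF P])

end

end

section \<open>The standard basis of a quantum complete intersection\<close>

lemma qpair_add_left: "qpair n q (\<lambda>i. u i + u' i) v = qpair n q u v * qpair n q u' v"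
  by (simp add: qpair_def add_mult_distrib power_add prod.distrib split_def)

lemma qpair_add_right: "qpair n q u (\<lambda>i. v i + v' i) = qpair n q u v * qpair n q u v'"
  by (simp add: qpair_def add_mult_distrib2 power_add prod.distrib split_def)

lemma qpair_zero [simp]: "qpair n q (\<lambda>_. 0) v = 1" "qpair n q u (\<lambda>_. 0) = 1"
  by (simp_all add: qpair_def)

lemma finite_pairs [simp]: "finite {(i, j). Suc 0 \<le> i \<and> i < j \<and> j \<le> n}"
  by (rule finite_subset[of _ "{1..n} \<times> {1..n}"]) auto

lemma qpair_unit_left:
  assumes "i \<in> {1..n}"
  shows "qpair n q (unit_vec i) v = (\<Prod>k\<in>{1..<i}. q k i ^ v k)"
proof -
  let ?S = "(\<lambda>k. (k, i)) ` {1..<i}"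
  have "qpair n q (unit_vec i) v = (\<Prod>(k, l)\<in>?S. q k l ^ (unit_vec i l * v k))"
    unfolding qpair_def
    by (rule prod.mono_neutral_right) (use assms in \<open>auto simp: unit_vec_def split: if_splits\<close>)
  also have "\<dots> = (\<Prod>k\<in>{1..<i}. q k i ^ v k)"
    by (subst prod.reindex) (auto simp: inj_on_def unit_vec_def)
  finally show ?thesis .
qed

lemma qpair_unit_unit:
  assumes "i \<in> {1..n}"
  shows "qpair n q (unit_vec i) (unit_vec j) = (if 1 \<le> j \<and> j < i then q j i else 1)"
proof -
  have "(\<Prod>k\<in>{1..<i}. q k i ^ unit_vec j k) = (\<Prod>k\<in>{1..<i}. if k = j then q j i else 1)"
    by (rule prod.cong) (auto simp: unit_vec_def)
  thus ?thesis by (simp add: qpair_unit_left[OF assms])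
qed

text \<open>The scalar that appears when a word is rewritten as a multiple of the ordered monomial with the same
  letters: each letter \<open>i\<close> is moved to the right past the smaller letters of the remaining word.\<close>

fun word_wt :: "nat \<Rightarrow> (nat \<Rightarrow> nat \<Rightarrow> 'k::field) \<Rightarrow> nat list \<Rightarrow> 'k" where
  "word_wt n q [] = 1"
| "word_wt n q (i # w) = qpair n q (unit_vec i) (count_list w) * word_wt n q w"

lemma count_list_Nil_fun [simp]: "count_list [] = (\<lambda>_. 0)"
  by auto

lemma count_list_append_fun: "count_list (u @ w) = (\<lambda>i. count_list u i + count_list w i)"
  by auto

lemma count_list_Cons_fun: "count_list (i # w) = (\<lambda>k. unit_vec i k + count_list w k)"
  by (auto simp: unit_vec_def)

text \<open>Sorting a concatenation amounts to sorting the two words and then merging them.\<close>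

lemma word_wt_append:
  "word_wt n q (u @ w) = word_wt n q u * word_wt n q w * qpair n q (count_list u) (count_list w)"
  by (induction u) (auto simp: count_list_append_fun qpair_add_right qpair_add_left
      count_list_Cons_fun simp del: count_list.simps)

text \<open>Scalars are central in a monoid algebra.\<close>

lemma single_zero_commute:
  "p * Poly_Mapping.single 0 c = Poly_Mapping.single 0 c * (p :: 'w::monoid_add \<Rightarrow>\<^sub>0 'k::field)"
proof -
  let ?p = "\<Sum>z\<in>Poly_Mapping.keys p. Poly_Mapping.single z (Poly_Mapping.lookup p z)"
  have "?p * Poly_Mapping.single 0 c = Poly_Mapping.single 0 c * ?p"
    by (simp add: sum_distrib_left sum_distrib_right mult_single mult.commute)
  thus ?thesis by (simp add: sum_single_lookup)
qed

lemma free_gen_power: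
  "(free_gen i :: free_word \<Rightarrow>\<^sub>0 'k::field) ^ m = Poly_Mapping.single (Word (replicate m i)) 1"
  by (induction m) (simp_all add: free_gen_def mult_single plus_free_word_def flip: zero_free_word_def)

text \<open>The word that spells out an ordered monomial in the variables of \<open>xs\<close>.\<close>

definition mon_word :: "(nat \<Rightarrow> nat) \<Rightarrow> nat list \<Rightarrow> nat list" where
  "mon_word v xs = concat (map (\<lambda>i. replicate (v i) i) xs)"

lemma count_list_replicate: "count_list (replicate m i) k = (if i = k then m else 0)"
  by (induction m) auto

lemma count_list_mon_word:
  "distinct xs \<Longrightarrow> count_list (mon_word v xs) i = (if i \<in> set xs then v i else 0)"
  by (induction xs) (auto simp: mon_word_def count_list_append_fun count_list_replicate)

lemma set_mon_word: "set (mon_word v xs) \<subseteq> set xs"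
  by (auto simp: mon_word_def)

locale quantum_ci =
  fixes n :: nat and a :: "nat \<Rightarrow> nat" and q :: "nat \<Rightarrow> nat \<Rightarrow> 'k::field"
  assumes data: "qci_data n a q"
begin

abbreviation A :: "('k, (free_word \<Rightarrow>\<^sub>0 'k) set) module" where "A \<equiv> qci n a q"
abbreviation Fr :: "('k, free_word \<Rightarrow>\<^sub>0 'k) module" where "Fr \<equiv> free_algebra n"
abbreviation V :: "(nat \<Rightarrow> nat) set" where "V \<equiv> exps n a"
abbreviation top :: "nat \<Rightarrow> nat" where "top \<equiv> top_vec n a"
abbreviation mon :: "(nat \<Rightarrow> nat) \<Rightarrow> (free_word \<Rightarrow>\<^sub>0 'k) set" where "mon \<equiv> qci_mon n a q"
abbreviation gen :: "nat \<Rightarrow> (free_word \<Rightarrow>\<^sub>0 'k) set" where "gen \<equiv> qci_gen n a q"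
abbreviation coset :: "(free_word \<Rightarrow>\<^sub>0 'k) \<Rightarrow> (free_word \<Rightarrow>\<^sub>0 'k) set" where
  "coset p \<equiv> qci_ideal n a q +>\<^bsub>Fr\<^esub> p"
abbreviation alg_mult (infixl \<open>\<cdot>\<close> 70) where "x \<cdot> y \<equiv> x \<otimes>\<^bsub>A\<^esub> y"
abbreviation alg_smult (infixl \<open>\<bullet>\<close> 70) where "c \<bullet> x \<equiv> c \<odot>\<^bsub>A\<^esub> x"
abbreviation words :: "free_word set" where "words \<equiv> {w. set (letters w) \<subseteq> {1..n}}"
abbreviation wt :: "nat list \<Rightarrow> 'k" where "wt \<equiv> word_wt n q"
abbreviation qp :: "(nat \<Rightarrow> nat) \<Rightarrow> (nat \<Rightarrow> nat) \<Rightarrow> 'k" where "qp \<equiv> qpair n q"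

lemma n_ge_2: "2 \<le> n"
  and a_ge_2: "i \<in> {1..n} \<Longrightarrow> 2 \<le> a i"
  and q_diag: "i \<in> {1..n} \<Longrightarrow> q i i = 1"
  and q_inv: "i \<in> {1..n} \<Longrightarrow> j \<in> {1..n} \<Longrightarrow> q i j * q j i = 1"
  using data by (auto simp: qci_data_def)

lemma q_nonzero: "i \<in> {1..n} \<Longrightarrow> j \<in> {1..n} \<Longrightarrow> q i j \<noteq> 0"
  using q_inv[of i j] by auto

lemma qp_nonzero: "qp u v \<noteq> 0"
proof -
  have "q i j ^ (u j * v i) \<noteq> 0" if "Suc 0 \<le> i" "i < j" "j \<le> n" for i j
    using q_nonzero[of i j] that by simp
  thus ?thesis by (auto simp: qpair_def prod_zero_iff)
qed

lemma finsupp_Fr: "finsupp_space Fr words"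
  by (auto simp: finsupp_space_def free_algebra_def)

lemma Fr_simps [simp]:
  "x \<oplus>\<^bsub>Fr\<^esub> y = x + y" "x \<otimes>\<^bsub>Fr\<^esub> y = x * y" "\<zero>\<^bsub>Fr\<^esub> = 0" "\<one>\<^bsub>Fr\<^esub> = 1"
  "c \<odot>\<^bsub>Fr\<^esub> x = Poly_Mapping.map ((*) c) x"
  by (simp_all add: free_algebra_def)

lemma vspace_Fr: "vspace Fr"
  by (rule vspace_finsupp_space[OF finsupp_Fr])

interpretation Fr: module scalars Fr by (rule vspace_Fr)

lemma single_in_Fr: "set w \<subseteq> {1..n} \<Longrightarrow> Poly_Mapping.single (Word w) c \<in> carrier Fr"
  by (auto simp: free_algebra_def)

lemma gen_in_Fr: "i \<in> {1..n} \<Longrightarrow> free_gen i \<in> carrier Fr"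
  unfolding free_gen_def by (rule single_in_Fr) auto

lemma one_eq_single: "(1 :: free_word \<Rightarrow>\<^sub>0 'k) = Poly_Mapping.single (Word []) 1"
  by (simp flip: zero_free_word_def)

lemma mult_in_Fr: "p \<in> carrier Fr \<Longrightarrow> r \<in> carrier Fr \<Longrightarrow> p * r \<in> carrier Fr"
  using keys_mult[of p r] by (fastforce simp: free_algebra_def plus_free_word_def)

lemma ring_Fr: "ring Fr"
proof (rule ringI)
  show "abelian_group Fr" by (rule Fr.abelian_group_axioms)
  show "Group.monoid Fr"
    by (rule monoidI) (use mult_in_Fr single_in_Fr[of "[]" 1] in \<open>auto simp: mult.assoc one_eq_single
        simp flip: one_eq_single\<close>)
qed (auto simp: algebra_simps)

interpretation FrR: ring Fr by (rule ring_Fr)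

lemmas Fr_minus = finsupp_space_minus[OF finsupp_Fr]

lemma relations_subset: "qci_relations n a q \<subseteq> carrier Fr"
proof -
  have s: "p - r \<in> carrier Fr" if "p \<in> carrier Fr" "r \<in> carrier Fr" for p r
    using Fr.minus_closed[OF that] Fr_minus[OF that] by simp
  have c: "Poly_Mapping.map ((*) c) p \<in> carrier Fr" if "p \<in> carrier Fr" for c p
    using Fr.smult_closed[of c p] that by simp
  show ?thesis
    unfolding qci_relations_def
    by (auto simp: free_gen_power intro!: single_in_Fr s c mult_in_Fr gen_in_Fr)
qed

lemma ideal_qci_ideal: "ideal (qci_ideal n a q) Fr"
  unfolding qci_ideal_def by (rule FrR.genideal_ideal[OF relations_subset])

lemma relations_in_ideal: "qci_relations n a q \<subseteq> qci_ideal n a q"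
  unfolding qci_ideal_def by (rule FrR.genideal_self[OF relations_subset])

interpretation I: ideal "qci_ideal n a q" Fr by (rule ideal_qci_ideal)

lemma submodule_qci_ideal: "submodule (qci_ideal n a q) scalars Fr"
proof (rule submodule.intro)
  show "subgroup (qci_ideal n a q) (add_monoid Fr)" by (rule I.a_subgroup)
  show "submodule_axioms (qci_ideal n a q) scalars Fr"
  proof
    fix c :: 'k and x assume x: "x \<in> qci_ideal n a q"
    have "Poly_Mapping.single (Word []) c \<in> carrier Fr" by (rule single_in_Fr) simp
    from I.I_l_closed[OF x this] show "c \<odot>\<^bsub>Fr\<^esub> x \<in> qci_ideal n a q"
      by (simp add: mult_map_scale_conv_mult zero_free_word_def)
  qed
qed

lemmas qci_quot = vspace_Fr submodule_qci_ideal

lemma vspace_A: "vspace A"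
  unfolding qci_def by (rule vspace_quot[OF qci_quot])

sublocale A: module scalars A by (rule vspace_A)

lemma carrier_A: "carrier A = coset ` carrier Fr"
  unfolding qci_def by (rule quot_carrier[OF qci_quot])

lemma coset_closed: "p \<in> carrier Fr \<Longrightarrow> coset p \<in> carrier A"
  by (simp add: carrier_A)

lemma coset_add: "p \<in> carrier Fr \<Longrightarrow> r \<in> carrier Fr \<Longrightarrow> coset p \<oplus>\<^bsub>A\<^esub> coset r = coset (p + r)"
  unfolding qci_def using quot_add[OF qci_quot, of p r] by simp

lemma coset_smult: "p \<in> carrier Fr \<Longrightarrow> c \<odot>\<^bsub>A\<^esub> coset p = coset (Poly_Mapping.map ((*) c) p)"
  unfolding qci_def using quot_smult[OF qci_quot, of p c] by simp

lemma coset_mult: "p \<in> carrier Fr \<Longrightarrow> r \<in> carrier Fr \<Longrightarrow> coset p \<otimes>\<^bsub>A\<^esub> coset r = coset (p * r)"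
  using I.rcoset_mult_add[of p r] by (simp add: qci_def quot_module_def FactRing_def)

lemma coset_one: "\<one>\<^bsub>A\<^esub> = coset 1"
  by (simp add: qci_def quot_module_def FactRing_def)

lemma coset_zero: "\<zero>\<^bsub>A\<^esub> = coset 0"
  unfolding qci_def using quot_zero[OF qci_quot] by simp

lemma lin_map_qci_coset: "lin_map Fr A (\<lambda>p. coset p)"
  unfolding qci_def by (rule lin_map_coset[OF qci_quot])

lemma coset_eqI:
  assumes "p \<in> carrier Fr" "r \<in> carrier Fr" "p - r \<in> qci_ideal n a q"
  shows "coset p = coset r"
  using quot_coset_eq_iff[OF qci_quot assms(1,2)] assms(3) Fr_minus[OF assms(1,2)] by simp

lemma one_in_Fr: "1 \<in> carrier Fr"
  using FrR.one_closed by simp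

lemma ring_A: "ring A"
proof (rule ringI)
  show "abelian_group A" by (rule A.abelian_group_axioms)
  show "Group.monoid A"
    by (rule monoidI) (auto simp: carrier_A coset_one coset_mult mult_in_Fr one_in_Fr mult.assoc)
  have add: "p + r \<in> carrier Fr" if "p \<in> carrier Fr" "r \<in> carrier Fr" for p r
    using Fr.a_closed[OF that] by simp
  fix x y z assume "x \<in> carrier A" "y \<in> carrier A" "z \<in> carrier A"
  then show "(x \<oplus>\<^bsub>A\<^esub> y) \<otimes>\<^bsub>A\<^esub> z = x \<otimes>\<^bsub>A\<^esub> z \<oplus>\<^bsub>A\<^esub> y \<otimes>\<^bsub>A\<^esub> z"
    and "z \<otimes>\<^bsub>A\<^esub> (x \<oplus>\<^bsub>A\<^esub> y) = z \<otimes>\<^bsub>A\<^esub> x \<oplus>\<^bsub>A\<^esub> z \<otimes>\<^bsub>A\<^esub> y"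
    by (auto simp: carrier_A coset_mult coset_add mult_in_Fr add algebra_simps)
qed

sublocale AR: ring A by (rule ring_A)

lemma assoc_algebra_A: "assoc_algebra A"
proof -
  have c: "Poly_Mapping.map ((*) c) p \<in> carrier Fr" if "p \<in> carrier Fr" for c p
    using Fr.smult_closed[of c p] that by simp
  have l: "Poly_Mapping.map ((*) c) p * r = Poly_Mapping.map ((*) c) (p * r)" for c :: 'k and p r :: "free_word \<Rightarrow>\<^sub>0 'k"
    by (simp add: mult_map_scale_conv_mult mult.assoc)
  have r: "p * Poly_Mapping.map ((*) c) r = Poly_Mapping.map ((*) c) (p * r)" for c :: 'k and p r :: "free_word \<Rightarrow>\<^sub>0 'k"
    by (simp add: mult_map_scale_conv_mult single_zero_commute flip: mult.assoc)
  show ?thesis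
    unfolding assoc_algebra_def using vspace_A ring_A
    by (auto simp: carrier_A coset_mult coset_smult c l r mult_in_Fr)
qed

lemma A_smult_mult:
  assumes "x \<in> carrier A" "y \<in> carrier A"
  shows "(c \<odot>\<^bsub>A\<^esub> x) \<otimes>\<^bsub>A\<^esub> y = c \<odot>\<^bsub>A\<^esub> (x \<otimes>\<^bsub>A\<^esub> y)" "x \<otimes>\<^bsub>A\<^esub> (c \<odot>\<^bsub>A\<^esub> y) = c \<odot>\<^bsub>A\<^esub> (x \<otimes>\<^bsub>A\<^esub> y)"
  using assoc_algebra_A assms by (auto simp: assoc_algebra_def)

lemma A_smult_closed: "x \<in> carrier A \<Longrightarrow> c \<odot>\<^bsub>A\<^esub> x \<in> carrier A"
  using A.smult_closed[of c x] by simp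

lemma A_smult_smult: "x \<in> carrier A \<Longrightarrow> c \<odot>\<^bsub>A\<^esub> (d \<odot>\<^bsub>A\<^esub> x) = (c * d) \<odot>\<^bsub>A\<^esub> x"
  using A.smult_assoc1[of c d x] by simp

lemma A_smult_one: "x \<in> carrier A \<Longrightarrow> 1 \<odot>\<^bsub>A\<^esub> x = x"
  using A.smult_one[of x] by simp

lemma A_smult_zero: "x \<in> carrier A \<Longrightarrow> 0 \<odot>\<^bsub>A\<^esub> x = \<zero>\<^bsub>A\<^esub>" "c \<odot>\<^bsub>A\<^esub> \<zero>\<^bsub>A\<^esub> = \<zero>\<^bsub>A\<^esub>"
  using A.smult_l_null[of x] A.smult_r_null[of c] by simp_all

subsection \<open>Multiplication of monomials\<close>

lemma gen_closed: "i \<in> {1..n} \<Longrightarrow> gen i \<in> carrier A"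
  by (simp add: qci_gen_def coset_closed gen_in_Fr)

lemma gen_pow: "i \<in> {1..n} \<Longrightarrow> gen i [^]\<^bsub>A\<^esub> m = coset (free_gen i ^ m)"
proof (induction m)
  case (Suc m)
  then have "free_gen i ^ m \<in> carrier Fr" by (auto simp: free_gen_power intro!: single_in_Fr)
  with Suc show ?case
    by (simp add: AR.nat_pow_Suc qci_gen_def coset_mult gen_in_Fr power_commutes)
qed (simp add: coset_one)

lemma gen_pow_a: "i \<in> {1..n} \<Longrightarrow> gen i [^]\<^bsub>A\<^esub> a i = \<zero>\<^bsub>A\<^esub>"
  unfolding gen_pow coset_zero
  by (rule coset_eqI) (use relations_in_ideal in
      \<open>auto simp: qci_relations_def free_gen_power free_algebra_def\<close>)

lemma gen_commute:
  assumes "i \<in> {1..n}" "j \<in> {1..n}"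
  shows "gen j \<cdot> gen i = q i j \<bullet> (gen i \<cdot> gen j)"
proof -
  have ij: "free_gen i * free_gen j \<in> carrier Fr" and ji: "free_gen j * free_gen i \<in> carrier Fr"
    using assms by (auto intro!: mult_in_Fr gen_in_Fr)
  have c: "Poly_Mapping.map ((*) (q i j)) (free_gen i * free_gen j) \<in> carrier Fr"
    using Fr.smult_closed[of "q i j", OF _ ij] by simp
  have "free_gen j * free_gen i - Poly_Mapping.map ((*) (q i j)) (free_gen i * free_gen j) \<in> qci_ideal n a q"
    using assms relations_in_ideal by (auto simp: qci_relations_def)
  from coset_eqI[OF ji c this] show ?thesis
    using assms ij by (simp add: qci_gen_def coset_mult gen_in_Fr coset_smult)
qed

lemma gen_commute_pow:
  assumes "i \<in> {1..n}" "k \<in> {1..n}"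
  shows "gen i \<cdot> gen k [^]\<^bsub>A\<^esub> m = (q k i) ^ m \<bullet> (gen k [^]\<^bsub>A\<^esub> m \<cdot> gen i)"
proof (induction m)
  case 0
  then show ?case using gen_closed[OF assms(1)] by (simp add: A_smult_one)
next
  case (Suc m)
  note g = gen_closed[OF assms(1)] gen_closed[OF assms(2)] AR.nat_pow_closed[OF gen_closed[OF assms(2)]]
  have "gen i \<cdot> gen k [^]\<^bsub>A\<^esub> Suc m = (gen i \<cdot> gen k [^]\<^bsub>A\<^esub> m) \<cdot> gen k"
    using g by (simp add: AR.nat_pow_Suc AR.m_assoc)
  also have "\<dots> = (q k i) ^ m \<bullet> (gen k [^]\<^bsub>A\<^esub> m \<cdot> (gen i \<cdot> gen k))"
    using g by (simp add: Suc A_smult_mult AR.m_assoc)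
  also have "\<dots> = (q k i) ^ m \<bullet> (q k i \<bullet> (gen k [^]\<^bsub>A\<^esub> m \<cdot> (gen k \<cdot> gen i)))"
    using g by (simp add: gen_commute[OF assms(2,1)] A_smult_mult)
  also have "\<dots> = (q k i) ^ Suc m \<bullet> (gen k [^]\<^bsub>A\<^esub> Suc m \<cdot> gen i)"
    using g by (simp add: A_smult_smult AR.m_assoc AR.nat_pow_Suc mult.commute)
  finally show ?case .
qed

text \<open>The ordered monomial in the variables of \<open>xs\<close> only; inductions over the variables need it.\<close>

definition pmon :: "nat list \<Rightarrow> (nat \<Rightarrow> nat) \<Rightarrow> (free_word \<Rightarrow>\<^sub>0 'k) set" where
  "pmon xs v = foldr (\<lambda>i y. (gen i [^]\<^bsub>A\<^esub> v i) \<cdot> y) xs \<one>\<^bsub>A\<^esub>"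

lemma pmon_simps [simp]:
  "pmon [] v = \<one>\<^bsub>A\<^esub>" "pmon (i # xs) v = (gen i [^]\<^bsub>A\<^esub> v i) \<cdot> pmon xs v"
  by (simp_all add: pmon_def)

lemma mon_eq_pmon: "mon v = pmon [1..<Suc n] v"
  by (simp add: pmon_def qci_mon_def)

lemma pmon_closed: "set xs \<subseteq> {1..n} \<Longrightarrow> pmon xs v \<in> carrier A"
  by (induction xs) (auto intro!: AR.m_closed AR.nat_pow_closed gen_closed)

lemma mon_closed [simp]: "mon v \<in> carrier A"
  unfolding mon_eq_pmon by (rule pmon_closed) auto

lemma pmon_cong: "(\<And>i. i \<in> set xs \<Longrightarrow> v i = w i) \<Longrightarrow> pmon xs v = pmon xs w"
  by (induction xs) auto

lemma pmon_overflow: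
  assumes "set xs \<subseteq> {1..n}" "i \<in> set xs" "a i \<le> v i"
  shows "pmon xs v = \<zero>\<^bsub>A\<^esub>"
  using assms
proof (induction xs)
  case (Cons k xs)
  show ?case
  proof (cases "k = i")
    case True
    have i: "i \<in> {1..n}" using Cons.prems by auto
    have "gen i [^]\<^bsub>A\<^esub> v i = gen i [^]\<^bsub>A\<^esub> a i \<cdot> gen i [^]\<^bsub>A\<^esub> (v i - a i)"
      using AR.nat_pow_mult[OF gen_closed[OF i], of "a i" "v i - a i"] Cons.prems(3) by simp
    also have "\<dots> = \<zero>\<^bsub>A\<^esub>" using i gen_closed[OF i] by (simp add: gen_pow_a)
    finally show ?thesis using True Cons.prems pmon_closed[of xs v] by simp
  next
    case False
    then show ?thesis using Cons gen_closed[of k] by simp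
  qed
qed simp

text \<open>The new factor travels to its place among the variables and picks up \<open>q k i\<close> for every
  smaller variable \<open>k\<close> that it passes.\<close>

lemma gen_pmon:
  assumes "sorted_wrt (<) xs" "set xs \<subseteq> {1..n}" "i \<in> set xs"
  shows "gen i \<cdot> pmon xs v =
    (\<Prod>k\<in>{k\<in>set xs. k < i}. q k i ^ v k) \<bullet> pmon xs (\<lambda>k. unit_vec i k + v k)"
  using assms
proof (induction xs)
  case (Cons k xs)
  have k: "k \<in> {1..n}" and i: "i \<in> {1..n}" and xs: "set xs \<subseteq> {1..n}" using Cons.prems by auto
  note c = gen_closed[OF k] gen_closed[OF i] pmon_closed[OF xs]
  show ?case
  proof (cases "k = i")
    case True
    have e: "{k' \<in> set (k # xs). k' < i} = {}" using Cons.prems True by auto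
    have "i \<notin> set xs" using Cons.prems True by auto
    hence p: "pmon xs (\<lambda>k. unit_vec i k + v k) = pmon xs v"
      by (intro pmon_cong) (auto simp: unit_vec_def)
    have "gen i \<cdot> pmon (k # xs) v = gen i [^]\<^bsub>A\<^esub> Suc (v i) \<cdot> pmon xs v"
      using c True AR.nat_pow_Suc2[OF c(2), of "v i"] by (simp add: AR.m_assoc del: AR.nat_pow_Suc)
    moreover have "unit_vec i i + v i = Suc (v i)" by (simp add: unit_vec_def)
    ultimately show ?thesis
      unfolding e using True c by (simp add: p A_smult_one)
  next
    case False
    hence ixs: "i \<in> set xs" and ki: "k < i" using Cons.prems by auto
    have knot: "k \<notin> set xs" using Cons.prems by auto
    have e: "{k' \<in> set (k # xs). k' < i} = insert k {k' \<in> set xs. k' < i}" using ki by auto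
    have IH: "gen i \<cdot> pmon xs v =
      (\<Prod>k\<in>{k\<in>set xs. k < i}. q k i ^ v k) \<bullet> pmon xs (\<lambda>k. unit_vec i k + v k)"
      using Cons ixs by auto
    have u: "unit_vec i k + v k = v k" using False by (simp add: unit_vec_def)
    have "gen i \<cdot> pmon (k # xs) v = (gen i \<cdot> gen k [^]\<^bsub>A\<^esub> v k) \<cdot> pmon xs v"
      using c by (simp add: AR.m_assoc)
    also have "\<dots> = (q k i) ^ v k \<bullet> (gen k [^]\<^bsub>A\<^esub> v k \<cdot> (gen i \<cdot> pmon xs v))"
      using c by (simp add: gen_commute_pow[OF i k] A_smult_mult AR.m_assoc)
    also have "\<dots> = (q k i ^ v k * (\<Prod>k\<in>{k\<in>set xs. k < i}. q k i ^ v k)) \<bullet>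
        (gen k [^]\<^bsub>A\<^esub> v k \<cdot> pmon xs (\<lambda>k. unit_vec i k + v k))"
      using c by (simp add: IH A_smult_mult A_smult_smult)
    also have "q k i ^ v k * (\<Prod>k\<in>{k\<in>set xs. k < i}. q k i ^ v k) =
        (\<Prod>k\<in>{k'\<in>set (k # xs). k' < i}. q k i ^ v k)"
      unfolding e using knot by (subst prod.insert) auto
    finally show ?thesis using u by simp
  qed
qed simp

lemma gen_mon:
  assumes "i \<in> {1..n}"
  shows "gen i \<cdot> mon v = qp (unit_vec i) v \<bullet> mon (\<lambda>k. unit_vec i k + v k)"
proof -
  have e: "{k \<in> set [1..<Suc n]. k < i} = {1..<i}" using assms by auto
  have "gen i \<cdot> pmon [1..<Suc n] v =
      (\<Prod>k\<in>{k \<in> set [1..<Suc n]. k < i}. q k i ^ v k) \<bullet> pmon [1..<Suc n] (\<lambda>k. unit_vec i k + v k)"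
    by (rule gen_pmon) (use assms in \<open>auto simp del: upt_Suc\<close>)
  thus ?thesis
    unfolding mon_eq_pmon e qpair_unit_left[OF assms] .
qed

lemma mon_zero: "mon (\<lambda>_. 0) = \<one>\<^bsub>A\<^esub>"
proof -
  have *: "set xs \<subseteq> {1..n} \<Longrightarrow> pmon xs (\<lambda>_. 0) = \<one>\<^bsub>A\<^esub>" for xs
    by (induction xs) auto
  show ?thesis unfolding mon_eq_pmon by (rule *) auto
qed

text \<open>The letters are inserted one by one with \<open>gen_mon\<close>. This shows that the ordered monomials span.\<close>

lemma coset_word:
  assumes "set w \<subseteq> {1..n}"
  shows "coset (Poly_Mapping.single (Word w) 1) = wt w \<bullet> mon (count_list w)"
  using assms
proof (induction w)
  case Nil
  then show ?case using A_smult_one[OF AR.one_closed] by (simp add: mon_zero coset_one one_eq_single)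
next
  case (Cons i w)
  have "Poly_Mapping.single (Word (i # w)) 1 = free_gen i * Poly_Mapping.single (Word w) (1::'k)"
    by (simp add: free_gen_def mult_single plus_free_word_def)
  hence "coset (Poly_Mapping.single (Word (i # w)) 1) = gen i \<cdot> coset (Poly_Mapping.single (Word w) 1)"
    using Cons.prems gen_in_Fr[of i] by (simp add: qci_gen_def coset_mult single_in_Fr)
  also have "\<dots> = wt w \<bullet> (gen i \<cdot> mon (count_list w))"
    using Cons gen_closed[of i] by (simp add: A_smult_mult)
  also have "\<dots> = wt (i # w) \<bullet> mon (count_list (i # w))"
    using Cons.prems by (subst gen_mon) (auto simp: A_smult_smult count_list_Cons_fun mult.commute
        simp del: count_list.simps)
  finally show ?case .
qed

lemma coset_mon_word:
  assumes "set xs \<subseteq> {1..n}"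
  shows "pmon xs v = coset (Poly_Mapping.single (Word (mon_word v xs)) 1)"
  using assms
proof (induction xs)
  case Nil
  then show ?case by (simp add: mon_word_def coset_one one_eq_single)
next
  case (Cons i xs)
  have "set (mon_word v xs) \<subseteq> {1..n}" using set_mon_word Cons.prems by fastforce
  moreover have "set (replicate (v i) i) \<subseteq> {1..n}" using Cons.prems by auto
  moreover have "mon_word v (i # xs) = replicate (v i) i @ mon_word v xs" by (simp add: mon_word_def)
  ultimately show ?case using Cons
    by (simp add: gen_pow free_gen_power coset_mult single_in_Fr mult_single plus_free_word_def)
qed

lemma wt_mon_word:
  assumes "sorted_wrt (<) xs" "set xs \<subseteq> {1..n}"
  shows "wt (mon_word v xs) = 1"
  using assms
proof (induction xs)
  case Nil
  then show ?case by (simp add: mon_word_def)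
next
  case (Cons i xs)
  have i: "i \<in> {1..n}" using Cons.prems by auto
  have one: "qp (unit_vec i) u = 1" if "\<And>k. k < i \<Longrightarrow> u k = 0" for u
    using that i by (auto simp: qpair_unit_left)
  have "distinct xs" using Cons.prems by (auto simp: strict_sorted_iff)
  hence "count_list (mon_word v xs) k = 0" if "k < i" for k
    using that Cons.prems by (auto simp: count_list_mon_word)
  hence "wt (replicate m i @ mon_word v xs) = wt (mon_word v xs)" for m
    by (induction m) (auto intro!: one simp: count_list_append_fun count_list_replicate)
  with Cons show ?case by (simp add: mon_word_def)
qed

definition std_word :: "(nat \<Rightarrow> nat) \<Rightarrow> nat list" where "std_word v = mon_word v [1..<Suc n]"

lemma std_word: "set (std_word v) \<subseteq> {1..n}" "wt (std_word v) = 1" "mon v = coset (Poly_Mapping.single (Word (std_word v)) 1)"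
proof -
  show "set (std_word v) \<subseteq> {1..n}" unfolding std_word_def using set_mon_word by fastforce
  show "wt (std_word v) = 1" unfolding std_word_def by (rule wt_mon_word) (auto simp: sorted_wrt_upt simp del: upt_Suc)
  show "mon v = coset (Poly_Mapping.single (Word (std_word v)) 1)"
    unfolding std_word_def mon_eq_pmon by (rule coset_mon_word) auto
qed

lemma count_std_word: "(\<And>i. i \<notin> {1..n} \<Longrightarrow> v i = 0) \<Longrightarrow> count_list (std_word v) = v"
  unfolding std_word_def by (rule ext) (subst count_list_mon_word, auto)

lemma mon_mult:
  assumes "\<And>i. i \<notin> {1..n} \<Longrightarrow> u i = 0" "\<And>i. i \<notin> {1..n} \<Longrightarrow> v i = 0"
  shows "mon u \<cdot> mon v = qp u v \<bullet> mon (\<lambda>i. u i + v i)"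
proof -
  have c: "count_list (std_word u) = u" "count_list (std_word v) = v"
    by (rule count_std_word, rule assms, assumption)+
  have "mon u \<cdot> mon v = coset (Poly_Mapping.single (Word (std_word u @ std_word v)) 1)"
    unfolding std_word(3) using std_word(1) by (simp add: coset_mult single_in_Fr mult_single plus_free_word_def)
  also have "\<dots> = qp u v \<bullet> mon (\<lambda>i. u i + v i)"
    using std_word(1)[of u] std_word(1)[of v]
    by (subst coset_word) (simp_all add: word_wt_append std_word(2) c count_list_append_fun)
  finally show ?thesis .
qed

lemma mon_overflow: "i \<in> {1..n} \<Longrightarrow> a i \<le> v i \<Longrightarrow> mon v = \<zero>\<^bsub>A\<^esub>"
  unfolding mon_eq_pmon by (rule pmon_overflow) auto

lemma V_out: "v \<in> V \<Longrightarrow> i \<notin> {1..n} \<Longrightarrow> v i = 0"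
  by (auto simp: exps_def)

lemma V_less: "v \<in> V \<Longrightarrow> i \<in> {1..n} \<Longrightarrow> v i < a i"
proof -
  assume v: "v \<in> V" and i: "i \<in> {1..n}"
  have "v i \<le> a i - 1" using v i unfolding exps_def by blast
  with a_ge_2[OF i] show ?thesis by linarith
qed

lemma mon_mult_V:
  assumes "u \<in> V" "v \<in> V"
  shows "mon u \<cdot> mon v =
    (if (\<lambda>i. u i + v i) \<in> V then qp u v \<bullet> mon (\<lambda>i. u i + v i) else \<zero>\<^bsub>A\<^esub>)"
proof (cases "(\<lambda>i. u i + v i) \<in> V")
  case True
  then show ?thesis using mon_mult[of u v] V_out assms by auto
next
  case False
  then obtain i where "i \<in> {1..n}" "a i \<le> u i + v i"
    using V_out[OF assms(1)] V_out[OF assms(2)] by (fastforce simp: exps_def)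
  then show ?thesis using mon_mult[of u v] V_out assms False mon_overflow[of i "\<lambda>i. u i + v i"]
    by (auto simp: A_smult_zero)
qed

subsection \<open>Coordinates\<close>

text \<open>Coefficient of the ordered monomial \<open>v\<close> after all words have been sorted, still on the level of the
  free algebra.\<close>

definition word_coord :: "(nat \<Rightarrow> nat) \<Rightarrow> (free_word \<Rightarrow>\<^sub>0 'k) \<Rightarrow> 'k" where
  "word_coord v = lin_ext scalars (\<lambda>w. if count_list (letters w) = v then wt (letters w) else 0)"

lemma lin_map_word_coord: "lin_map Fr scalars (word_coord v)"
  unfolding word_coord_def by (rule lin_map_lin_ext[OF finsupp_Fr vspace_scalars]) simp

lemma word_coord_single:
  "word_coord v (Poly_Mapping.single w c) = (if count_list (letters w) = v then c * wt (letters w) else 0)"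
  unfolding word_coord_def by (subst lin_ext_single[OF vspace_scalars]) auto

lemma finsupp_lin_map_mult:
  assumes "p \<in> carrier Fr"
  shows "lin_map Fr Fr (\<lambda>r. p * r)" "lin_map Fr Fr (\<lambda>r. r * p)"
proof -
  have "p * (Poly_Mapping.single 0 c * r) = Poly_Mapping.single 0 c * (p * r)" for c :: 'k and r
    by (metis mult.assoc single_zero_commute)
  thus "lin_map Fr Fr (\<lambda>r. p * r)" "lin_map Fr Fr (\<lambda>r. r * p)"
    using assms by (auto intro!: lin_mapI simp: mult_in_Fr algebra_simps mult_map_scale_conv_mult)
qed

text \<open>By the cocycle rule for weights, a coordinate of a product with a word is a multiple of a single
  coordinate of the other factor, or zero.\<close>

lemma word_coord_word_mult:
  assumes w: "w \<in> words" and p: "p \<in> carrier Fr"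
  shows "word_coord v (Poly_Mapping.single w 1 * p) =
      (if \<forall>i. count_list (letters w) i \<le> v i then
         wt (letters w) * qp (count_list (letters w)) (\<lambda>i. v i - count_list (letters w) i) *
         word_coord (\<lambda>i. v i - count_list (letters w) i) p else 0)" (is "_ = ?R p")
    and "word_coord v (p * Poly_Mapping.single w 1) =
      (if \<forall>i. count_list (letters w) i \<le> v i then
         wt (letters w) * qp (\<lambda>i. v i - count_list (letters w) i) (count_list (letters w)) *
         word_coord (\<lambda>i. v i - count_list (letters w) i) p else 0)" (is "_ = ?R' p")
proof -
  have wF: "Poly_Mapping.single w 1 \<in> carrier Fr" using w single_in_Fr[of "letters w" 1] by simp
  let ?d = "\<lambda>i. v i - count_list (letters w) i"
  have lm: "lin_map Fr scalars (\<lambda>p. if P then d * word_coord u p else 0)" for P d u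
    using lin_mapD[OF lin_map_word_coord] by (auto intro!: lin_mapI simp: algebra_simps)
  have iff: "(\<lambda>i. count_list (letters w) i + count_list (letters u) i) = v \<longleftrightarrow>
     (\<forall>i. count_list (letters w) i \<le> v i) \<and> count_list (letters u) = ?d" (is "?l \<longleftrightarrow> ?r") for u
  proof
    assume l: ?l
    have "v i = count_list (letters w) i + count_list (letters u) i" for i
      using fun_cong[OF l, of i] by simp
    thus ?r by (simp add: fun_eq_iff)
  next
    assume ?r
    thus ?l by (simp add: fun_eq_iff)
  qed
  show "word_coord v (Poly_Mapping.single w 1 * p) = ?R p"
  proof (rule finsupp_space_lin_map_eqI[OF finsupp_Fr vspace_scalars _ lm _ p])
    show "lin_map Fr scalars (\<lambda>p. word_coord v (Poly_Mapping.single w 1 * p))"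
      by (rule lin_map_comp[OF finsupp_lin_map_mult(1)[OF wF] lin_map_word_coord])
    fix u assume "u \<in> words"
    show "word_coord v (Poly_Mapping.single w 1 * Poly_Mapping.single u 1) = ?R (Poly_Mapping.single u 1)"
      using iff[of u] by (auto simp: mult_single word_coord_single plus_free_word_def
          count_list_append_fun word_wt_append)
  qed
  show "word_coord v (p * Poly_Mapping.single w 1) = ?R' p"
  proof (rule finsupp_space_lin_map_eqI[OF finsupp_Fr vspace_scalars _ lm _ p])
    show "lin_map Fr scalars (\<lambda>p. word_coord v (p * Poly_Mapping.single w 1))"
      by (rule lin_map_comp[OF finsupp_lin_map_mult(2)[OF wF] lin_map_word_coord])
    fix u assume "u \<in> words"
    show "word_coord v (Poly_Mapping.single u 1 * Poly_Mapping.single w 1) = ?R' (Poly_Mapping.single u 1)"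
      using iff[of u] by (auto simp: mult_single word_coord_single plus_free_word_def
          count_list_append_fun word_wt_append add.commute)
  qed
qed

definition coord_kernel :: "(free_word \<Rightarrow>\<^sub>0 'k) set" where
  "coord_kernel = {p \<in> carrier Fr. \<forall>v\<in>V. word_coord v p = 0}"

text \<open>If \<open>v\<close> lies in \<open>V\<close>, so do the smaller vectors to which multiplication by words relates the
  \<open>v\<close>-coordinate. Hence vanishing of all coordinates in \<open>V\<close> is stable under multiplication.\<close>

lemma coord_kernel_ideal: "ideal coord_kernel Fr"
proof (rule idealI[OF ring_Fr])
  note l = lin_mapD[OF lin_map_word_coord]
  have "submodule coord_kernel scalars Fr"
  proof (rule vspace_submoduleI[OF vspace_Fr])
    show "\<zero>\<^bsub>Fr\<^esub> \<in> coord_kernel"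
      using lin_map_zero[OF vspace_Fr vspace_scalars lin_map_word_coord] Fr.zero_closed
      by (simp add: coord_kernel_def)
    fix p r c assume p: "p \<in> coord_kernel"
    show "c \<odot>\<^bsub>Fr\<^esub> p \<in> coord_kernel"
      using p l(3)[where x = p and c = c] Fr.smult_closed[of c p] by (simp add: coord_kernel_def)
    assume r: "r \<in> coord_kernel"
    show "p \<oplus>\<^bsub>Fr\<^esub> r \<in> coord_kernel"
      using p r l(2)[where x = p and y = r] Fr.a_closed[of p r] by (simp add: coord_kernel_def)
  qed (auto simp: coord_kernel_def)
  thus "subgroup coord_kernel (add_monoid Fr)" by (simp add: submodule_def)
  fix p r assume p: "p \<in> coord_kernel" and r: "r \<in> carrier Fr"
  have pF: "p \<in> carrier Fr" using p by (simp add: coord_kernel_def)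
  have z: "lin_map Fr scalars (\<lambda>_. 0)" by (auto intro!: lin_mapI)
  have d: "(\<lambda>i. v i - count_list (letters w) i) \<in> V" if "v \<in> V" for v w
    using that by (auto simp: exps_def intro: order_trans[OF diff_le_self])
  have "word_coord v (r * p) = 0" if v: "v \<in> V" for v
  proof (rule finsupp_space_lin_map_eqI[OF finsupp_Fr vspace_scalars _ z _ r])
    show "lin_map Fr scalars (\<lambda>r. word_coord v (r * p))"
      by (rule lin_map_comp[OF finsupp_lin_map_mult(2)[OF pF] lin_map_word_coord])
  qed (use p d[OF v] in \<open>auto simp: word_coord_word_mult pF coord_kernel_def\<close>)
  thus "r \<otimes>\<^bsub>Fr\<^esub> p \<in> coord_kernel" using mult_in_Fr[OF r pF] by (simp add: coord_kernel_def)
  have "word_coord v (p * r) = 0" if v: "v \<in> V" for v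
  proof (rule finsupp_space_lin_map_eqI[OF finsupp_Fr vspace_scalars _ z _ r])
    show "lin_map Fr scalars (\<lambda>r. word_coord v (p * r))"
      by (rule lin_map_comp[OF finsupp_lin_map_mult(1)[OF pF] lin_map_word_coord])
  qed (use p d[OF v] in \<open>auto simp: word_coord_word_mult pF coord_kernel_def\<close>)
  thus "p \<otimes>\<^bsub>Fr\<^esub> r \<in> coord_kernel" using mult_in_Fr[OF pF r] by (simp add: coord_kernel_def)
qed

text \<open>The power of a generator has its only coordinate outside \<open>V\<close>, and both words in a commutation
  relation sort to the same monomial with weights that differ by the factor in the relation.\<close>

lemma relations_in_coord_kernel: "qci_relations n a q \<subseteq> coord_kernel"
proof
  fix p assume p: "p \<in> qci_relations n a q"
  have "word_coord v p = 0" if v: "v \<in> V" for v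
  proof -
    note l = lin_mapD[OF lin_map_word_coord]
    from p consider (1) i where "i \<in> {1..n}" "p = free_gen i ^ a i"
      | (2) i j where "i \<in> {1..n}" "j \<in> {1..n}"
        "p = free_gen j * free_gen i - Poly_Mapping.map ((*) (q i j)) (free_gen i * free_gen j)"
      unfolding qci_relations_def by auto
    thus ?thesis
    proof cases
      case 1
      have "count_list (replicate (a i) i) \<noteq> v"
        using V_less[OF v 1(1)] by (auto simp: count_list_replicate)
      with 1 show ?thesis by (simp add: free_gen_power word_coord_single)
    next
      case 2
      let ?ji = "Poly_Mapping.single (Word [j, i]) (1::'k)" and ?ij = "Poly_Mapping.single (Word [i, j]) (- q i j)"
      have "p = ?ji \<oplus>\<^bsub>Fr\<^esub> ?ij"
        using 2 by (simp add: free_gen_def mult_single plus_free_word_def single_uminus)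
      moreover have "?ji \<in> carrier Fr" "?ij \<in> carrier Fr" using 2 by (auto intro: single_in_Fr)
      ultimately have "word_coord v p = word_coord v ?ji + word_coord v ?ij" using l(2) by simp
      also have "\<dots> = 0"
      proof -
        have c: "count_list [i, j] = count_list [j, i]" by auto
        have "wt [j, i] = q i j * wt [i, j]"
          using 2 q_inv[of i j] q_diag[of i]
          by (auto simp: count_list_Cons_fun qpair_add_right qpair_unit_unit simp del: count_list.simps)
        thus ?thesis using c by (simp add: word_coord_single del: word_wt.simps count_list.simps)
      qed
      finally show ?thesis .
    qed
  qed
  thus "p \<in> coord_kernel" using p relations_subset by (auto simp: coord_kernel_def)
qed

lemma ideal_coord_zero: "p \<in> qci_ideal n a q \<Longrightarrow> v \<in> V \<Longrightarrow> word_coord v p = 0"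
  using FrR.genideal_minimal[OF coord_kernel_ideal relations_in_coord_kernel]
  by (auto simp: qci_ideal_def coord_kernel_def)

text \<open>The word coordinate at a representative; by the preceding lemma it does not depend on the choice.\<close>

definition crd :: "(nat \<Rightarrow> nat) \<Rightarrow> (free_word \<Rightarrow>\<^sub>0 'k) set \<Rightarrow> 'k" where
  "crd v x = the_elem (word_coord v ` x)"

lemma crd_coset:
  assumes "v \<in> V" "p \<in> carrier Fr"
  shows "crd v (coset p) = word_coord v p"
proof -
  have "word_coord v ` coset p = {word_coord v p}"
    by (rule image_coset[OF qci_quot vspace_scalars lin_map_word_coord _ assms(2)])
      (use ideal_coord_zero assms in auto)
  thus ?thesis by (simp add: crd_def)
qed

lemma lin_map_crd:
  assumes "v \<in> V"
  shows "lin_map A scalars (crd v)"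
proof -
  note l = lin_mapD[OF lin_map_word_coord]
  have "p + r \<in> carrier Fr" if "p \<in> carrier Fr" "r \<in> carrier Fr" for p r
    using Fr.a_closed[OF that] by simp
  moreover have "Poly_Mapping.map ((*) c) p \<in> carrier Fr" if "p \<in> carrier Fr" for c p
    using Fr.smult_closed[of c p] that by simp
  moreover note l(2,3)[simplified]
  ultimately show ?thesis
    using assms by (intro lin_mapI) (auto simp: carrier_A coset_add coset_smult crd_coset)
qed

lemma crd_mon:
  assumes "u \<in> V" "v \<in> V"
  shows "crd v (mon u) = (if u = v then 1 else 0)"
proof -
  have "count_list (std_word u) = u" by (rule count_std_word) (rule V_out[OF assms(1)])
  thus ?thesis
    using assms std_word(1)[of u] by (simp add: std_word(2,3) crd_coset single_in_Fr word_coord_single)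
qed

lemma finite_V: "finite V"
proof -
  let ?V = "{f. \<forall>i. (i \<in> {1..n} \<longrightarrow> f i \<in> {..Max (a ` {1..n})}) \<and> (i \<notin> {1..n} \<longrightarrow> f i = 0)}"
  have "finite ?V" by (rule finite_set_of_finite_funs) auto
  moreover have "V \<subseteq> ?V"
  proof
    fix v assume v: "v \<in> V"
    have "v i \<le> Max (a ` {1..n})" if "i \<in> {1..n}" for i
    proof -
      have "a i \<le> Max (a ` {1..n})" using that by (intro Max_ge) auto
      thus ?thesis using V_less[OF v that] by linarith
    qed
    then show "v \<in> ?V" using V_out[OF v] by auto
  qed
  ultimately show ?thesis by (rule finite_subset[rotated])
qed

text \<open>Both sides are linear in a representative of \<open>x\<close>, so it suffices to compare them on words.\<close>

lemma basis_expansion: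
  assumes "x \<in> carrier A"
  shows "x = (\<Oplus>\<^bsub>A\<^esub>v\<in>V. crd v x \<bullet> mon v)"
proof -
  obtain p where p: "p \<in> carrier Fr" "x = coset p" using assms by (auto simp: carrier_A)
  have "coset p = (\<Oplus>\<^bsub>A\<^esub>v\<in>V. word_coord v p \<bullet> mon v)"
  proof (rule finsupp_space_lin_map_eqI[OF finsupp_Fr vspace_A lin_map_qci_coset _ _ p(1)])
    show "lin_map Fr A (\<lambda>p. \<Oplus>\<^bsub>A\<^esub>v\<in>V. word_coord v p \<bullet> mon v)"
      by (rule lin_map_finsum_coeffs[OF vspace_A lin_map_word_coord finite_V]) simp
    fix w assume w: "w \<in> words"
    let ?c = "count_list (letters w)"
    have "coset (Poly_Mapping.single w 1) = wt (letters w) \<bullet> mon ?c"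
      using coset_word[of "letters w"] w by simp
    also have "\<dots> = (\<Oplus>\<^bsub>A\<^esub>v\<in>V. if ?c = v then wt (letters w) \<bullet> mon v else \<zero>\<^bsub>A\<^esub>)"
    proof (cases "?c \<in> V")
      case True
      then show ?thesis
        by (subst A.M.add.finprod_singleton) (auto simp: finite_V A_smult_closed)
    next
      case False
      then obtain i where "i \<in> {1..n}" "a i \<le> ?c i"
        using w by (fastforce simp: exps_def count_list_0_iff)
      hence "mon ?c = \<zero>\<^bsub>A\<^esub>" by (rule mon_overflow)
      moreover have "(\<Oplus>\<^bsub>A\<^esub>v\<in>V. if ?c = v then wt (letters w) \<bullet> mon v else \<zero>\<^bsub>A\<^esub>) = \<zero>\<^bsub>A\<^esub>"
        using False by (intro A.M.add.finprod_one_eqI) auto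
      ultimately show ?thesis by (simp add: A_smult_zero)
    qed
    also have "\<dots> = (\<Oplus>\<^bsub>A\<^esub>v\<in>V. word_coord v (Poly_Mapping.single w 1) \<bullet> mon v)"
      by (rule A.M.finsum_cong') (auto simp: word_coord_single A_smult_zero A_smult_closed)
    finally show "coset (Poly_Mapping.single w 1) = \<dots>" .
  qed
  also have "\<dots> = (\<Oplus>\<^bsub>A\<^esub>v\<in>V. crd v x \<bullet> mon v)"
    by (rule A.M.finsum_cong') (auto simp: p crd_coset A_smult_closed)
  finally show ?thesis using p by simp
qed

lemma crd_finsum:
  assumes "v \<in> V"
  shows "crd v (\<Oplus>\<^bsub>A\<^esub>u\<in>V. c u \<bullet> mon u) = c v"
proof -
  have "crd v (\<Oplus>\<^bsub>A\<^esub>u\<in>V. c u \<bullet> mon u) = (\<Sum>u\<in>V. crd v (c u \<bullet> mon u))"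
    using lin_map_finsum[OF vspace_A vspace_scalars lin_map_crd[OF assms], of "\<lambda>u. c u \<bullet> mon u" V]
    by (simp add: finsum_scalars A_smult_closed)
  also have "\<dots> = (\<Sum>u\<in>V. if u = v then c v else 0)"
    by (rule sum.cong) (auto simp: lin_mapD(3)[OF lin_map_crd[OF assms]] crd_mon assms)
  also have "\<dots> = c v" using assms by (simp add: finite_V)
  finally show ?thesis .
qed

text \<open>Existence of the coordinates is spanning, uniqueness is independence.\<close>

lemma qci_coord_eq:
  assumes "x \<in> carrier A"
  shows "qci_coord n a q x = (\<lambda>v\<in>V. crd v x)"
  unfolding qci_coord_def
proof (rule the_equality, goal_cases)
  case 1
  have "(\<Oplus>\<^bsub>A\<^esub>v\<in>V. (\<lambda>v\<in>V. crd v x) v \<bullet> mon v) = (\<Oplus>\<^bsub>A\<^esub>v\<in>V. crd v x \<bullet> mon v)"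
    by (rule A.M.finsum_cong') (auto simp: A_smult_closed)
  then show ?case using basis_expansion[OF assms] by auto
next
  case (2 c)
  then show ?case using crd_finsum[of _ c] by (auto simp: fun_eq_iff PiE_def extensional_def)
qed

lemma qci_coord_V: "x \<in> carrier A \<Longrightarrow> v \<in> V \<Longrightarrow> qci_coord n a q x v = crd v x"
  by (simp add: qci_coord_eq)

lemma A_lin_map_eqI:
  assumes P: "vspace P" and f: "lin_map A P f" and g: "lin_map A P g"
    and eq: "\<And>v. v \<in> V \<Longrightarrow> f (mon v) = g (mon v)" and x: "x \<in> carrier A"
  shows "f x = g x"
proof -
  interpret P: module scalars P by fact
  have *: "h x = (\<Oplus>\<^bsub>P\<^esub>v\<in>V. crd v x \<odot>\<^bsub>P\<^esub> h (mon v))" if h: "lin_map A P h" for h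
  proof -
    have "h x = h (\<Oplus>\<^bsub>A\<^esub>v\<in>V. crd v x \<bullet> mon v)" using basis_expansion[OF x] by simp
    also have "\<dots> = (\<Oplus>\<^bsub>P\<^esub>v\<in>V. h (crd v x \<bullet> mon v))"
      by (rule lin_map_finsum[OF vspace_A P h]) (auto simp: A_smult_closed)
    also have "\<dots> = (\<Oplus>\<^bsub>P\<^esub>v\<in>V. crd v x \<odot>\<^bsub>P\<^esub> h (mon v))"
      by (rule P.finsum_cong') (auto simp: lin_mapD[OF h] intro!: P.smult_closed)
    finally show ?thesis .
  qed
  show ?thesis
    unfolding *[OF f] *[OF g]
    by (rule P.finsum_cong') (auto simp: eq lin_mapD[OF g] intro!: P.smult_closed)
qed

lemma lin_map_qci_extend:
  assumes P: "vspace P" and f: "f \<in> V \<rightarrow> carrier P"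
  shows "lin_map A P (qci_extend n a q P f)"
proof -
  interpret P: module scalars P by fact
  have "lin_map A P (\<lambda>x. \<Oplus>\<^bsub>P\<^esub>v\<in>V. crd v x \<odot>\<^bsub>P\<^esub> f v)"
    by (rule lin_map_finsum_coeffs[OF P lin_map_crd finite_V f])
  then show ?thesis
    by (rule lin_map_cong[OF vspace_A])
      (auto simp: qci_extend_def qci_coord_V intro!: P.finsum_cong' P.smult_closed funcset_mem[OF f])
qed

lemma qci_extend_mon:
  assumes P: "vspace P" and f: "f \<in> V \<rightarrow> carrier P" and u: "u \<in> V"
  shows "qci_extend n a q P f (mon u) = f u"
proof -
  interpret P: module scalars P by fact
  have fu: "f v \<in> carrier P" if "v \<in> V" for v using f that by auto
  have "qci_extend n a q P f (mon u) = (\<Oplus>\<^bsub>P\<^esub>v\<in>V. if u = v then f v else \<zero>\<^bsub>P\<^esub>)"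
    unfolding qci_extend_def using P.smult_one[OF fu] P.smult_l_null[OF fu] fu
    by (intro P.finsum_cong') (auto simp: qci_coord_V crd_mon u)
  also have "\<dots> = f u"
    using u fu by (subst P.add.finprod_singleton) (auto simp: finite_V)
  finally show ?thesis .
qed

lemma fin_dim_A: "fin_dim A"
  unfolding fin_dim_def
proof (intro exI[of _ "mon ` V"] conjI ballI)
  show "finite (mon ` V)" using finite_V by simp
  show "mon ` V \<subseteq> carrier A" by auto
  fix x assume x: "x \<in> carrier A"
  have inj: "inj_on mon V"
    by (rule inj_onI) (metis crd_mon zero_neq_one)
  have "x = (\<Oplus>\<^bsub>A\<^esub>v\<in>V. crd v x \<bullet> mon v)" by (rule basis_expansion[OF x])
  also have "\<dots> = (\<Oplus>\<^bsub>A\<^esub>v\<in>V. crd (inv_into V mon (mon v)) x \<bullet> mon v)"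
    by (rule A.M.finsum_cong') (auto simp: inj A_smult_closed)
  also have "\<dots> = (\<Oplus>\<^bsub>A\<^esub>b\<in>mon ` V. crd (inv_into V mon b) x \<bullet> b)"
    by (rule A.M.finsum_reindex[symmetric]) (auto simp: inj A_smult_closed)
  finally show "\<exists>c. x = (\<Oplus>\<^bsub>A\<^esub>b\<in>mon ` V. c b \<bullet> b)"
    by (rule exI[of _ "\<lambda>b. crd (inv_into V mon b) x"])
qed

end

section \<open>Sweedler calculus\<close>

lemma bilin_comp:
  assumes "bilin M N P \<beta>" "lin_map P Q g"
  shows "bilin M N Q (\<lambda>x y. g (\<beta> x y))"
  by (intro bilinI lin_map_comp[OF _ assms(2)] bilinD[OF assms(1)])

lemma bilin_flip: "bilin M N P \<beta> \<Longrightarrow> bilin N M P (\<lambda>y x. \<beta> x y)"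
  by (simp add: bilin_def)

lemma bilin_comp_args:
  assumes "bilin M' N' P \<beta>" "lin_map M M' f" "lin_map N N' g"
  shows "bilin M N P (\<lambda>x y. \<beta> (f x) (g y))"
proof (rule bilinI)
  fix x assume "x \<in> carrier M"
  then show "lin_map N P (\<lambda>y. \<beta> (f x) (g y))"
    using lin_map_comp[OF assms(3) bilinD(1)[OF assms(1)]] lin_mapD(1)[OF assms(2)] by blast
next
  fix y assume "y \<in> carrier N"
  then have "lin_map M' P (\<lambda>x. \<beta> x (g y))"
    using bilinD(2)[OF assms(1)] lin_mapD(1)[OF assms(3)] by blast
  then show "lin_map M P (\<lambda>x. \<beta> (f x) (g y))"
    by (rule lin_map_comp[OF assms(2)])
qed

lemma bilin_smult:
  assumes P: "vspace P"
  shows "bilin scalars P P (\<lambda>c x. c \<odot>\<^bsub>P\<^esub> x)"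
proof -
  interpret P: module scalars P by fact
  show ?thesis
    by (intro bilinI lin_mapI)
       (auto simp: P.smult_r_distr P.smult_l_distr[simplified] mult.commute
             simp flip: P.smult_assoc1[simplified] intro!: P.smult_closed)
qed

lemma bilin_scale:
  assumes "vspace P" "lin_map M scalars f" "lin_map N P g"
  shows "bilin M N P (\<lambda>x y. f x \<odot>\<^bsub>P\<^esub> g y)" "bilin N M P (\<lambda>y x. f x \<odot>\<^bsub>P\<^esub> g y)"
  using bilin_comp_args[OF bilin_smult[OF assms(1)] assms(2,3)] bilin_flip by blast+

lemma bilin_pure:
  assumes "vspace M'" "vspace N'" "lin_map M M' f" "lin_map N N' g"
  shows "bilin M N (tensor M' N') (\<lambda>x y. pure_tensor M' N' (f x) (g y))"
    and "bilin N M (tensor M' N') (\<lambda>y x. pure_tensor M' N' (f x) (g y))"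
  using bilin_comp_args[OF bilin_pure_tensor[OF assms(1,2)] assms(3,4)] bilin_flip by blast+

lemma tensor_lift_comp:
  assumes M: "vspace M" and N: "vspace N" and P: "vspace P" and Q: "vspace Q"
    and \<beta>: "bilin M N P \<beta>" and g: "lin_map P Q g" and T: "T \<in> carrier (tensor M N)"
  shows "g (tensor_lift M N P \<beta> T) = tensor_lift M N Q (\<lambda>x y. g (\<beta> x y)) T"
proof (rule tensor_lin_map_eqI[OF M N Q _ _ _ T])
  show "lin_map (tensor M N) Q (\<lambda>T. g (tensor_lift M N P \<beta> T))"
    by (rule lin_map_comp[OF lin_map_tensor_lift[OF M N P \<beta>] g])
  show "lin_map (tensor M N) Q (tensor_lift M N Q (\<lambda>x y. g (\<beta> x y)))"
    by (rule lin_map_tensor_lift[OF M N Q bilin_comp[OF \<beta> g]])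
qed (simp add: tensor_lift_pure[OF M N P \<beta>] tensor_lift_pure[OF M N Q bilin_comp[OF \<beta> g]])

lemma tensor_lift_cong:
  assumes M: "vspace M" and N: "vspace N" and P: "vspace P"
    and \<beta>: "bilin M N P \<beta>" and \<gamma>: "bilin M N P \<gamma>" and T: "T \<in> carrier (tensor M N)"
    and eq: "\<And>x y. x \<in> carrier M \<Longrightarrow> y \<in> carrier N \<Longrightarrow> \<beta> x y = \<gamma> x y"
  shows "tensor_lift M N P \<beta> T = tensor_lift M N P \<gamma> T"
  by (rule tensor_lin_map_eqI[OF M N P lin_map_tensor_lift[OF M N P \<beta>] lin_map_tensor_lift[OF M N P \<gamma>] _ T])
     (simp add: tensor_lift_pure[OF M N P \<beta>] tensor_lift_pure[OF M N P \<gamma>] eq)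

lemma dual_spaceD: "f \<in> dual_space M \<Longrightarrow> lin_map M scalars f"
  by (simp add: dual_space_def)

lemma dual_spaceI: "lin_map M scalars f \<Longrightarrow> vspace M \<Longrightarrow> restrict f (carrier M) \<in> dual_space M"
  using lin_map_cong[of M scalars f "restrict f (carrier M)"] by (auto simp: dual_space_def)

lemma assoc_algebra_lin_maps:
  assumes "assoc_algebra A" "x \<in> carrier A"
  shows "lin_map A A (\<lambda>y. y \<otimes>\<^bsub>A\<^esub> x)" "lin_map A A (\<lambda>y. x \<otimes>\<^bsub>A\<^esub> y)"
proof -
  interpret ring A using assms(1) by (simp add: assoc_algebra_def)
  show "lin_map A A (\<lambda>y. y \<otimes>\<^bsub>A\<^esub> x)" "lin_map A A (\<lambda>y. x \<otimes>\<^bsub>A\<^esub> y)"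
    using assms by (auto intro!: lin_mapI simp: l_distr r_distr assoc_algebra_def)
qed

section \<open>Antipodes of bi-Frobenius algebras\<close>

locale bi_frobenius_algebra =
  fixes A :: "('k::field, 'a) module" and \<Delta> \<epsilon> \<phi> t S
  assumes bi_frobenius: "bi_frobenius A \<Delta> \<epsilon> \<phi> t S"
begin

lemma bi_frobenius_simps:
  shows assoc: "assoc_algebra A" and coalg: "coalgebra A \<Delta> \<epsilon>"
    and phi: "lin_map A scalars \<phi>" and t: "t \<in> carrier A" and S: "lin_map A A S"
    and S_eq: "x \<in> carrier A \<Longrightarrow> S x = tensor_lift A A A (\<lambda>y z. \<phi> (y \<otimes>\<^bsub>A\<^esub> x) \<odot>\<^bsub>A\<^esub> z) (\<Delta> t)"
    and eps_one: "\<epsilon> \<one>\<^bsub>A\<^esub> = 1"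
    and eps_mult: "x \<in> carrier A \<Longrightarrow> y \<in> carrier A \<Longrightarrow> \<epsilon> (x \<otimes>\<^bsub>A\<^esub> y) = \<epsilon> x * \<epsilon> y"
    and frob: "frobenius_algebra A \<phi>" and cofrob: "frobenius_coalgebra A \<Delta> t"
    and S_one: "S \<one>\<^bsub>A\<^esub> = \<one>\<^bsub>A\<^esub>"
    and S_mult: "x \<in> carrier A \<Longrightarrow> y \<in> carrier A \<Longrightarrow> S (x \<otimes>\<^bsub>A\<^esub> y) = S y \<otimes>\<^bsub>A\<^esub> S x"
    and eps_S: "x \<in> carrier A \<Longrightarrow> \<epsilon> (S x) = \<epsilon> x"
    and Delta_S: "x \<in> carrier A \<Longrightarrow>
       \<Delta> (S x) = tensor_lift A A (tensor A A) (\<lambda>y z. pure_tensor A A (S z) (S y)) (\<Delta> x)"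
    and eps: "lin_map A scalars \<epsilon>" and Delta: "lin_map A (tensor A A) \<Delta>"
    and counit1: "x \<in> carrier A \<Longrightarrow> tensor_lift A A A (\<lambda>y z. \<epsilon> y \<odot>\<^bsub>A\<^esub> z) (\<Delta> x) = x"
    and counit2: "x \<in> carrier A \<Longrightarrow> tensor_lift A A A (\<lambda>y z. \<epsilon> z \<odot>\<^bsub>A\<^esub> y) (\<Delta> x) = x"
  using bi_frobenius by (auto simp: bi_frobenius_def coalgebra_def dual_space_def)

lemma vspace_alg: "vspace A"
  using assoc by (simp add: assoc_algebra_def)

interpretation A: module scalars A by (rule vspace_alg)
interpretation AR: ring A using assoc by (simp add: assoc_algebra_def)

lemmas mult_lin = assoc_algebra_lin_maps[OF assoc]

lemma Delta_t: "\<Delta> t \<in> carrier (tensor A A)"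
  by (rule lin_mapD(1)[OF Delta t])

lemma phi_mult_lin: "x \<in> carrier A \<Longrightarrow> lin_map A scalars (\<lambda>y. \<phi> (y \<otimes>\<^bsub>A\<^esub> x))"
  by (rule lin_map_comp[OF mult_lin(1) phi])

text \<open>Apply $\varepsilon$ to the formula for \<open>S\<close> and use the counit axiom to collapse $\Delta(t)$ to \<open>t\<close>.
  By nondegeneracy of $\phi$ this identity makes \<open>t\<close> an integral.\<close>

lemma phi_t_mult:
  assumes x: "x \<in> carrier A"
  shows "\<phi> (t \<otimes>\<^bsub>A\<^esub> x) = \<epsilon> x"
proof -
  note V = vspace_alg
  have b: "bilin A A A (\<lambda>y z. \<epsilon> z \<odot>\<^bsub>A\<^esub> y)"
    by (rule bilin_scale(2)[OF V eps lin_map_ident])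
  have "\<epsilon> x = \<epsilon> (tensor_lift A A A (\<lambda>y z. \<phi> (y \<otimes>\<^bsub>A\<^esub> x) \<odot>\<^bsub>A\<^esub> z) (\<Delta> t))"
    using eps_S[OF x] S_eq[OF x] by simp
  also have "\<dots> = tensor_lift A A scalars (\<lambda>y z. \<epsilon> (\<phi> (y \<otimes>\<^bsub>A\<^esub> x) \<odot>\<^bsub>A\<^esub> z)) (\<Delta> t)"
    by (rule tensor_lift_comp[OF V V V vspace_scalars _ eps Delta_t])
       (rule bilin_scale(1)[OF V phi_mult_lin[OF x] lin_map_ident])
  also have "\<dots> = tensor_lift A A scalars (\<lambda>y z. \<phi> ((\<epsilon> z \<odot>\<^bsub>A\<^esub> y) \<otimes>\<^bsub>A\<^esub> x)) (\<Delta> t)"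
    using x phi_mult_lin[OF x] by (intro tensor_lift_cong[OF V V vspace_scalars _ _ Delta_t])
      (auto simp: lin_mapD[OF phi] lin_mapD[OF eps] lin_mapD[OF phi_mult_lin[OF x]]
        intro!: bilin_comp[OF _ eps] bilin_scale(1)[OF V] lin_map_ident bilin_comp[OF b])
  also have "\<dots> = \<phi> (tensor_lift A A A (\<lambda>y z. \<epsilon> z \<odot>\<^bsub>A\<^esub> y) (\<Delta> t) \<otimes>\<^bsub>A\<^esub> x)"
    by (rule tensor_lift_comp[OF V V V vspace_scalars b phi_mult_lin[OF x] Delta_t, symmetric])
  also have "\<dots> = \<phi> (t \<otimes>\<^bsub>A\<^esub> x)" by (simp add: counit2 t)
  finally show ?thesis by simp
qed

text \<open>In the formula for \<open>S t\<close> the first leg of $\Delta(t)$ meets only \<open>t\<close>, on which it acts by $\varepsilon$.\<close>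

lemma S_t_of_left_integral:
  assumes int: "\<And>y. y \<in> carrier A \<Longrightarrow> y \<otimes>\<^bsub>A\<^esub> t = \<epsilon> y \<odot>\<^bsub>A\<^esub> t"
  shows "S t = t"
proof -
  note V = vspace_alg
  have "\<phi> (t \<otimes>\<^bsub>A\<^esub> \<one>\<^bsub>A\<^esub>) = 1" by (simp add: phi_t_mult eps_one)
  hence p: "\<phi> t = 1" by (simp add: t)
  have "S t = tensor_lift A A A (\<lambda>y z. \<phi> (y \<otimes>\<^bsub>A\<^esub> t) \<odot>\<^bsub>A\<^esub> z) (\<Delta> t)" by (rule S_eq[OF t])
  also have "\<dots> = tensor_lift A A A (\<lambda>y z. \<epsilon> y \<odot>\<^bsub>A\<^esub> z) (\<Delta> t)"
    by (rule tensor_lift_cong[OF V V V _ _ Delta_t])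
       (auto simp: int lin_mapD[OF phi] p t intro!: bilin_scale(1)[OF V] phi_mult_lin eps lin_map_ident)
  also have "\<dots> = t" by (rule counit1[OF t])
  finally show ?thesis .
qed

text \<open>If \<open>S\<close> fixes \<open>t\<close>, the anti-comultiplicativity of \<open>S\<close> says that $\Delta(t)$ equals
  $\sum S(t_2) \otimes S(t_1)$; so any bilinear expression in the two legs may be replaced by its flipped version.\<close>

lemma lift_Delta_t_flip:
  assumes St: "S t = t" and P: "vspace P" and \<beta>: "bilin A A P \<beta>"
  shows "tensor_lift A A P \<beta> (\<Delta> t) = tensor_lift A A P (\<lambda>y z. \<beta> (S z) (S y)) (\<Delta> t)"
proof -
  note V = vspace_alg
  have "tensor_lift A A P \<beta> (\<Delta> t) =
      tensor_lift A A P \<beta> (tensor_lift A A (tensor A A) (\<lambda>y z. pure_tensor A A (S z) (S y)) (\<Delta> t))"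
    using Delta_S[OF t] St by simp
  also have "\<dots> = tensor_lift A A P (\<lambda>y z. tensor_lift A A P \<beta> (pure_tensor A A (S z) (S y))) (\<Delta> t)"
    by (rule tensor_lift_comp[OF V V vspace_tensor[OF V V] P bilin_pure(2)[OF V V S S]
          lin_map_tensor_lift[OF V V P \<beta>] Delta_t])
  also have "\<dots> = tensor_lift A A P (\<lambda>y z. \<beta> (S z) (S y)) (\<Delta> t)"
    by (rule tensor_lift_cong[OF V V P _ _ Delta_t])
       (use lin_mapD(1)[OF S] in \<open>auto simp: tensor_lift_pure[OF V V P \<beta>]
          intro!: bilin_comp[OF bilin_pure(2)[OF V V S S] lin_map_tensor_lift[OF V V P \<beta>]]
            bilin_flip[OF bilin_comp_args[OF \<beta> S S]]\<close>)
  finally show ?thesis .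
qed

text \<open>Every element is a slice of $\Delta(t)$, and by the flip the second leg lies in the image of \<open>S\<close>.\<close>

lemma S_surj:
  assumes St: "S t = t" and x: "x \<in> carrier A"
  shows "\<exists>y\<in>carrier A. S y = x"
proof -
  note V = vspace_alg
  obtain f where f: "f \<in> dual_space A" "x = tensor_lift A A A (\<lambda>y z. f y \<odot>\<^bsub>A\<^esub> z) (\<Delta> t)"
    using cofrob x unfolding frobenius_coalgebra_def by blast
  note fl = dual_spaceD[OF f(1)]
  have b: "bilin A A A (\<lambda>y z. f (S z) \<odot>\<^bsub>A\<^esub> y)"
    by (rule bilin_scale(2)[OF V lin_map_comp[OF S fl] lin_map_ident])
  have "x = tensor_lift A A A (\<lambda>y z. f (S z) \<odot>\<^bsub>A\<^esub> S y) (\<Delta> t)"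
    unfolding f(2) by (rule lift_Delta_t_flip[OF St V bilin_scale(1)[OF V fl lin_map_ident]])
  also have "\<dots> = tensor_lift A A A (\<lambda>y z. S (f (S z) \<odot>\<^bsub>A\<^esub> y)) (\<Delta> t)"
    by (rule tensor_lift_cong[OF V V V _ _ Delta_t])
       (auto simp: lin_mapD[OF S] intro!: bilin_scale(2)[OF V lin_map_comp[OF S fl] S] bilin_comp[OF b S])
  also have "\<dots> = S (tensor_lift A A A (\<lambda>y z. f (S z) \<odot>\<^bsub>A\<^esub> y) (\<Delta> t))"
    by (rule tensor_lift_comp[OF V V V V b S Delta_t, symmetric])
  finally show ?thesis
    using lin_mapD(1)[OF lin_map_tensor_lift[OF V V V b] Delta_t] by metis
qed

text \<open>Flip $\Delta(t)$ in the formula for \<open>S x\<close> and cancel \<open>S\<close>: this writes \<open>x\<close> as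
  $\sum \phi(S(t_2) x) t_1$. Multiplying by \<open>w\<close> and applying $\phi$ recovers the formula for \<open>S w\<close>.\<close>

lemma nakayama_S_squared:
  assumes St: "S t = t" and inj: "inj_on S (carrier A)"
    and x: "x \<in> carrier A" and w: "w \<in> carrier A"
  shows "\<phi> (x \<otimes>\<^bsub>A\<^esub> w) = \<phi> (S (S w) \<otimes>\<^bsub>A\<^esub> x)"
proof -
  note V = vspace_alg
  note Sc = lin_mapD(1)[OF S]
  have px: "lin_map A scalars (\<lambda>z. \<phi> (S z \<otimes>\<^bsub>A\<^esub> x))"
    by (rule lin_map_comp[OF S phi_mult_lin[OF x]])
  have b: "bilin A A A (\<lambda>y z. \<phi> (S z \<otimes>\<^bsub>A\<^esub> x) \<odot>\<^bsub>A\<^esub> y)"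
    by (rule bilin_scale(2)[OF V px lin_map_ident])
  have bw: "bilin A A A (\<lambda>y z. \<phi> (y \<otimes>\<^bsub>A\<^esub> w) \<odot>\<^bsub>A\<^esub> z)"
    by (rule bilin_scale(1)[OF V phi_mult_lin[OF w] lin_map_ident])
  let ?r = "tensor_lift A A A (\<lambda>y z. \<phi> (S z \<otimes>\<^bsub>A\<^esub> x) \<odot>\<^bsub>A\<^esub> y) (\<Delta> t)"
  have "S x = tensor_lift A A A (\<lambda>y z. \<phi> (S z \<otimes>\<^bsub>A\<^esub> x) \<odot>\<^bsub>A\<^esub> S y) (\<Delta> t)"
    unfolding S_eq[OF x]
    by (rule lift_Delta_t_flip[OF St V bilin_scale(1)[OF V phi_mult_lin[OF x] lin_map_ident]])
  also have "\<dots> = tensor_lift A A A (\<lambda>y z. S (\<phi> (S z \<otimes>\<^bsub>A\<^esub> x) \<odot>\<^bsub>A\<^esub> y)) (\<Delta> t)"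
    by (rule tensor_lift_cong[OF V V V _ _ Delta_t])
       (auto simp: lin_mapD[OF S] intro!: bilin_scale(2)[OF V px S] bilin_comp[OF b S])
  also have "\<dots> = S ?r"
    by (rule tensor_lift_comp[OF V V V V b S Delta_t, symmetric])
  finally have "x = ?r"
    using inj x lin_mapD(1)[OF lin_map_tensor_lift[OF V V V b] Delta_t] by (auto dest: inj_onD)
  hence "\<phi> (x \<otimes>\<^bsub>A\<^esub> w) = \<phi> (?r \<otimes>\<^bsub>A\<^esub> w)" by simp
  also have "\<dots> = tensor_lift A A scalars (\<lambda>y z. \<phi> ((\<phi> (S z \<otimes>\<^bsub>A\<^esub> x) \<odot>\<^bsub>A\<^esub> y) \<otimes>\<^bsub>A\<^esub> w)) (\<Delta> t)"
    by (rule tensor_lift_comp[OF V V V vspace_scalars b phi_mult_lin[OF w] Delta_t])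
  also have "\<dots> = tensor_lift A A scalars (\<lambda>y z. \<phi> (S (\<phi> (y \<otimes>\<^bsub>A\<^esub> w) \<odot>\<^bsub>A\<^esub> z) \<otimes>\<^bsub>A\<^esub> x)) (\<Delta> t)"
    by (rule tensor_lift_cong[OF V V vspace_scalars
          bilin_comp[OF b phi_mult_lin[OF w]] bilin_comp[OF bw px] Delta_t])
       (simp add: lin_mapD[OF phi_mult_lin[OF w]] lin_mapD[OF px])
  also have "\<dots> = \<phi> (S (S w) \<otimes>\<^bsub>A\<^esub> x)"
    unfolding S_eq[OF w]
    by (rule tensor_lift_comp[OF V V V vspace_scalars bw px Delta_t, symmetric])
  finally show ?thesis .
qed

end

section \<open>A permutation antipode yields a compatible involution\<close>

lemma unit_vec_inject: "unit_vec i = unit_vec k \<longleftrightarrow> i = k"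
  by (auto simp: unit_vec_def fun_eq_iff split: if_splits)

context quantum_ci
begin

lemma zero_V: "(\<lambda>_. 0) \<in> V"
  by (simp add: exps_def)

lemma unit_V: "i \<in> {1..n} \<Longrightarrow> unit_vec i \<in> V"
  using a_ge_2[of i] by (auto simp: exps_def unit_vec_def)

lemma top_V: "top \<in> V"
  by (auto simp: exps_def top_vec_def)

lemma V_le_top: "v \<in> V \<Longrightarrow> v i \<le> top i"
  by (auto simp: exps_def top_vec_def)

lemma co_V: "co_vec n a v \<in> V"
  by (auto simp: exps_def top_vec_def co_vec_def)

lemma V_mono: "v \<in> V \<Longrightarrow> (\<And>i. w i \<le> v i) \<Longrightarrow> w \<in> V"
proof -
  assume v: "v \<in> V" and w: "\<And>i. w i \<le> v i"
  have "w i \<le> a i - 1" if i: "i \<in> {1..n}" for i using V_less[OF v i] w[of i] by linarith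
  moreover have "w i = 0" if "i \<notin> {1..n}" for i using V_out[OF v that] w[of i] by simp
  ultimately show ?thesis by (simp add: exps_def)
qed

lemma V_decompose:
  assumes "v \<in> V" "v \<noteq> (\<lambda>_. 0)"
  obtains i v' where "i \<in> {1..n}" "v' \<in> V" "v = (\<lambda>k. unit_vec i k + v' k)"
proof -
  obtain i where i: "v i \<noteq> 0" using assms(2) by auto
  let ?v = "\<lambda>k. if k = i then v i - 1 else v k"
  have "i \<in> {1..n}" by (rule ccontr) (use V_out[OF assms(1), of i] i in simp)
  moreover have "?v \<in> V" by (rule V_mono[OF assms(1)]) auto
  moreover have "v = (\<lambda>k. unit_vec i k + ?v k)" using i by (auto simp: unit_vec_def)
  ultimately show ?thesis by (rule that)
qed

lemma gen_eq_mon: "i \<in> {1..n} \<Longrightarrow> gen i = mon (unit_vec i)"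
  using gen_mon[of i "\<lambda>_. 0"] gen_closed[of i] by (simp add: mon_zero A_smult_one)

lemma A_mult_lin:
  assumes "x \<in> carrier A"
  shows "lin_map A A (\<lambda>y. y \<cdot> x)" "lin_map A A (\<lambda>y. x \<cdot> y)"
  by (rule assoc_algebra_lin_maps[OF assoc_algebra_A assms])+

lemma crd_smult_mon: "u \<in> V \<Longrightarrow> v \<in> V \<Longrightarrow> crd v (c \<bullet> mon u) = (if u = v then c else 0)"
  by (simp add: lin_mapD(3)[OF lin_map_crd] crd_mon)

lemma smult_mon_eq:
  assumes "c \<bullet> mon u = d \<bullet> mon v" "u \<in> V" "v \<in> V" "c \<noteq> 0"
  shows "u = v \<and> c = d"
proof -
  have "c = (if v = u then d else 0)"
    using crd_smult_mon[OF assms(2,2), of c] crd_smult_mon[OF assms(3,2), of d] assms(1) by simp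
  thus ?thesis using assms(4) by (auto split: if_splits)
qed

lemma crd_eqI:
  assumes "x \<in> carrier A" "y \<in> carrier A" "\<And>v. v \<in> V \<Longrightarrow> crd v x = crd v y"
  shows "x = y"
proof -
  have "(\<Oplus>\<^bsub>A\<^esub>v\<in>V. crd v x \<bullet> mon v) = (\<Oplus>\<^bsub>A\<^esub>v\<in>V. crd v y \<bullet> mon v)"
    by (rule A.M.finsum_cong') (auto simp: assms(3) A_smult_closed)
  thus ?thesis using basis_expansion[OF assms(1)] basis_expansion[OF assms(2)] by simp
qed

lemma mon_mult_top:
  assumes "v \<in> V"
  shows "mon v \<cdot> mon top = (if v = (\<lambda>_. 0) then mon top else \<zero>\<^bsub>A\<^esub>)"
    and "mon top \<cdot> mon v = (if v = (\<lambda>_. 0) then mon top else \<zero>\<^bsub>A\<^esub>)"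
proof -
  consider "v = (\<lambda>_. 0)" | i where "v i \<noteq> 0" "v \<noteq> (\<lambda>_. 0)" by auto
  then have "mon v \<cdot> mon top = (if v = (\<lambda>_. 0) then mon top else \<zero>\<^bsub>A\<^esub>) \<and>
    mon top \<cdot> mon v = (if v = (\<lambda>_. 0) then mon top else \<zero>\<^bsub>A\<^esub>)"
  proof cases
    case 1
    show ?thesis unfolding 1 mon_zero by simp
  next
    case (2 i)
    have "(\<lambda>i. v i + top i) \<notin> V" "(\<lambda>i. top i + v i) \<notin> V"
      using V_le_top[of "\<lambda>i. v i + top i" i] V_le_top[of "\<lambda>i. top i + v i" i] 2(1) by linarith+
    thus ?thesis
      using mon_mult_V[OF assms top_V] mon_mult_V[OF top_V assms] 2(2) by simp
  qed
  thus "mon v \<cdot> mon top = (if v = (\<lambda>_. 0) then mon top else \<zero>\<^bsub>A\<^esub>)"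
    and "mon top \<cdot> mon v = (if v = (\<lambda>_. 0) then mon top else \<zero>\<^bsub>A\<^esub>)"
    by blast+
qed

lemma mult_mon_top:
  assumes "x \<in> carrier A"
  shows "x \<cdot> mon top = crd (\<lambda>_. 0) x \<bullet> mon top"
proof (rule A_lin_map_eqI[OF vspace_A _ _ _ assms])
  show "lin_map A A (\<lambda>x. x \<cdot> mon top)" by (rule A_mult_lin) simp
  show "lin_map A A (\<lambda>x. crd (\<lambda>_. 0) x \<bullet> mon top)"
    by (rule bilinD(2)[OF bilin_scale(1)[OF vspace_A lin_map_crd[OF zero_V] lin_map_ident]]) simp
qed (simp add: mon_mult_top crd_mon zero_V A_smult_one A_smult_zero)

definition deg :: "(nat \<Rightarrow> nat) \<Rightarrow> nat" where "deg v = (\<Sum>i\<in>{1..n}. v i)"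

lemma deg_add: "deg (\<lambda>i. u i + v i) = deg u + deg v"
  by (simp add: deg_def sum.distrib)

lemma deg_unit: "i \<in> {1..n} \<Longrightarrow> deg (unit_vec i) = 1"
  by (simp add: deg_def unit_vec_def)

lemma deg_zero_iff: "v \<in> V \<Longrightarrow> deg v = 0 \<longleftrightarrow> v = (\<lambda>_. 0)"
  using V_out[of v] by (auto simp: deg_def fun_eq_iff)

lemma deg_le_imp_eq:
  assumes "u \<in> V" "v \<in> V" "\<And>i. u i \<le> v i" "deg v \<le> deg u"
  shows "u = v"
proof (rule ext, rule ccontr)
  fix i assume ne: "u i \<noteq> v i"
  hence "i \<in> {1..n}" using V_out assms(1,2) by metis
  hence "deg u < deg v"
    unfolding deg_def using assms(3) ne by (intro sum_strict_mono_ex1) (auto intro!: bexI[of _ i] le_neq_trans)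
  with assms(4) show False by simp
qed

lemma unit_of_deg_1:
  assumes "v \<in> V" "deg v = 1"
  obtains i where "i \<in> {1..n}" "v = unit_vec i"
proof -
  have "v \<noteq> (\<lambda>_. 0)" using assms(2) by (auto simp: deg_def)
  then obtain i v' where i: "i \<in> {1..n}" "v' \<in> V" "v = (\<lambda>k. unit_vec i k + v' k)"
    using V_decompose[OF assms(1)] by blast
  hence "deg v' = 0" using assms(2) by (simp add: deg_add deg_unit)
  hence "v' = (\<lambda>_. 0)" using deg_zero_iff i by blast
  with i that show ?thesis by auto
qed

context
  fixes \<Delta> \<epsilon> \<phi> t S
  assumes bf: "bi_frobenius A \<Delta> \<epsilon> \<phi> t S"
begin

interpretation B: bi_frobenius_algebra A \<Delta> \<epsilon> \<phi> t S by unfold_locales (rule bf)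

text \<open>The counit is multiplicative and the generators are nilpotent, so it kills them.\<close>

lemma counit_mon: "v \<in> V \<Longrightarrow> \<epsilon> (mon v) = (if v = (\<lambda>_. 0) then 1 else 0)"
proof (cases "v = (\<lambda>_. 0)")
  case True
  then show ?thesis using B.eps_one by (simp add: mon_zero)
next
  case False
  assume v: "v \<in> V"
  obtain i v' where i: "i \<in> {1..n}" "v' \<in> V" "v = (\<lambda>k. unit_vec i k + v' k)"
    using V_decompose[OF v False] by blast
  have pow: "\<epsilon> (gen i [^]\<^bsub>A\<^esub> m) = \<epsilon> (gen i) ^ m" for m :: nat
    by (induction m) (simp_all add: B.eps_one B.eps_mult gen_closed[OF i(1)])
  have "\<epsilon> (gen i) ^ a i = 0"
    using lin_map_zero[OF vspace_A vspace_scalars B.eps] by (simp add: gen_pow_a[OF i(1)] flip: pow)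
  hence "\<epsilon> (gen i \<cdot> mon v') = 0"
    by (simp add: B.eps_mult gen_closed[OF i(1)])
  hence "qp (unit_vec i) v' * \<epsilon> (mon v) = 0"
    using gen_mon[OF i(1)] lin_mapD(3)[OF B.eps] by (simp add: i(3))
  thus ?thesis using qp_nonzero False by simp
qed

text \<open>The socle element generates a one-dimensional ideal, so $\phi$ could not be nondegenerate otherwise.\<close>

lemma phi_top_nonzero: "\<phi> (mon top) \<noteq> 0"
proof
  assume 0: "\<phi> (mon top) = 0"
  obtain b where b: "b \<in> carrier A" "\<And>x. x \<in> carrier A \<Longrightarrow> restrict (crd top) (carrier A) x = \<phi> (b \<cdot> x)"
    using B.frob dual_spaceI[OF lin_map_crd[OF top_V] vspace_A] unfolding frobenius_algebra_def by metis
  have "1 = \<phi> (b \<cdot> mon top)" using b(2)[of "mon top"] by (simp add: crd_mon top_V)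
  also have "\<dots> = 0" using b(1) by (simp add: mult_mon_top lin_mapD(3)[OF B.phi] 0)
  finally show False by simp
qed

text \<open>Let \<open>v\<close> have least degree in the support of \<open>t\<close>. Then $t x_{a-1-v}$ is a nonzero multiple of the
  socle element, so $\varepsilon(x_{a-1-v}) \neq 0$ because $\phi(tx) = \varepsilon(x)$. This forces
  $v = a-1$, and then no other vector fits into the support.\<close>

lemma t_eq: "t = crd top t \<bullet> mon top"
proof -
  have supp: "w = top" if w: "w \<in> V" "crd w t \<noteq> 0" for w
  proof -
    define X where "X = {v \<in> V. crd v t \<noteq> 0}"
    have fin: "finite X" and ne: "X \<noteq> {}" using finite_V w by (auto simp: X_def)
    obtain v where v: "v \<in> X" "\<And>u. u \<in> X \<Longrightarrow> deg v \<le> deg u"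
      using arg_min_if_finite[OF fin ne, of deg] by (metis leI)
    have vV: "v \<in> V" "crd v t \<noteq> 0" using v by (auto simp: X_def)
    \<comment> \<open>multiplying by the complementary monomial isolates the coefficient of lowest degree\<close>
    let ?d = "co_vec n a v"
    have vd: "(\<lambda>i. v i + ?d i) = top" using V_le_top[OF vV(1)] by (auto simp: co_vec_def)
    have "t \<cdot> mon ?d = (\<Oplus>\<^bsub>A\<^esub>u\<in>V. crd u t \<bullet> (mon u \<cdot> mon ?d))"
    proof -
      have "t \<cdot> mon ?d = (\<Oplus>\<^bsub>A\<^esub>u\<in>V. crd u t \<bullet> mon u) \<cdot> mon ?d"
        using basis_expansion[OF B.t] by simp
      also have "\<dots> = (\<Oplus>\<^bsub>A\<^esub>u\<in>V. (crd u t \<bullet> mon u) \<cdot> mon ?d)"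
        by (rule lin_map_finsum[OF vspace_A vspace_A A_mult_lin(1)]) (auto simp: A_smult_closed)
      also have "\<dots> = (\<Oplus>\<^bsub>A\<^esub>u\<in>V. crd u t \<bullet> (mon u \<cdot> mon ?d))"
        by (rule A.M.finsum_cong') (auto simp: A_smult_mult A_smult_closed)
      finally show ?thesis .
    qed
    also have "\<dots> = (\<Oplus>\<^bsub>A\<^esub>u\<in>V. if v = u then (crd u t * qp u ?d) \<bullet> mon top else \<zero>\<^bsub>A\<^esub>)"
    proof (rule A.M.finsum_cong', goal_cases)
      case (3 u)
      show ?case
      proof (cases "v = u")
        case True
        then show ?thesis using mon_mult_V[OF 3 co_V[of v]] vd top_V by (simp add: A_smult_smult)
      next
        case False
        have "crd u t \<bullet> (mon u \<cdot> mon ?d) = \<zero>\<^bsub>A\<^esub>"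
        proof (cases "u \<in> X")
          case True
          have "(\<lambda>i. u i + ?d i) \<notin> V"
          proof
            assume V: "(\<lambda>i. u i + ?d i) \<in> V"
            have "u i \<le> v i" for i
              using V_le_top[OF V, of i] fun_cong[OF vd, of i] by simp
            hence "u = v" using deg_le_imp_eq[OF 3 vV(1)] v(2)[OF True] by blast
            with False show False by simp
          qed
          thus ?thesis using mon_mult_V[OF 3 co_V[of v]] by (simp add: A_smult_zero)
        next
          case False
          then show ?thesis using 3 by (simp add: X_def A_smult_zero)
        qed
        with False show ?thesis by simp
      qed
    qed (auto simp: A_smult_closed)
    also have "\<dots> = (crd v t * qp v ?d) \<bullet> mon top"
      using vV by (subst A.M.add.finprod_singleton) (auto simp: finite_V A_smult_closed)
    finally have "\<phi> (t \<cdot> mon ?d) = crd v t * qp v ?d * \<phi> (mon top)"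
      by (simp add: lin_mapD(3)[OF B.phi])
    hence "\<epsilon> (mon ?d) \<noteq> 0"
      using B.phi_t_mult[of "mon ?d"] vV qp_nonzero[of v ?d] phi_top_nonzero by simp
    hence d0: "?d = (\<lambda>_. 0)" using counit_mon[OF co_V] by (auto split: if_splits)
    hence "v = top" using vd by simp
    hence "deg top \<le> deg w" using v(2)[of w] w by (simp add: X_def)
    thus "w = top" using deg_le_imp_eq[OF w(1) top_V V_le_top[OF w(1)]] by blast
  qed
  show ?thesis
    by (rule crd_eqI) (use supp in \<open>auto simp: B.t A_smult_closed crd_smult_mon top_V\<close>)
qed

lemma S_t: "S t = t"
proof (rule B.S_t_of_left_integral)
  fix y assume y: "y \<in> carrier A"
  show "y \<cdot> t = \<epsilon> y \<bullet> t"
  proof (rule A_lin_map_eqI[OF vspace_A _ _ _ y])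
    show "lin_map A A (\<lambda>y. y \<cdot> t)" by (rule A_mult_lin(1)[OF B.t])
    show "lin_map A A (\<lambda>y. \<epsilon> y \<bullet> t)"
      by (rule bilinD(2)[OF bilin_scale(1)[OF vspace_A B.eps lin_map_ident] B.t])
    fix v assume v: "v \<in> V"
    have "mon v \<cdot> t = crd top t \<bullet> (mon v \<cdot> mon top)"
      by (subst t_eq) (simp add: A_smult_mult)
    also have "\<dots> = \<epsilon> (mon v) \<bullet> t"
      using v t_eq by (simp add: mon_mult_top counit_mon A_smult_one[OF B.t] A_smult_zero B.t)
    finally show "mon v \<cdot> t = \<epsilon> (mon v) \<bullet> t" .
  qed
qed

context
  fixes \<sigma> c
  assumes \<sigma>: "bij_betw \<sigma> V V" and S_mon: "\<And>v. v \<in> V \<Longrightarrow> S (mon v) = c v \<bullet> mon (\<sigma> v)"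
begin

lemma \<sigma>_V: "v \<in> V \<Longrightarrow> \<sigma> v \<in> V"
  using \<sigma> by (auto simp: bij_betw_def)

lemma \<sigma>_inj: "u \<in> V \<Longrightarrow> v \<in> V \<Longrightarrow> \<sigma> u = \<sigma> v \<Longrightarrow> u = v"
  using \<sigma> by (auto simp: bij_betw_def inj_on_def)

text \<open>The antipode permutes the coordinate axes, so its surjectivity forces all the scalars to be nonzero
  and thereby its injectivity.\<close>

lemma crd_S: "v \<in> V \<Longrightarrow> x \<in> carrier A \<Longrightarrow> crd (\<sigma> v) (S x) = c v * crd v x"
proof -
  assume v: "v \<in> V" and x: "x \<in> carrier A"
  show ?thesis
  proof (rule A_lin_map_eqI[OF vspace_scalars _ _ _ x])
    show "lin_map A scalars (\<lambda>x. crd (\<sigma> v) (S x))"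
      by (rule lin_map_comp[OF B.S lin_map_crd[OF \<sigma>_V[OF v]]])
    show "lin_map A scalars (\<lambda>x. c v * crd v x)"
      using lin_map_smult[OF vspace_scalars lin_map_crd[OF v], of "c v"] by simp
    fix u assume u: "u \<in> V"
    show "crd (\<sigma> v) (S (mon u)) = c v * crd v (mon u)"
      using u v \<sigma>_inj[OF u v] by (auto simp: S_mon crd_smult_mon \<sigma>_V crd_mon)
  qed
qed

lemma c_nonzero: "v \<in> V \<Longrightarrow> c v \<noteq> 0"
proof
  assume v: "v \<in> V" and 0: "c v = 0"
  obtain y where y: "y \<in> carrier A" "S y = mon (\<sigma> v)"
    using B.S_surj[OF S_t, of "mon (\<sigma> v)"] by auto
  have "crd (\<sigma> v) (S y) = 0" using crd_S[OF v y(1)] 0 by simp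
  thus False using crd_mon[OF \<sigma>_V[OF v] \<sigma>_V[OF v]] y by simp
qed

lemma S_inj: "inj_on S (carrier A)"
proof (rule inj_onI)
  fix x y assume x: "x \<in> carrier A" "y \<in> carrier A" "S x = S y"
  show "x = y"
  proof (rule crd_eqI[OF x(1,2)])
    fix v assume v: "v \<in> V"
    show "crd v x = crd v y"
      using crd_S[OF v x(1)] crd_S[OF v x(2)] x(3) c_nonzero[OF v] by simp
  qed
qed

lemma phi_swap: "x \<in> carrier A \<Longrightarrow> w \<in> carrier A \<Longrightarrow> \<phi> (x \<cdot> w) = \<phi> (S (S w) \<cdot> x)"
  by (rule B.nakayama_S_squared[OF S_t S_inj])

text \<open>Compare the two sides of $S(x_u x_v) = S(x_v) S(x_u)$. The left one is nonzero, so the right one is too.\<close>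

lemma \<sigma>_add:
  assumes u: "u \<in> V" and v: "v \<in> V" and uv: "(\<lambda>i. u i + v i) \<in> V"
  shows "\<sigma> (\<lambda>i. u i + v i) = (\<lambda>i. \<sigma> u i + \<sigma> v i)"
    and "qp u v * c (\<lambda>i. u i + v i) = c u * c v * qp (\<sigma> v) (\<sigma> u)"
proof -
  let ?w = "\<lambda>i. u i + v i" and ?s = "\<lambda>i. \<sigma> v i + \<sigma> u i"
  have "(qp u v * c ?w) \<bullet> mon (\<sigma> ?w) = S (mon u \<cdot> mon v)"
    using u v uv by (simp add: mon_mult_V lin_mapD(3)[OF B.S] S_mon A_smult_smult)
  also have "\<dots> = (c u * c v) \<bullet> (mon (\<sigma> v) \<cdot> mon (\<sigma> u))"
    using u v by (simp add: B.S_mult S_mon A_smult_mult A_smult_smult A_smult_closed mult.commute)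
  finally have e: "(qp u v * c ?w) \<bullet> mon (\<sigma> ?w) = \<dots>" .
  have nz: "qp u v * c ?w \<noteq> 0" using qp_nonzero c_nonzero[OF uv] by simp
  have sV: "?s \<in> V"
  proof (rule ccontr)
    assume "?s \<notin> V"
    hence "(qp u v * c ?w) \<bullet> mon (\<sigma> ?w) = 0 \<bullet> mon (\<sigma> ?w)"
      using e u v by (simp add: mon_mult_V \<sigma>_V A_smult_zero)
    from smult_mon_eq[OF this \<sigma>_V[OF uv] \<sigma>_V[OF uv] nz] nz show False by simp
  qed
  hence "(qp u v * c ?w) \<bullet> mon (\<sigma> ?w) = (c u * c v * qp (\<sigma> v) (\<sigma> u)) \<bullet> mon ?s"
    using e u v by (simp add: mon_mult_V \<sigma>_V A_smult_smult)
  from smult_mon_eq[OF this \<sigma>_V[OF uv] sV nz]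
  show "\<sigma> ?w = (\<lambda>i. \<sigma> u i + \<sigma> v i)" "qp u v * c ?w = c u * c v * qp (\<sigma> v) (\<sigma> u)"
    by (auto simp: add.commute)
qed

lemma \<sigma>_zero: "\<sigma> (\<lambda>_. 0) = (\<lambda>_. 0)"
  using \<sigma>_add(1)[OF zero_V zero_V] zero_V by (auto simp: fun_eq_iff)

text \<open>The permutation is additive and sends no unit vector to zero.\<close>

lemma deg_\<sigma>: "v \<in> V \<Longrightarrow> deg v \<le> deg (\<sigma> v)"
proof (induction "deg v" arbitrary: v)
  case (Suc d)
  hence "v \<noteq> (\<lambda>_. 0)" by (auto simp: deg_def)
  then obtain i v' where i: "i \<in> {1..n}" "v' \<in> V" "v = (\<lambda>k. unit_vec i k + v' k)"
    using V_decompose[OF Suc.prems] by blast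
  have "\<sigma> (unit_vec i) \<noteq> (\<lambda>_. 0)"
  proof
    assume "\<sigma> (unit_vec i) = (\<lambda>_. 0)"
    hence "unit_vec i = (\<lambda>_. 0)" using \<sigma>_inj[OF unit_V[OF i(1)] zero_V] \<sigma>_zero by simp
    from fun_cong[OF this, of i] show False by (simp add: unit_vec_def)
  qed
  hence "deg (\<sigma> (unit_vec i)) \<noteq> 0" using deg_zero_iff[OF \<sigma>_V[OF unit_V[OF i(1)]]] by simp
  moreover have "deg v' \<le> deg (\<sigma> v')"
    using Suc i by (intro Suc.hyps(1)) (auto simp: deg_add deg_unit)
  moreover have "deg (\<sigma> v) = deg (\<sigma> (unit_vec i)) + deg (\<sigma> v')"
    using \<sigma>_add(1)[OF unit_V[OF i(1)] i(2)] Suc.prems i by (simp add: deg_add)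
  moreover have "deg v = 1 + deg v'" using i by (simp add: deg_add deg_unit)
  ultimately show ?case by linarith
qed simp

text \<open>A preimage of a unit vector has degree at most one and is nonzero, so it is a unit vector. By counting,
  unit vectors are also mapped to unit vectors.\<close>

lemma \<sigma>_units: "\<sigma> ` (unit_vec ` {1..n}) = unit_vec ` {1..n}"
proof (rule card_subset_eq[symmetric])
  show "unit_vec ` {1..n} \<subseteq> \<sigma> ` (unit_vec ` {1..n})"
  proof
    fix u assume "u \<in> unit_vec ` {1..n}"
    then obtain i where i: "i \<in> {1..n}" "u = unit_vec i" by auto
    have "unit_vec i \<in> \<sigma> ` V" using \<sigma> unit_V[OF i(1)] by (simp add: bij_betw_def)
    then obtain v where v: "v \<in> V" "\<sigma> v = unit_vec i" by auto
    have "deg v \<noteq> 0"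
    proof
      assume "deg v = 0"
      hence "unit_vec i = (\<lambda>_. 0)" using deg_zero_iff[OF v(1)] \<sigma>_zero v(2) by simp
      from fun_cong[OF this, of i] show False by (simp add: unit_vec_def)
    qed
    moreover have "deg v \<le> 1" using deg_\<sigma>[OF v(1)] v(2) deg_unit[OF i(1)] by simp
    ultimately have "deg v = 1" by simp
    then obtain k where "k \<in> {1..n}" "v = unit_vec k" using unit_of_deg_1[OF v(1)] by blast
    thus "u \<in> \<sigma> ` (unit_vec ` {1..n})" using v(2) i(2) by (metis image_eqI)
  qed
  have "card (\<sigma> ` (unit_vec ` {1..n})) \<le> card (unit_vec ` {1..n})"
    by (rule card_image_le) simp
  moreover have "card (unit_vec ` {1..n}) \<le> card (\<sigma> ` (unit_vec ` {1..n}))"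
    by (rule card_mono) (use \<open>unit_vec ` {1..n} \<subseteq> \<sigma> ` (unit_vec ` {1..n})\<close> in auto)
  ultimately show "card (unit_vec ` {1..n}) = card (\<sigma> ` (unit_vec ` {1..n}))" by simp
qed simp

lemma obtain_perm:
  obtains \<pi> where "\<pi> permutes {1..n}" "\<And>i. i \<in> {1..n} \<Longrightarrow> \<sigma> (unit_vec i) = unit_vec (\<pi> i)"
proof -
  have "\<forall>i\<in>{1..n}. \<exists>k\<in>{1..n}. \<sigma> (unit_vec i) = unit_vec k"
    using \<sigma>_units by blast
  then obtain f where f: "\<And>i. i \<in> {1..n} \<Longrightarrow> f i \<in> {1..n} \<and> \<sigma> (unit_vec i) = unit_vec (f i)"
    by metis
  define \<pi> where "\<pi> i = (if i \<in> {1..n} then f i else i)" for i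
  have "inj_on \<pi> {1..n}"
  proof (rule inj_onI)
    fix i k assume i: "i \<in> {1..n}" "k \<in> {1..n}" "\<pi> i = \<pi> k"
    hence "\<sigma> (unit_vec i) = \<sigma> (unit_vec k)" using f by (auto simp: \<pi>_def)
    hence "unit_vec i = unit_vec k" using \<sigma>_inj unit_V i by blast
    thus "i = k" by (simp add: unit_vec_inject)
  qed
  moreover have "\<pi> ` {1..n} \<subseteq> {1..n}" using f by (auto simp: \<pi>_def)
  ultimately have "bij_betw \<pi> {1..n} {1..n}"
    by (simp add: bij_betw_def endo_inj_surj)
  hence "\<pi> permutes {1..n}" by (rule bij_imp_permutes) (simp only: \<pi>_def if_False)
  moreover have "\<sigma> (unit_vec i) = unit_vec (\<pi> i)" if "i \<in> {1..n}" for i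
    using f[OF that] that by (simp add: \<pi>_def)
  ultimately show ?thesis by (rule that)
qed

context
  fixes \<pi> assumes \<pi>: "\<pi> permutes {1..n}" and \<sigma>_unit: "\<And>i. i \<in> {1..n} \<Longrightarrow> \<sigma> (unit_vec i) = unit_vec (\<pi> i)"
begin

lemma \<pi>_in: "i \<in> {1..n} \<Longrightarrow> \<pi> i \<in> {1..n}"
  using permutes_in_image[OF \<pi>] by blast

lemma \<sigma>_multiple:
  assumes i: "i \<in> {1..n}"
  shows "m < a i \<Longrightarrow> \<sigma> (\<lambda>k. m * unit_vec i k) = (\<lambda>k. m * unit_vec (\<pi> i) k)"
proof (induction m)
  case 0
  then show ?case by (simp add: \<sigma>_zero)
next
  case (Suc m)
  have V: "(\<lambda>k. m' * unit_vec i k) \<in> V" if "m' < a i" for m'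
    using that i by (auto simp: exps_def unit_vec_def)
  have "\<sigma> (\<lambda>k. unit_vec i k + m * unit_vec i k) = (\<lambda>k. \<sigma> (unit_vec i) k + \<sigma> (\<lambda>k. m * unit_vec i k) k)"
    by (rule \<sigma>_add(1)[OF unit_V[OF i]]) (use V[of m] V[of "Suc m"] Suc.prems in simp_all)
  then show ?case using Suc \<sigma>_unit[OF i] by simp
qed

text \<open>The multiple $(a_i-1)e_i$ lies in \<open>V\<close>, hence so does $(a_i-1)e_{\pi(i)}$, which gives
  $a_i \le a_{\pi(i)}$; summing over \<open>i\<close> gives equality. For the parameters, divide the multiplicativity
  relation for $(e_i,e_j)$ by the one for $(e_j,e_i)$.\<close>

lemma perm_compatible: "compatible n a q \<pi>"
  unfolding compatible_def
proof (intro conjI ballI)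
  have le: "a i \<le> a (\<pi> i)" if i: "i \<in> {1..n}" for i
  proof -
    have "(\<lambda>k. (a i - 1) * unit_vec i k) \<in> V"
      using i by (auto simp: exps_def unit_vec_def)
    hence "\<sigma> (\<lambda>k. (a i - 1) * unit_vec i k) \<in> V" by (rule \<sigma>_V)
    hence "(\<lambda>k. (a i - 1) * unit_vec (\<pi> i) k) \<in> V"
      using \<sigma>_multiple[OF i, of "a i - 1"] a_ge_2[OF i] by simp
    from V_less[OF this \<pi>_in[OF i]] show ?thesis by (simp add: unit_vec_def)
  qed
  have sum: "(\<Sum>i\<in>{1..n}. a (\<pi> i)) = (\<Sum>i\<in>{1..n}. a i)"
    using sum.permute[OF \<pi>, of a] by (simp add: comp_def)
  fix i assume i: "i \<in> {1..n}"
  show "a (\<pi> i) = a i"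
  proof (rule ccontr)
    assume "a (\<pi> i) \<noteq> a i"
    hence "(\<Sum>i\<in>{1..n}. a i) < (\<Sum>i\<in>{1..n}. a (\<pi> i))"
      using le i by (intro sum_strict_mono_ex1) (auto intro!: bexI[of _ i] le_neq_trans)
    with sum show False by simp
  qed
  fix j assume j: "j \<in> {1..n}"
  show "q (\<pi> i) (\<pi> j) = q j i"
  proof (cases "i = j")
    case True
    then show ?thesis using q_diag i \<pi>_in by simp
  next
    case False
    let ?i = "unit_vec i" and ?j = "unit_vec j"
    have ne: "\<pi> i \<noteq> \<pi> j" using False permutes_inj[OF \<pi>] by (auto dest: injD)
    have ij: "(\<lambda>k. ?i k + ?j k) \<in> V" and ji: "(\<lambda>k. ?j k + ?i k) \<in> V"
      using i j False a_ge_2[OF i] a_ge_2[OF j] by (auto simp: exps_def unit_vec_def)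
    have e: "(\<lambda>k. ?i k + ?j k) = (\<lambda>k. ?j k + ?i k)" by (simp add: add.commute)
    let ?c = "c (\<lambda>k. ?i k + ?j k)" and ?d = "c ?i * c ?j"
    have 1: "qp ?i ?j * ?c = ?d * qp (unit_vec (\<pi> j)) (unit_vec (\<pi> i))"
      using \<sigma>_add(2)[OF unit_V[OF i] unit_V[OF j] ij] by (simp add: \<sigma>_unit[OF i] \<sigma>_unit[OF j])
    have 2: "qp ?j ?i * ?c = ?d * qp (unit_vec (\<pi> i)) (unit_vec (\<pi> j))"
      using \<sigma>_add(2)[OF unit_V[OF j] unit_V[OF i] ji] unfolding e[symmetric]
      by (simp add: \<sigma>_unit[OF i] \<sigma>_unit[OF j] mult.commute)
    have nz: "?c \<noteq> 0" "?d \<noteq> 0" using c_nonzero ij unit_V i j by auto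
    have rat: "qp (unit_vec i) (unit_vec j) = q j i * qp (unit_vec j) (unit_vec i)"
      if "i \<in> {1..n}" "j \<in> {1..n}" "i \<noteq> j" for i j
      using that q_inv[of j i] by (auto simp: qpair_unit_unit)
    have 3: "q j i * (qp ?j ?i * ?c) = ?d * (q (\<pi> i) (\<pi> j) * qp (unit_vec (\<pi> i)) (unit_vec (\<pi> j)))"
      using 1 rat[OF i j False] rat[OF \<pi>_in[OF j] \<pi>_in[OF i]] ne by (simp add: mult_ac)
    have "q j i * (?d * qp (unit_vec (\<pi> i)) (unit_vec (\<pi> j))) = q (\<pi> i) (\<pi> j) * (?d * qp (unit_vec (\<pi> i)) (unit_vec (\<pi> j)))"
      using 3 unfolding 2 by (simp add: mult_ac)
    thus ?thesis using nz qp_nonzero by simp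
  qed
qed

text \<open>The Nakayama identity with the two factors $x_{a-1-e_i}$ and $x_i$: the left side is nonzero, whereas on
  the right side $x_{\pi^2(i)}$ already occurs with its highest power unless $\pi^2(i) = i$.\<close>

lemma perm_involution: "\<pi> \<circ> \<pi> = id"
proof
  fix i
  show "(\<pi> \<circ> \<pi>) i = id i"
  proof (cases "i \<in> {1..n}")
    case False
    then show ?thesis using permutes_not_in[OF \<pi>] by simp
  next
    case i: True
    show ?thesis
    proof (rule ccontr)
      assume "(\<pi> \<circ> \<pi>) i \<noteq> id i"
      hence ne: "\<pi> (\<pi> i) \<noteq> i" by simp
      let ?k = "\<pi> (\<pi> i)" and ?u = "\<lambda>k. top k - unit_vec i k"
      have k: "?k \<in> {1..n}" using \<pi>_in i by simp
      have uV: "?u \<in> V" by (rule V_mono[OF top_V]) simp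
      have ui: "(\<lambda>k. ?u k + unit_vec i k) = top"
        using V_le_top[OF unit_V[OF i]] by auto
      have "mon ?u \<cdot> mon (unit_vec i) = qp ?u (unit_vec i) \<bullet> mon top"
        using mon_mult_V[OF uV unit_V[OF i]] top_V unfolding ui by simp
      hence 1: "\<phi> (mon ?u \<cdot> mon (unit_vec i)) \<noteq> 0"
        using phi_top_nonzero qp_nonzero by (simp add: lin_mapD(3)[OF B.phi])
      have SS: "S (S (mon (unit_vec i))) = (c (unit_vec i) * c (unit_vec (\<pi> i))) \<bullet> mon (unit_vec ?k)"
        by (simp add: S_mon[OF unit_V[OF i]] S_mon[OF unit_V[OF \<pi>_in[OF i]]] \<sigma>_unit[OF i]
            \<sigma>_unit[OF \<pi>_in[OF i]] lin_mapD(3)[OF B.S] A_smult_smult)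
      have "a ?k \<le> unit_vec ?k ?k + ?u ?k"
        using k ne a_ge_2[OF k] by (simp add: unit_vec_def top_vec_def)
      hence "(\<lambda>l. unit_vec ?k l + ?u l) \<notin> V"
        using V_less[OF _ k, of "\<lambda>l. unit_vec ?k l + ?u l"] by auto
      hence "mon (unit_vec ?k) \<cdot> mon ?u = \<zero>\<^bsub>A\<^esub>"
        using mon_mult_V[OF unit_V[OF k] uV] by simp
      hence "\<phi> (S (S (mon (unit_vec i))) \<cdot> mon ?u) = 0"
        using lin_map_zero[OF vspace_A vspace_scalars B.phi]
        by (simp add: SS A_smult_mult A_smult_zero)
      thus False using 1 phi_swap[of "mon ?u" "mon (unit_vec i)"] by simp
    qed
  qed
qed

end

end

end

lemma perm_antipode_imp_involution:
  assumes "bi_frobenius A \<Delta> \<epsilon> \<phi> t S" "perm_antipode n a q S"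
  shows "\<exists>\<pi>. \<pi> permutes {1..n} \<and> compatible n a q \<pi> \<and> \<pi> \<circ> \<pi> = id"
proof -
  obtain \<sigma> c where sc: "bij_betw \<sigma> V V" "\<And>v. v \<in> V \<Longrightarrow> S (mon v) = c v \<bullet> mon (\<sigma> v)"
    using assms(2) unfolding perm_antipode_def by blast
  obtain \<pi> where pi: "\<pi> permutes {1..n}" "\<And>i. i \<in> {1..n} \<Longrightarrow> \<sigma> (unit_vec i) = unit_vec (\<pi> i)"
    using obtain_perm[OF assms(1) sc] by blast
  show ?thesis
    using pi(1) perm_compatible[OF assms(1) sc pi] perm_involution[OF assms(1) sc pi] by blast
qed

end

section \<open>Coefficients of the antipode\<close>

text \<open>Points moved by the involution cancel in pairs.\<close>

lemma prod_involution:
  fixes m :: "'i \<Rightarrow> 'k::comm_monoid_mult"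
  assumes "finite P" "\<And>p. p \<in> P \<Longrightarrow> \<tau> p \<in> P" "\<And>p. p \<in> P \<Longrightarrow> \<tau> (\<tau> p) = p"
    and "\<And>p. p \<in> P \<Longrightarrow> m p * m (\<tau> p) = 1" "\<And>p. p \<in> P \<Longrightarrow> \<tau> p = p \<Longrightarrow> m p = 1"
  shows "prod m P = 1"
  using assms
proof (induction P rule: finite_psubset_induct)
  case (psubset P)
  show ?case
  proof (cases "P = {}")
    case False
    then obtain p where p: "p \<in> P" by auto
    have tp: "\<tau> p \<in> P" and ttp: "\<tau> (\<tau> p) = p" using psubset.prems p by auto
    let ?P = "P - {p, \<tau> p}"
    have "prod m ?P = 1"
    proof (rule psubset.IH)
      show "?P \<subset> P" using p by auto
      fix r assume r: "r \<in> ?P"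
      have "\<tau> (\<tau> r) = r" using r psubset.prems(2) by auto
      thus "\<tau> r \<in> ?P" using r psubset.prems(1)[of r] ttp by auto
    qed (use psubset.prems in auto)
    moreover have "prod m P = prod m ?P * prod m {p, \<tau> p}"
      using p tp psubset.hyps by (intro prod.subset_diff) auto
    moreover have "prod m {p, \<tau> p} = 1"
      using psubset.prems(3)[OF p] psubset.prems(4)[OF p] by (cases "\<tau> p = p") auto
    ultimately show ?thesis by simp
  qed simp
qed

lemma unit_vec_times_self [simp]: "unit_vec i j * unit_vec i k = (if j = i \<and> k = i then 1 else 0)"
  by (simp add: unit_vec_def)

context quantum_ci
begin

lemma qp_units: "i \<in> {1..n} \<Longrightarrow> j \<in> {1..n} \<Longrightarrow> qp (unit_vec i) (unit_vec j) = (if j < i then q j i else 1)"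
  by (simp add: qpair_unit_unit)

lemma mult_eqI:
  fixes F G :: "(nat \<Rightarrow> nat) \<Rightarrow> 'k"
  assumes "F (\<lambda>_. 0) = G (\<lambda>_. 0)" "\<And>u v. F (\<lambda>i. u i + v i) = F u * F v" "\<And>u v. G (\<lambda>i. u i + v i) = G u * G v"
    and "\<And>i. i \<in> {1..n} \<Longrightarrow> F (unit_vec i) = G (unit_vec i)" and "v \<in> V"
  shows "F v = G v"
  using assms(5)
proof (induction "deg v" arbitrary: v)
  case 0
  then show ?case using deg_zero_iff[of v] assms(1) by simp
next
  case (Suc d)
  hence "v \<noteq> (\<lambda>_. 0)" by (auto simp: deg_def)
  then obtain i v' where i: "i \<in> {1..n}" "v' \<in> V" "v = (\<lambda>k. unit_vec i k + v' k)"
    using V_decompose[OF Suc.prems] by blast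
  have "F v' = G v'" using Suc i by (intro Suc.hyps(1)) (auto simp: deg_add deg_unit)
  then show ?case using assms(4)[OF i(1)] unfolding i(3) assms(2,3) by simp
qed

text \<open>Bimultiplicative functions are determined by their values on unit vectors. All identities between the
  coefficients of the antipode are reduced to generators in this way.\<close>

lemma bimult_eqI:
  fixes F G :: "(nat \<Rightarrow> nat) \<Rightarrow> (nat \<Rightarrow> nat) \<Rightarrow> 'k"
  assumes F: "\<And>u u' v. F (\<lambda>i. u i + u' i) v = F u v * F u' v" "\<And>u v v'. F u (\<lambda>i. v i + v' i) = F u v * F u v'"
    and G: "\<And>u u' v. G (\<lambda>i. u i + u' i) v = G u v * G u' v" "\<And>u v v'. G u (\<lambda>i. v i + v' i) = G u v * G u v'"
    and zero: "\<And>v. F (\<lambda>_. 0) v = 1" "\<And>u. F u (\<lambda>_. 0) = 1" "\<And>v. G (\<lambda>_. 0) v = 1" "\<And>u. G u (\<lambda>_. 0) = 1"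
    and units: "\<And>i j. i \<in> {1..n} \<Longrightarrow> j \<in> {1..n} \<Longrightarrow> F (unit_vec i) (unit_vec j) = G (unit_vec i) (unit_vec j)"
    and u: "u \<in> V" and v: "v \<in> V"
  shows "F u v = G u v"
proof (rule mult_eqI[of "\<lambda>u. F u v" "\<lambda>u. G u v", OF _ F(1) G(1) _ u])
  fix i assume i: "i \<in> {1..n}"
  show "F (unit_vec i) v = G (unit_vec i) v"
    by (rule mult_eqI[of "F (unit_vec i)" "G (unit_vec i)", OF _ F(2) G(2) units[OF i] v])
       (simp add: zero)
qed (simp add: zero)

end

locale quantum_ci_perm = quantum_ci n a q for n a and q :: "nat \<Rightarrow> nat \<Rightarrow> 'k::field" +
  fixes \<pi> :: "nat \<Rightarrow> nat"
  assumes \<pi>: "\<pi> permutes {1..n}" and compat: "compatible n a q \<pi>" and invol: "\<pi> \<circ> \<pi> = id"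
begin

lemma \<pi>_\<pi> [simp]: "\<pi> (\<pi> i) = i"
  using fun_cong[OF invol, of i] by simp

lemma \<pi>_in: "\<pi> i \<in> {1..n} \<longleftrightarrow> i \<in> {1..n}"
  using permutes_in_image[OF \<pi>] .

lemma \<pi>_eq_iff [simp]: "\<pi> i = \<pi> j \<longleftrightarrow> i = j"
  by (metis \<pi>_\<pi>)

lemma a_\<pi>: "i \<in> {1..n} \<Longrightarrow> a (\<pi> i) = a i"
  and q_\<pi>: "i \<in> {1..n} \<Longrightarrow> j \<in> {1..n} \<Longrightarrow> q (\<pi> i) (\<pi> j) = q j i"
  using compat by (auto simp: compatible_def)

lemma perm_act_eq: "perm_act \<pi> v = (\<lambda>i. v (\<pi> i))"
proof -
  have "inv_into UNIV \<pi> = \<pi>" by (rule inv_unique_comp[OF invol invol])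
  thus ?thesis by (simp add: perm_act_def)
qed

lemma perm_act_unit: "perm_act \<pi> (unit_vec i) = unit_vec (\<pi> i)"
proof -
  have "\<pi> k = i \<longleftrightarrow> k = \<pi> i" for k by (metis \<pi>_\<pi>)
  thus ?thesis by (simp add: perm_act_eq unit_vec_def)
qed

lemma perm_act_perm_act [simp]: "perm_act \<pi> (perm_act \<pi> v) = v"
  by (simp add: perm_act_eq)

lemma perm_act_zero [simp]: "perm_act \<pi> (\<lambda>_. 0) = (\<lambda>_. 0)"
  by (simp add: perm_act_eq)

lemma perm_act_add: "perm_act \<pi> (\<lambda>i. u i + v i) = (\<lambda>i. perm_act \<pi> u i + perm_act \<pi> v i)"
  by (simp add: perm_act_eq)

lemma perm_act_top [simp]: "perm_act \<pi> top = top"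
proof
  fix i
  show "perm_act \<pi> top i = top i"
    using \<pi>_in[of i] a_\<pi>[of i] by (cases "i \<in> {1..n}") (simp_all only: perm_act_eq top_vec_def if_True if_False)
qed

lemma perm_act_V: "v \<in> V \<Longrightarrow> perm_act \<pi> v \<in> V"
proof -
  assume v: "v \<in> V"
  show ?thesis
  proof (rule V_mono[OF top_V])
    fix i
    have "v (\<pi> i) \<le> top (\<pi> i)" by (rule V_le_top[OF v])
    also have "\<dots> = top i" using fun_cong[OF perm_act_top, of i] by (simp add: perm_act_eq)
    finally show "perm_act \<pi> v i \<le> top i" by (simp add: perm_act_eq)
  qed
qed

lemma perm_act_V_iff: "perm_act \<pi> v \<in> V \<longleftrightarrow> v \<in> V"
  using perm_act_V[of v] perm_act_V[of "perm_act \<pi> v"] by auto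

lemma bij_perm_act: "bij_betw (perm_act \<pi>) V V"
  by (rule bij_betwI[of _ _ _ "perm_act \<pi>"]) (auto simp: perm_act_V)

abbreviation Q :: "nat \<Rightarrow> nat \<Rightarrow> 'k" where
  "Q j k \<equiv> qpair n q (perm_act \<pi> (unit_vec k)) (perm_act \<pi> (unit_vec j))"

text \<open>The failure of the quadratic part of the antipode coefficient to be multiplicative.\<close>

definition cross :: "(nat \<Rightarrow> nat) \<Rightarrow> (nat \<Rightarrow> nat) \<Rightarrow> 'k" where
  "cross u v = (\<Prod>(j, k)\<in>{(j, k). 1 \<le> j \<and> j < k \<and> k \<le> n}. Q j k ^ (u j * v k + v j * u k))"

lemma cross_units:
  assumes "i \<in> {1..n}" "l \<in> {1..n}"
  shows "cross (unit_vec i) (unit_vec l) = (if i < l then Q i l else if l < i then Q l i else 1)"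
proof -
  have "cross (unit_vec i) (unit_vec l) =
      (\<Prod>p\<in>{(j, k). 1 \<le> j \<and> j < k \<and> k \<le> n}. if p = (min i l, max i l) then Q (min i l) (max i l) else 1)"
    unfolding cross_def
    by (rule prod.cong) (auto simp: unit_vec_def min_def max_def split: if_splits)
  also have "\<dots> = (if i \<noteq> l then Q (min i l) (max i l) else 1)"
    using assms by (subst prod.delta) (auto simp: min_def max_def)
  finally show ?thesis by (auto simp: min_def max_def)
qed

text \<open>On unit vectors this is a comparison of the orders of \<open>i, j\<close> and of their images, where compatibility
  of $\pi$ supplies the values.\<close>

lemma qp_cross:
  assumes "u \<in> V" "v \<in> V"
  shows "qp u v * cross u v = qp (perm_act \<pi> v) (perm_act \<pi> u)"
proof (rule bimult_eqI[of "\<lambda>u v. qp u v * cross u v" "\<lambda>u v. qp (perm_act \<pi> v) (perm_act \<pi> u)", OF _ _ _ _ _ _ _ _ _ assms])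
  fix i j assume ij: "i \<in> {1..n}" "j \<in> {1..n}"
  note ij' = ij[THEN \<pi>_in[THEN iffD2]]
  show "qp (unit_vec i) (unit_vec j) * cross (unit_vec i) (unit_vec j) =
      qp (perm_act \<pi> (unit_vec j)) (perm_act \<pi> (unit_vec i))"
    unfolding cross_units[OF ij] perm_act_unit qp_units[OF ij] qp_units[OF ij'(1,2)] qp_units[OF ij'(2,1)]
    using q_inv[OF ij] q_inv[OF ij(2,1)] q_\<pi>[OF ij] q_\<pi>[OF ij(2,1)] by (cases "\<pi> i" "\<pi> j" rule: linorder_cases) auto
qed (auto simp: qpair_add_left qpair_add_right cross_def perm_act_add algebra_simps power_add prod.distrib split_def)

lemma qp_perm_act_flip:
  assumes "u \<in> V" "v \<in> V"
  shows "qp (perm_act \<pi> v) (perm_act \<pi> u) * qp v u = qp u v * qp (perm_act \<pi> u) (perm_act \<pi> v)"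
proof (rule bimult_eqI[of "\<lambda>u v. qp (perm_act \<pi> v) (perm_act \<pi> u) * qp v u"
      "\<lambda>u v. qp u v * qp (perm_act \<pi> u) (perm_act \<pi> v)", OF _ _ _ _ _ _ _ _ _ assms])
  fix i j assume ij: "i \<in> {1..n}" "j \<in> {1..n}"
  note ij' = ij[THEN \<pi>_in[THEN iffD2]]
  show "qp (perm_act \<pi> (unit_vec j)) (perm_act \<pi> (unit_vec i)) * qp (unit_vec j) (unit_vec i) =
      qp (unit_vec i) (unit_vec j) * qp (perm_act \<pi> (unit_vec i)) (perm_act \<pi> (unit_vec j))"
    unfolding perm_act_unit qp_units[OF ij] qp_units[OF ij(2,1)] qp_units[OF ij'(1,2)] qp_units[OF ij'(2,1)]
    using q_inv[OF ij] q_inv[OF ij(2,1)] q_\<pi>[OF ij] q_\<pi>[OF ij(2,1)]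
    by (cases "\<pi> i" "\<pi> j" rule: linorder_cases; cases i j rule: linorder_cases) (auto simp: mult.commute)
qed (auto simp: qpair_add_left qpair_add_right perm_act_add mult_ac)

abbreviation sc :: "(nat \<Rightarrow> 'k) \<Rightarrow> (nat \<Rightarrow> nat) \<Rightarrow> 'k" where "sc c \<equiv> antipode_coeff n q \<pi> c"

lemma sc_add: "sc c (\<lambda>i. u i + v i) = sc c u * sc c v * cross u v"
proof -
  have "(\<Prod>(j, k)\<in>{(j, k). 1 \<le> j \<and> j < k \<and> k \<le> n}. Q j k ^ ((u j + v j) * (u k + v k))) =
      (\<Prod>(j, k)\<in>{(j, k). 1 \<le> j \<and> j < k \<and> k \<le> n}.
        Q j k ^ (u j * u k) * Q j k ^ (v j * v k) * Q j k ^ (u j * v k + v j * u k))"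
    by (rule prod.cong) (auto simp: algebra_simps simp flip: power_add)
  thus ?thesis
    by (simp add: antipode_coeff_def cross_def power_add prod.distrib split_def mult_ac)
qed

lemma sc_zero [simp]: "sc c (\<lambda>_. 0) = 1"
  by (simp add: antipode_coeff_def split_def)

lemma sc_unit:
  assumes "i \<in> {1..n}"
  shows "sc c (unit_vec i) = c i"
proof -
  have "(\<Prod>(j, k)\<in>{(j, k). 1 \<le> j \<and> j < k \<and> k \<le> n}. Q j k ^ (unit_vec i j * unit_vec i k)) = 1"
    by (rule prod.neutral) auto
  moreover have "(\<Prod>k\<in>{1..n}. c k ^ unit_vec i k) = (\<Prod>k\<in>{1..n}. if k = i then c i else 1)"
    by (rule prod.cong) (auto simp: unit_vec_def)
  ultimately show ?thesis using assms by (simp add: antipode_coeff_def)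
qed

text \<open>This is the identity $S(x_u x_v) = S(x_v) S(x_u)$ on the level of coefficients.\<close>

lemma sc_mult:
  assumes "u \<in> V" "v \<in> V"
  shows "qp u v * sc c (\<lambda>i. u i + v i) = sc c u * sc c v * qp (perm_act \<pi> v) (perm_act \<pi> u)"
  unfolding qp_cross[OF assms, symmetric] sc_add by (simp add: mult_ac)

text \<open>In other words, $S^2$ is the identity. It is so on generators, and \<open>sc_mult\<close>, used twice, propagates it
  to sums of vectors; the remaining factors cancel by \<open>qp_perm_act_flip\<close>.\<close>

lemma sc_perm_act:
  assumes c: "\<And>i. i \<in> {1..n} \<Longrightarrow> c i * c (\<pi> i) = 1" and v: "v \<in> V"
  shows "sc c v * sc c (perm_act \<pi> v) = 1"
  using v
proof (induction "deg v" arbitrary: v)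
  case 0
  then show ?case using deg_zero_iff[of v] by simp
next
  case (Suc d)
  hence "v \<noteq> (\<lambda>_. 0)" by (auto simp: deg_def)
  then obtain i v' where i: "i \<in> {1..n}" "v' \<in> V" "v = (\<lambda>k. unit_vec i k + v' k)"
    using V_decompose[OF Suc.prems] by blast
  let ?u = "unit_vec i" and ?p = "perm_act \<pi>"
  have uV: "?u \<in> V" by (rule unit_V[OF i(1)])
  have IH: "sc c v' * sc c (?p v') = 1"
    using Suc i by (intro Suc.hyps(1)) (auto simp: deg_add deg_unit)
  have u1: "sc c ?u * sc c (?p ?u) = 1"
    using c[OF i(1)] i(1) \<pi>_in[of i] by (simp only: perm_act_unit sc_unit)
  have "(qp ?u v' * qp (?p ?u) (?p v')) * (sc c v * sc c (?p v)) =
      (qp ?u v' * sc c v) * (qp (?p ?u) (?p v') * sc c (?p v))" by (simp add: mult_ac)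
  also have "qp ?u v' * sc c v = sc c ?u * sc c v' * qp (?p v') (?p ?u)"
    unfolding i(3) by (rule sc_mult[OF uV i(2)])
  also have "qp (?p ?u) (?p v') * sc c (?p v) = sc c (?p ?u) * sc c (?p v') * qp v' ?u"
    unfolding i(3) perm_act_add using sc_mult[OF perm_act_V[OF uV] perm_act_V[OF i(2)]] by simp
  also have "(sc c ?u * sc c v' * qp (?p v') (?p ?u)) * (sc c (?p ?u) * sc c (?p v') * qp v' ?u) =
      (sc c ?u * sc c (?p ?u)) * (sc c v' * sc c (?p v')) * (qp (?p v') (?p ?u) * qp v' ?u)"
    by (simp add: mult_ac)
  also have "\<dots> = qp ?u v' * qp (?p ?u) (?p v')"
    by (simp add: IH u1 qp_perm_act_flip[OF uV i(2)])
  finally show ?case using qp_nonzero by (simp add: mult_cancel_left1)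
qed

lemma q_perm_eq: "q_perm n a q \<pi> * (\<Prod>i\<in>{1..n}. c i ^ (a i - 1)) = sc c top"
proof -
  have "q_perm n a q \<pi> =
      (\<Prod>(j, k)\<in>{(j, k). 1 \<le> j \<and> j < k \<and> k \<le> n}. Q j k ^ (top j * top k))"
    unfolding q_perm_def by (rule prod.cong) (auto simp: top_vec_def mult.commute)
  moreover have "(\<Prod>i\<in>{1..n}. c i ^ (a i - 1)) = (\<Prod>i\<in>{1..n}. c i ^ top i)"
    by (rule prod.cong) (auto simp: top_vec_def)
  ultimately show ?thesis by (simp add: antipode_coeff_def mult.commute)
qed

text \<open>The number $q_\pi$ is the coefficient of the antipode at the top vector when all scalars are \<open>1\<close>.\<close>

lemma q_perm_square: "q_perm n a q \<pi> * q_perm n a q \<pi> = 1"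
  using sc_perm_act[of "\<lambda>_. 1" top] top_V q_perm_eq[of "\<lambda>_. 1"] by simp

text \<open>Write $q_\pi$ as a product over the pairs whose order is preserved by $\pi$. The factors of a pair and of
  its image are inverse to each other, so only pairs of fixed indices $j<k$ contribute. Their factor
  $q_{kj}^{(a_k-1)(a_j-1)}$ has $q_{kj} = \pm 1$ by compatibility, so it can differ from $1$ only if both exponents are odd.\<close>

lemma q_perm_nontrivial:
  assumes "q_perm n a q \<pi> \<noteq> 1"
  obtains i where "i \<in> {1..n}" "\<pi> i = i" "odd (a i - 1)" "q_perm n a q \<pi> = -1"
proof -
  let ?P = "{(j, k). 1 \<le> j \<and> j < k \<and> k \<le> n}"
  let ?N = "{(j, k). 1 \<le> j \<and> j < k \<and> k \<le> n \<and> \<pi> j < \<pi> k}"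
  let ?m = "\<lambda>(j, k). q k j ^ ((a k - 1) * (a j - 1))"
  let ?\<tau> = "\<lambda>(j, k). (\<pi> j, \<pi> k)"
  have Q: "Q j k = (if \<pi> j < \<pi> k then q k j else 1)" if "j \<in> {1..n}" "k \<in> {1..n}" for j k
    using that[THEN \<pi>_in[THEN iffD2]] q_\<pi>[OF that] unfolding perm_act_unit by (simp only: qp_units)
  have "q_perm n a q \<pi> = (\<Prod>p\<in>?P. if p \<in> ?N then ?m p else 1)"
    unfolding q_perm_def by (rule prod.cong) (auto simp: Q split: if_splits)
  also have "\<dots> = prod ?m ?N"
  proof -
    have e: "?P \<inter> ?N = ?N" by auto
    have "finite ?P" by simp
    from prod.inter_restrict[OF this, of ?m ?N] show ?thesis unfolding e by (rule sym)
  qed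
  finally have qp_eq: "q_perm n a q \<pi> = prod ?m ?N" .
  \<comment> \<open>otherwise all factors cancel in pairs under the involution\<close>
  have "\<exists>p\<in>?N. ?\<tau> p = p \<and> ?m p \<noteq> 1"
  proof (rule ccontr)
    assume no: "\<not> ?thesis"
    have "prod ?m ?N = 1"
    proof (rule prod_involution[where \<tau> = ?\<tau>])
      show "finite ?N" by (rule finite_subset[of _ ?P]) auto
      fix p assume p: "p \<in> ?N"
      then obtain j k where jk: "p = (j, k)" "j \<in> {1..n}" "k \<in> {1..n}" "j < k" "\<pi> j < \<pi> k" by auto
      note jk' = jk(2,3)[THEN \<pi>_in[THEN iffD2]]
      show "?\<tau> p \<in> ?N" using jk jk' by auto
      show "?\<tau> (?\<tau> p) = p" using jk by simp
      show "?m p * ?m (?\<tau> p) = 1"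
        using jk(1) q_\<pi>[OF jk(3,2)] a_\<pi>[OF jk(2)] a_\<pi>[OF jk(3)] q_inv[OF jk(3,2)]
        by (simp flip: power_mult_distrib)
      show "?\<tau> p = p \<Longrightarrow> ?m p = 1" using no p by blast
    qed
    with qp_eq assms show False by simp
  qed
  then obtain j k where "(j, k) \<in> ?N" "\<pi> j = j" "\<pi> k = k"
    "q k j ^ ((a k - 1) * (a j - 1)) \<noteq> 1" by auto
  hence jk: "j \<in> {1..n}" "k \<in> {1..n}" "\<pi> j = j" "\<pi> k = k"
    "q k j ^ ((a k - 1) * (a j - 1)) \<noteq> 1" by auto
  have "q k j * q k j = 1" using q_\<pi>[OF jk(1,2)] q_inv[OF jk(2,1)] jk(3,4) by simp
  hence "q k j = 1 \<or> q k j = -1" by (simp add: square_eq_1_iff)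
  with jk(5) have m: "q k j = -1" by auto
  have "odd ((a k - 1) * (a j - 1))"
    using jk(5) unfolding m by (rule contrapos_nn) (simp add: minus_one_power_iff)
  hence "odd (a j - 1)" by simp
  moreover have "q_perm n a q \<pi> = -1" using q_perm_square assms square_eq_1_iff by blast
  ultimately show ?thesis using that jk by blast
qed

text \<open>All scalars can be \<open>1\<close> if $q_\pi = 1$. Otherwise $q_\pi = -1$, and the sign is corrected at one fixed
  index with odd exponent, where the condition on $c_i c_{\pi(i)}$ is insensitive to the sign.\<close>

lemma exists_scalars:
  "\<exists>c :: nat \<Rightarrow> 'k. (\<forall>i\<in>{1..n}. c i * c (\<pi> i) = 1) \<and>
     q_perm n a q \<pi> * (\<Prod>i\<in>{1..n}. c i ^ (a i - 1)) = 1"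
proof (cases "q_perm n a q \<pi> = 1")
  case True
  then show ?thesis by (intro exI[of _ "\<lambda>_. 1"]) simp
next
  case False
  then obtain i where i: "i \<in> {1..n}" "\<pi> i = i" "odd (a i - 1)" "q_perm n a q \<pi> = -1"
    by (rule q_perm_nontrivial)
  let ?c = "\<lambda>k. if k = i then -1 else 1 :: 'k"
  have "\<pi> k = i \<longleftrightarrow> k = i" for k using i(2) \<pi>_eq_iff[of k i] by simp
  hence "\<forall>k\<in>{1..n}. ?c k * ?c (\<pi> k) = 1" by simp
  moreover have "(\<Prod>k\<in>{1..n}. ?c k ^ (a k - 1)) = (\<Prod>k\<in>{1..n}. if k = i then (-1) ^ (a i - 1) else 1)"
    by (rule prod.cong) auto
  hence "(\<Prod>k\<in>{1..n}. ?c k ^ (a k - 1)) = -1" using i(1,3) by simp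
  ultimately show ?thesis using i(4) by (intro exI[of _ ?c]) simp
qed

end

section \<open>Symmetric quantum complete intersections\<close>

lemma (in quantum_ci) top_mult:
  assumes "x \<in> carrier A"
  shows "mon top \<cdot> x = crd (\<lambda>_. 0) x \<bullet> mon top"
proof (rule A_lin_map_eqI[OF vspace_A _ _ _ assms])
  show "lin_map A A (\<lambda>x. mon top \<cdot> x)" by (rule A_mult_lin) simp
  show "lin_map A A (\<lambda>x. crd (\<lambda>_. 0) x \<bullet> mon top)"
    by (rule bilinD(2)[OF bilin_scale(1)[OF vspace_A lin_map_crd[OF zero_V] lin_map_ident]]) simp
qed (simp add: mon_mult_top crd_mon zero_V A_smult_one A_smult_zero)

text \<open>The image of \<open>1\<close> under a bimodule isomorphism onto the dual is a functional with
  $\phi(xy) = \phi(yx)$. It does not vanish on the socle element, by injectivity; so $x_u x_v$ and $x_v x_u$ are the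
  same multiple of it.\<close>

lemma (in quantum_ci) symmetric_qp:
  assumes "symmetric_algebra A" and u: "u \<in> V" and v: "v \<in> V" and uv: "(\<lambda>i. u i + v i) = top"
  shows "qp u v = qp v u"
proof -
  obtain \<Phi> where bij: "bij_betw \<Phi> (carrier A) (dual_space A)"
    and \<Phi>: "\<forall>b\<in>carrier A. \<forall>x\<in>carrier A. \<forall>z\<in>carrier A.
          \<Phi> (b \<cdot> x) z = \<Phi> x (z \<cdot> b) \<and> \<Phi> (x \<cdot> b) z = \<Phi> x (b \<cdot> z)"
    using assms(1) unfolding symmetric_algebra_def by blast
  define \<phi> where "\<phi> = \<Phi> \<one>\<^bsub>A\<^esub>"
  have \<phi>: "lin_map A scalars \<phi>"
    using bij dual_spaceD unfolding \<phi>_def bij_betw_def by blast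
  have L: "\<Phi> b z = \<phi> (z \<cdot> b)" and R: "\<Phi> b z = \<phi> (b \<cdot> z)" if "b \<in> carrier A" "z \<in> carrier A" for b z
    using \<Phi>[rule_format, OF that(1) AR.one_closed that(2)]
    unfolding \<phi>_def AR.r_one[OF that(1)] AR.l_one[OF that(1)] by blast+
  have nz: "\<phi> (mon top) \<noteq> 0"
  proof
    assume 0: "\<phi> (mon top) = 0"
    have "\<Phi> (mon top) = \<Phi> \<zero>\<^bsub>A\<^esub>"
    proof
      fix z
      show "\<Phi> (mon top) z = \<Phi> \<zero>\<^bsub>A\<^esub> z"
      proof (cases "z \<in> carrier A")
        case True
        then show ?thesis
          using lin_map_zero[OF vspace_A vspace_scalars \<phi>]
          by (simp add: R top_mult lin_mapD(3)[OF \<phi>] 0)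
      next
        case False
        have "\<Phi> (mon top) \<in> dual_space A" "\<Phi> \<zero>\<^bsub>A\<^esub> \<in> dual_space A"
          using bij by (auto simp: bij_betw_def)
        with False show ?thesis by (auto simp: dual_space_def PiE_def extensional_def)
      qed
    qed
    hence "mon top = \<zero>\<^bsub>A\<^esub>" using bij by (auto simp: bij_betw_def dest: inj_onD)
    hence "crd top (mon top) = 0"
      using lin_map_zero[OF vspace_A vspace_scalars lin_map_crd[OF top_V]] by simp
    thus False by (simp add: crd_mon top_V)
  qed
  have "\<phi> (mon u \<cdot> mon v) = \<phi> (mon v \<cdot> mon u)"
    using L[of "mon u" "mon v"] R[of "mon u" "mon v"] by simp
  moreover have "(\<lambda>i. v i + u i) = top" using uv by (simp add: add.commute)
  ultimately show ?thesis
    using uv nz by (simp add: mon_mult_V u v top_V lin_mapD(3)[OF \<phi>])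
qed

section \<open>Functoriality of the tensor product\<close>

context
  fixes M :: "('k::field, 'a) module" and N :: "('k, 'b) module"
    and M' :: "('k, 'c) module" and N' :: "('k, 'd) module" and f g
  assumes vs: "vspace M" "vspace N" "vspace M'" "vspace N'"
    and f: "lin_map M M' f" and g: "lin_map N N' g"
begin

lemma lin_map_tensor_map: "lin_map (tensor M N) (tensor M' N') (tensor_map M N M' N' f g)"
  unfolding tensor_map_def
  by (rule lin_map_tensor_lift[OF vs(1,2) vspace_tensor[OF vs(3,4)] bilin_pure(1)[OF vs(3,4) f g]])

lemma tensor_map_pure:
  "x \<in> carrier M \<Longrightarrow> y \<in> carrier N \<Longrightarrow>
    tensor_map M N M' N' f g (pure_tensor M N x y) = pure_tensor M' N' (f x) (g y)"
  unfolding tensor_map_def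
  by (rule tensor_lift_pure[OF vs(1,2) vspace_tensor[OF vs(3,4)] bilin_pure(1)[OF vs(3,4) f g]])

end

context
  fixes M :: "('k::field, 'a) module" and N :: "('k, 'b) module" and P :: "('k, 'c) module"
  assumes vs: "vspace M" "vspace N" "vspace P"
begin

abbreviation (input) triple_space :: "('k, ('a \<times> ('b \<times> 'c \<Rightarrow>\<^sub>0 'k) set \<Rightarrow>\<^sub>0 'k) set) module" where
  "triple_space \<equiv> tensor M (tensor N P)"

abbreviation (input) pure3 where
  "pure3 x y z \<equiv> pure_tensor M (tensor N P) x (pure_tensor N P y z)"

lemma vspace_MNP: "vspace triple_space"
  by (rule vspace_tensor[OF vs(1) vspace_tensor[OF vs(2,3)]])

lemma bilin_pure3:
  assumes "z \<in> carrier P"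
  shows "bilin M N triple_space (\<lambda>x y. pure3 x y z)"
proof -
  have "lin_map N (tensor N P) (\<lambda>y. pure_tensor N P y z)"
    by (rule bilinD(2)[OF bilin_pure_tensor[OF vs(2,3)] assms])
  thus ?thesis
    by (rule bilin_pure(1)[OF vs(1) vspace_tensor[OF vs(2,3)] lin_map_ident])
qed

lemma lin_map_pure3:
  assumes "x \<in> carrier M" "y \<in> carrier N"
  shows "lin_map P triple_space (\<lambda>z. pure3 x y z)"
  by (rule lin_map_comp[OF bilinD(1)[OF bilin_pure_tensor[OF vs(2,3)] assms(2)]
        bilinD(1)[OF bilin_pure_tensor[OF vs(1) vspace_tensor[OF vs(2,3)]] assms(1)]])

lemma bilin_assoc:
  "bilin (tensor M N) P triple_space (\<lambda>T z. tensor_lift M N triple_space (\<lambda>x y. pure3 x y z) T)"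
proof (rule bilinI)
  fix z assume "z \<in> carrier P"
  thus "lin_map (tensor M N) triple_space (\<lambda>T. tensor_lift M N triple_space (\<lambda>x y. pure3 x y z) T)"
    using lin_map_tensor_lift[OF vs(1,2) vspace_MNP bilin_pure3] by simp
next
  fix T assume T: "T \<in> carrier (tensor M N)"
  interpret P: module scalars P by (rule vs(3))
  note lift = lin_map_tensor_lift[OF vs(1,2) vspace_MNP bilin_pure3]
  note lp = tensor_lift_pure[OF vs(1,2) vspace_MNP bilin_pure3]
  show "lin_map P triple_space (\<lambda>z. tensor_lift M N triple_space (\<lambda>x y. pure3 x y z) T)"
  proof (rule lin_mapI)
    fix z z' c assume z: "z \<in> carrier P"
    show "tensor_lift M N triple_space (\<lambda>x y. pure3 x y z) T \<in> carrier triple_space"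
      by (rule lin_mapD(1)[OF lift[OF z] T])
    have cz: "c \<odot>\<^bsub>P\<^esub> z \<in> carrier P" using z by (intro P.smult_closed) auto
    show "tensor_lift M N triple_space (\<lambda>x y. pure3 x y (c \<odot>\<^bsub>P\<^esub> z)) T =
        c \<odot>\<^bsub>triple_space\<^esub> tensor_lift M N triple_space (\<lambda>x y. pure3 x y z) T"
      by (rule tensor_lin_map_eqI[OF vs(1,2) vspace_MNP lift[OF cz]
            lin_map_smult[OF vspace_MNP lift[OF z]] _ T])
         (simp add: lp[OF z] lp[OF cz] lin_mapD(3)[OF lin_map_pure3 z])
    assume z': "z' \<in> carrier P"
    have zz: "z \<oplus>\<^bsub>P\<^esub> z' \<in> carrier P" using z z' by simp
    show "tensor_lift M N triple_space (\<lambda>x y. pure3 x y (z \<oplus>\<^bsub>P\<^esub> z')) T =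
        tensor_lift M N triple_space (\<lambda>x y. pure3 x y z) T \<oplus>\<^bsub>triple_space\<^esub> tensor_lift M N triple_space (\<lambda>x y. pure3 x y z') T"
      by (rule tensor_lin_map_eqI[OF vs(1,2) vspace_MNP lift[OF zz]
            lin_map_add[OF vspace_MNP lift[OF z] lift[OF z']] _ T])
         (simp add: lp[OF z] lp[OF z'] lp[OF zz] lin_mapD(2)[OF lin_map_pure3 z z'])
  qed
qed

lemma lin_map_tensor_assoc: "lin_map (tensor (tensor M N) P) triple_space (tensor_assoc M N P)"
  unfolding tensor_assoc_def
  by (rule lin_map_tensor_lift[OF vspace_tensor[OF vs(1,2)] vs(3) vspace_MNP bilin_assoc])

lemma tensor_assoc_pure:
  assumes "T \<in> carrier (tensor M N)" "z \<in> carrier P"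
  shows "tensor_assoc M N P (pure_tensor (tensor M N) P T z) = tensor_lift M N triple_space (\<lambda>x y. pure3 x y z) T"
  unfolding tensor_assoc_def
  by (rule tensor_lift_pure[OF vspace_tensor[OF vs(1,2)] vs(3) vspace_MNP bilin_assoc assms])

end

section \<open>The bi-Frobenius structure attached to a compatible involution\<close>

locale quantum_ci_antipode = quantum_ci_perm n a q \<pi> for n a and q :: "nat \<Rightarrow> nat \<Rightarrow> 'k::field" and \<pi> +
  fixes c :: "nat \<Rightarrow> 'k"
  assumes c_inv: "\<And>i. i \<in> {1..n} \<Longrightarrow> c i * c (\<pi> i) = 1"
    and c_top: "q_perm n a q \<pi> * (\<Prod>i\<in>{1..n}. c i ^ (a i - 1)) = 1"
    and qp_sym: "\<And>u v. u \<in> V \<Longrightarrow> v \<in> V \<Longrightarrow> (\<lambda>i. u i + v i) = top \<Longrightarrow> qp u v = qp v u"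
begin

abbreviation AA :: "('k, ((free_word \<Rightarrow>\<^sub>0 'k) set \<times> (free_word \<Rightarrow>\<^sub>0 'k) set \<Rightarrow>\<^sub>0 'k) set) module" where
  "AA \<equiv> tensor A A"
abbreviation pure where "pure \<equiv> pure_tensor A A"
abbreviation co :: "(nat \<Rightarrow> nat) \<Rightarrow> nat \<Rightarrow> nat" where "co \<equiv> co_vec n a"
abbreviation pa :: "(nat \<Rightarrow> nat) \<Rightarrow> nat \<Rightarrow> nat" where "pa \<equiv> perm_act \<pi>"
abbreviation s :: "(nat \<Rightarrow> nat) \<Rightarrow> 'k" where "s \<equiv> antipode_coeff n q \<pi> c"
abbreviation g :: "(nat \<Rightarrow> nat) \<Rightarrow> 'k" where "g \<equiv> g_coeff n a q \<pi> c"
abbreviation D where "D \<equiv> qci_comult n a q \<pi> c"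
abbreviation E where "E \<equiv> qci_counit n a q"
abbreviation S where "S \<equiv> qci_antipode n a q \<pi> c"
abbreviation \<phi> where "\<phi> \<equiv> qci_dual_basis n a q top"

lemma s_top: "s top = 1"
  using q_perm_eq[of c] c_top by simp

lemma s_pa: "v \<in> V \<Longrightarrow> s v * s (pa v) = 1"
  by (rule sc_perm_act) (rule c_inv)

lemma s_nonzero: "v \<in> V \<Longrightarrow> s v \<noteq> 0"
  using s_pa[of v] by auto

lemma co_add: "v \<in> V \<Longrightarrow> (\<lambda>i. co v i + v i) = top" "v \<in> V \<Longrightarrow> (\<lambda>i. v i + co v i) = top"
  using V_le_top[of v] by (auto simp: co_vec_def)

lemma co_co: "v \<in> V \<Longrightarrow> co (co v) = v"
  using V_le_top[of v] by (auto simp: co_vec_def)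

lemma co_zero: "co (\<lambda>_. 0) = top" and co_top: "co top = (\<lambda>_. 0)"
  by (auto simp: co_vec_def)

lemma top_nonzero: "top \<noteq> (\<lambda>_. 0)"
proof
  assume "top = (\<lambda>_. 0)"
  from fun_cong[OF this, of 1] show False using a_ge_2[of 1] n_ge_2 by (simp add: top_vec_def)
qed

lemma co_eq_zero_iff: "v \<in> V \<Longrightarrow> co v = (\<lambda>_. 0) \<longleftrightarrow> v = top"
  using co_co[of v] co_zero co_top by metis

lemma pa_eq_zero_iff: "pa v = (\<lambda>_. 0) \<longleftrightarrow> v = (\<lambda>_. 0)"
  by (metis perm_act_perm_act perm_act_zero)

lemma pa_eq_top_iff: "pa v = top \<longleftrightarrow> v = top"
  by (metis perm_act_perm_act perm_act_top)

lemma g_zero: "g (\<lambda>_. 0) = 1" and g_top: "g top = 1"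
  by (simp_all add: g_coeff_def co_top s_top)

lemma g_nonzero: "v \<in> V \<Longrightarrow> g v \<noteq> 0"
  by (simp add: g_coeff_def qp_nonzero s_nonzero)

lemma g_qp: "g v * qp (co v) v = s v"
  using qp_nonzero[of "co v" v] by (simp add: g_coeff_def)

lemmas vsA = vspace_A
lemmas vsAA = vspace_tensor[OF vspace_A vspace_A]

sublocale T: module scalars AA by (rule vsAA)

lemma pure_closed [simp]: "x \<in> carrier A \<Longrightarrow> y \<in> carrier A \<Longrightarrow> pure x y \<in> carrier AA"
  by (rule bilinD(3)[OF bilin_pure_tensor[OF vsA vsA]])

lemma AA_smult_closed: "X \<in> carrier AA \<Longrightarrow> r \<odot>\<^bsub>AA\<^esub> X \<in> carrier AA"
  using T.smult_closed[of r X] by simp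

lemma AA_smult_smult: "X \<in> carrier AA \<Longrightarrow> r \<odot>\<^bsub>AA\<^esub> (r' \<odot>\<^bsub>AA\<^esub> X) = (r * r') \<odot>\<^bsub>AA\<^esub> X"
  using T.smult_assoc1[of r r' X] by simp

subsection \<open>The structure maps on the standard basis\<close>

definition Dval where
  "Dval v = (if v = (\<lambda>_. 0) then pure \<one>\<^bsub>A\<^esub> \<one>\<^bsub>A\<^esub>
     else if v = top then (\<Oplus>\<^bsub>AA\<^esub>w\<in>V. g w \<odot>\<^bsub>AA\<^esub> pure (mon (co w)) (mon (pa w)))
     else pure \<one>\<^bsub>A\<^esub> (mon v) \<oplus>\<^bsub>AA\<^esub> pure (mon v) \<one>\<^bsub>A\<^esub>)"

lemma Dval_closed: "Dval \<in> V \<rightarrow> carrier AA"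
  by (auto simp: Dval_def AA_smult_closed intro!: T.finsum_closed)

lemma D_eq: "D = qci_extend n a q AA Dval"
  by (simp add: qci_comult_def Dval_def[abs_def] Let_def)

lemma lin_map_D: "lin_map A AA D"
  unfolding D_eq by (rule lin_map_qci_extend[OF vsAA Dval_closed])

lemma D_mon: "v \<in> V \<Longrightarrow> D (mon v) = Dval v"
  unfolding D_eq by (rule qci_extend_mon[OF vsAA Dval_closed])

lemma D_one: "D \<one>\<^bsub>A\<^esub> = pure \<one>\<^bsub>A\<^esub> \<one>\<^bsub>A\<^esub>"
  using D_mon[OF zero_V] by (simp add: Dval_def mon_zero)

lemma D_top: "D (mon top) = (\<Oplus>\<^bsub>AA\<^esub>w\<in>V. g w \<odot>\<^bsub>AA\<^esub> pure (mon (co w)) (mon (pa w)))"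
  using D_mon[OF top_V] top_nonzero by (simp add: Dval_def)

lemma D_mid:
  "v \<in> V \<Longrightarrow> v \<noteq> (\<lambda>_. 0) \<Longrightarrow> v \<noteq> top \<Longrightarrow>
     D (mon v) = pure \<one>\<^bsub>A\<^esub> (mon v) \<oplus>\<^bsub>AA\<^esub> pure (mon v) \<one>\<^bsub>A\<^esub>"
  using D_mon[of v] by (simp add: Dval_def)

lemma lin_map_E: "lin_map A scalars E"
  unfolding qci_counit_def by (rule lin_map_qci_extend[OF vspace_scalars]) simp

lemma E_mon: "v \<in> V \<Longrightarrow> E (mon v) = (if v = (\<lambda>_. 0) then 1 else 0)"
  unfolding qci_counit_def by (subst qci_extend_mon[OF vspace_scalars]) auto

lemma lin_map_S: "lin_map A A S"
  unfolding qci_antipode_def by (rule lin_map_qci_extend[OF vsA]) (simp add: A_smult_closed)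

lemma S_mon: "v \<in> V \<Longrightarrow> S (mon v) = s v \<bullet> mon (pa v)"
  unfolding qci_antipode_def by (subst qci_extend_mon[OF vsA]) (auto simp: A_smult_closed)

lemma S_one: "S \<one>\<^bsub>A\<^esub> = \<one>\<^bsub>A\<^esub>"
  using S_mon[OF zero_V] A_smult_one[OF AR.one_closed] by (simp add: mon_zero)

lemma S_top: "S (mon top) = mon top"
  using S_mon[OF top_V] by (simp add: s_top A_smult_one)

lemma phi_eq: "x \<in> carrier A \<Longrightarrow> \<phi> x = crd top x"
  by (simp add: qci_dual_basis_def qci_coord_V top_V)

lemma lin_map_phi: "lin_map A scalars \<phi>"
  by (rule lin_map_cong[OF vsA lin_map_crd[OF top_V]]) (simp add: phi_eq)

lemma phi_dual: "\<phi> \<in> dual_space A"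
  using lin_map_phi by (auto simp: dual_space_def qci_dual_basis_def)

text \<open>With respect to the form $\phi(xy)$, the elements $x_{a-1-v}$ are dual to the $x_v$ up to nonzero scalars.\<close>

lemma phi_co_mon:
  assumes "v \<in> V" "w \<in> V"
  shows "\<phi> (mon (co w) \<cdot> mon v) = (if w = v then qp (co v) v else 0)"
proof (cases "w = v")
  case True
  then show ?thesis
    using assms by (simp add: mon_mult_V co_V co_add top_V phi_eq A_smult_closed crd_smult_mon)
next
  case False
  have "(\<lambda>i. co w i + v i) \<noteq> top"
  proof
    assume e: "(\<lambda>i. co w i + v i) = top"
    have "v i = w i" for i using fun_cong[OF e, of i] fun_cong[OF co_add(1)[OF assms(2)], of i] by simp
    with False show False by auto
  qed
  thus ?thesis
    using False assms lin_map_zero[OF vsA vspace_scalars lin_map_phi]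
    by (simp add: mon_mult_V co_V top_V phi_eq A_smult_closed crd_smult_mon)
qed

lemma A_bilin_eqI:
  assumes P: "vspace P" and F: "bilin A A P F" and G: "bilin A A P G"
    and eq: "\<And>u v. u \<in> V \<Longrightarrow> v \<in> V \<Longrightarrow> F (mon u) (mon v) = G (mon u) (mon v)"
    and x: "x \<in> carrier A" and y: "y \<in> carrier A"
  shows "F x y = G x y"
proof (rule A_lin_map_eqI[OF P bilinD(2)[OF F y] bilinD(2)[OF G y] _ x])
  fix u assume u: "u \<in> V"
  show "F (mon u) y = G (mon u) y"
    by (rule A_lin_map_eqI[OF P bilinD(1)[OF F] bilinD(1)[OF G] _ y]) (simp_all add: eq u)
qed

lemma bilin_mult: "bilin A A A (\<lambda>x y. x \<cdot> y)"
  by (intro bilinI A_mult_lin)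

lemma lift_D_top:
  assumes P: "vspace P" and \<beta>: "bilin A A P \<beta>"
  shows "tensor_lift A A P \<beta> (D (mon top)) = (\<Oplus>\<^bsub>P\<^esub>w\<in>V. g w \<odot>\<^bsub>P\<^esub> \<beta> (mon (co w)) (mon (pa w)))"
proof -
  interpret P: module scalars P by fact
  note L = lin_map_tensor_lift[OF vsA vsA P \<beta>] and lp = tensor_lift_pure[OF vsA vsA P \<beta>]
  have "tensor_lift A A P \<beta> (D (mon top)) =
      (\<Oplus>\<^bsub>P\<^esub>w\<in>V. tensor_lift A A P \<beta> (g w \<odot>\<^bsub>AA\<^esub> pure (mon (co w)) (mon (pa w))))"
    unfolding D_top by (rule lin_map_finsum[OF vsAA P L]) (auto simp: AA_smult_closed)
  also have "\<dots> = (\<Oplus>\<^bsub>P\<^esub>w\<in>V. g w \<odot>\<^bsub>P\<^esub> \<beta> (mon (co w)) (mon (pa w)))"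
    by (rule P.finsum_cong') (auto simp: lin_mapD(3)[OF L] lp intro!: P.smult_closed bilinD(3)[OF \<beta>])
  finally show ?thesis .
qed

lemma lift_D_mid:
  assumes P: "vspace P" and \<beta>: "bilin A A P \<beta>" and v: "v \<in> V" "v \<noteq> (\<lambda>_. 0)" "v \<noteq> top"
  shows "tensor_lift A A P \<beta> (D (mon v)) = \<beta> \<one>\<^bsub>A\<^esub> (mon v) \<oplus>\<^bsub>P\<^esub> \<beta> (mon v) \<one>\<^bsub>A\<^esub>"
  using lin_mapD(2)[OF lin_map_tensor_lift[OF vsA vsA P \<beta>]] tensor_lift_pure[OF vsA vsA P \<beta>]
  by (simp add: D_mid[OF v])

lemma lift_D_one:
  assumes P: "vspace P" and \<beta>: "bilin A A P \<beta>"
  shows "tensor_lift A A P \<beta> (D (mon (\<lambda>_. 0))) = \<beta> \<one>\<^bsub>A\<^esub> \<one>\<^bsub>A\<^esub>"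
  using tensor_lift_pure[OF vsA vsA P \<beta>] by (simp add: mon_zero D_one)

lemma lin_map_lift_D:
  assumes P: "vspace P" and \<beta>: "bilin A A P \<beta>"
  shows "lin_map A P (\<lambda>x. tensor_lift A A P \<beta> (D x))"
  by (rule lin_map_comp[OF lin_map_D lin_map_tensor_lift[OF vsA vsA P \<beta>]])

lemma finsum_V_single:
  assumes P: "vspace P" and u: "u \<in> V" and f: "f u \<in> carrier P"
    and z: "\<And>w. w \<in> V \<Longrightarrow> w \<noteq> u \<Longrightarrow> f w = \<zero>\<^bsub>P\<^esub>"
  shows "(\<Oplus>\<^bsub>P\<^esub>w\<in>V. f w) = f u"
proof -
  interpret P: module scalars P by fact
  have "(\<Oplus>\<^bsub>P\<^esub>w\<in>V. f w) = (\<Oplus>\<^bsub>P\<^esub>w\<in>V. if u = w then f w else \<zero>\<^bsub>P\<^esub>)"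
    by (rule P.finsum_cong') (use f z in auto)
  also have "\<dots> = f u"
    by (rule P.add.finprod_singleton) (use u f z finite_V in \<open>auto simp: Pi_def\<close>, metis P.zero_closed)
  finally show ?thesis .
qed

subsection \<open>Counit\<close>

lemma bilin_counit:
  "bilin A A A (\<lambda>y z. E y \<bullet> z)" "bilin A A A (\<lambda>y z. E z \<bullet> y)"
  by (rule bilin_scale[OF vsA lin_map_E lin_map_ident])+

lemma counit_left:
  assumes "x \<in> carrier A"
  shows "tensor_lift A A A (\<lambda>y z. E y \<bullet> z) (D x) = x"
proof (rule A_lin_map_eqI[OF vsA lin_map_lift_D[OF vsA bilin_counit(1)] lin_map_ident _ assms])
  have E1: "E \<one>\<^bsub>A\<^esub> = 1" using E_mon[OF zero_V] by (simp add: mon_zero)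
  fix v assume v: "v \<in> V"
  consider "v = (\<lambda>_. 0)" | "v = top" | "v \<noteq> (\<lambda>_. 0)" "v \<noteq> top" by blast
  then show "tensor_lift A A A (\<lambda>y z. E y \<bullet> z) (D (mon v)) = mon v"
  proof cases
    case 1
    show ?thesis unfolding 1 lift_D_one[OF vsA bilin_counit(1)]
      by (simp add: E1 mon_zero A_smult_one)
  next
    case 2
    have "(\<Oplus>\<^bsub>A\<^esub>w\<in>V. g w \<bullet> (E (mon (co w)) \<bullet> mon (pa w))) =
        g top \<bullet> (E (mon (co top)) \<bullet> mon (pa top))"
      by (rule finsum_V_single[OF vsA top_V])
         (auto simp: E_mon co_V co_eq_zero_iff A_smult_closed A_smult_zero)
    also have "\<dots> = mon top" by (simp add: g_top co_top E_mon zero_V A_smult_one)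
    finally show ?thesis unfolding 2 lift_D_top[OF vsA bilin_counit(1)] .
  next
    case 3
    show ?thesis unfolding lift_D_mid[OF vsA bilin_counit(1) v 3]
      using 3 v by (simp add: E1 E_mon A_smult_one A_smult_zero)
  qed
qed

lemma counit_right:
  assumes "x \<in> carrier A"
  shows "tensor_lift A A A (\<lambda>y z. E z \<bullet> y) (D x) = x"
proof (rule A_lin_map_eqI[OF vsA lin_map_lift_D[OF vsA bilin_counit(2)] lin_map_ident _ assms])
  have E1: "E \<one>\<^bsub>A\<^esub> = 1" using E_mon[OF zero_V] by (simp add: mon_zero)
  fix v assume v: "v \<in> V"
  consider "v = (\<lambda>_. 0)" | "v = top" | "v \<noteq> (\<lambda>_. 0)" "v \<noteq> top" by blast
  then show "tensor_lift A A A (\<lambda>y z. E z \<bullet> y) (D (mon v)) = mon v"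
  proof cases
    case 1
    show ?thesis unfolding 1 lift_D_one[OF vsA bilin_counit(2)]
      by (simp add: E1 mon_zero A_smult_one)
  next
    case 2
    have "(\<Oplus>\<^bsub>A\<^esub>w\<in>V. g w \<bullet> (E (mon (pa w)) \<bullet> mon (co w))) =
        g (\<lambda>_. 0) \<bullet> (E (mon (pa (\<lambda>_. 0))) \<bullet> mon (co (\<lambda>_. 0)))"
      by (rule finsum_V_single[OF vsA zero_V])
         (auto simp: E_mon perm_act_V pa_eq_zero_iff A_smult_closed A_smult_zero)
    also have "\<dots> = mon top" by (simp add: g_zero co_zero E_mon zero_V A_smult_one)
    finally show ?thesis unfolding 2 lift_D_top[OF vsA bilin_counit(2)] .
  next
    case 3
    show ?thesis unfolding lift_D_mid[OF vsA bilin_counit(2) v 3]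
      using 3 v by (simp add: E1 E_mon A_smult_one A_smult_zero)
  qed
qed

subsection \<open>Coassociativity\<close>

abbreviation AAA where "AAA \<equiv> tensor A AA"
abbreviation p3 where "p3 x y z \<equiv> pure_tensor A AA x (pure y z)"

lemma vsAAA: "vspace AAA"
  by (rule vspace_tensor[OF vsA vsAA])

sublocale TT: module scalars AAA by (rule vsAAA)

lemma AAA_smult_closed: "X \<in> carrier AAA \<Longrightarrow> r \<odot>\<^bsub>AAA\<^esub> X \<in> carrier AAA"
  using TT.smult_closed[of r X] by simp

lemma p3_closed [simp]:
  "x \<in> carrier A \<Longrightarrow> y \<in> carrier A \<Longrightarrow> z \<in> carrier A \<Longrightarrow> p3 x y z \<in> carrier AAA"
  by (rule bilinD(3)[OF bilin_pure_tensor[OF vsA vsAA]]) simp_all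

text \<open>Reassociated, $\Delta \otimes \mathrm{id}$ takes values in the same space as $\mathrm{id} \otimes \Delta$, named
  \<open>coR\<close> below.\<close>

definition coL where "coL T = tensor_assoc A A A (tensor_map A A AA A D (\<lambda>y. y) T)"
definition coR where "coR T = tensor_map A A A AA (\<lambda>y. y) D T"

lemma lin_map_coL: "lin_map AA AAA coL"
  unfolding coL_def
  by (rule lin_map_comp[OF lin_map_tensor_map[OF vsA vsA vsAA vsA lin_map_D lin_map_ident]
        lin_map_tensor_assoc[OF vsA vsA vsA]])

lemma lin_map_coR: "lin_map AA AAA coR"
  unfolding coR_def by (rule lin_map_tensor_map[OF vsA vsA vsA vsAA lin_map_ident lin_map_D])

lemma coL_pure:
  assumes "x \<in> carrier A" "z \<in> carrier A"
  shows "coL (pure x z) = tensor_lift A A AAA (\<lambda>x y. p3 x y z) (D x)"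
  unfolding coL_def tensor_map_pure[OF vsA vsA vsAA vsA lin_map_D lin_map_ident assms]
  by (rule tensor_assoc_pure[OF vsA vsA vsA lin_mapD(1)[OF lin_map_D assms(1)] assms(2)])

lemma coR_pure:
  assumes "x \<in> carrier A" "z \<in> carrier A"
  shows "coR (pure x z) = pure_tensor A AA x (D z)"
  unfolding coR_def by (rule tensor_map_pure[OF vsA vsA vsA vsAA lin_map_ident lin_map_D assms])

lemma p3_add_right:
  "x \<in> carrier A \<Longrightarrow> X \<in> carrier AA \<Longrightarrow> Y \<in> carrier AA \<Longrightarrow>
     pure_tensor A AA x (X \<oplus>\<^bsub>AA\<^esub> Y) = pure_tensor A AA x X \<oplus>\<^bsub>AAA\<^esub> pure_tensor A AA x Y"
  by (rule lin_mapD(2)[OF bilinD(1)[OF bilin_pure_tensor[OF vsA vsAA]]])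

lemma coL_one: "z \<in> carrier A \<Longrightarrow> coL (pure \<one>\<^bsub>A\<^esub> z) = p3 \<one>\<^bsub>A\<^esub> \<one>\<^bsub>A\<^esub> z"
  using lift_D_one[OF vsAAA bilin_pure3[OF vsA vsA vsA]] by (simp add: coL_pure mon_zero)

lemma coL_mid:
  "v \<in> V \<Longrightarrow> v \<noteq> (\<lambda>_. 0) \<Longrightarrow> v \<noteq> top \<Longrightarrow> z \<in> carrier A \<Longrightarrow>
     coL (pure (mon v) z) = p3 \<one>\<^bsub>A\<^esub> (mon v) z \<oplus>\<^bsub>AAA\<^esub> p3 (mon v) \<one>\<^bsub>A\<^esub> z"
  using lift_D_mid[OF vsAAA bilin_pure3[OF vsA vsA vsA]] by (simp add: coL_pure)

lemma coL_top:
  "z \<in> carrier A \<Longrightarrow>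
     coL (pure (mon top) z) = (\<Oplus>\<^bsub>AAA\<^esub>w\<in>V. g w \<odot>\<^bsub>AAA\<^esub> p3 (mon (co w)) (mon (pa w)) z)"
  using lift_D_top[OF vsAAA bilin_pure3[OF vsA vsA vsA]] by (simp add: coL_pure)

lemma coR_one: "x \<in> carrier A \<Longrightarrow> coR (pure x \<one>\<^bsub>A\<^esub>) = p3 x \<one>\<^bsub>A\<^esub> \<one>\<^bsub>A\<^esub>"
  by (simp add: coR_pure D_one)

lemma coR_mid:
  "v \<in> V \<Longrightarrow> v \<noteq> (\<lambda>_. 0) \<Longrightarrow> v \<noteq> top \<Longrightarrow> x \<in> carrier A \<Longrightarrow>
     coR (pure x (mon v)) = p3 x \<one>\<^bsub>A\<^esub> (mon v) \<oplus>\<^bsub>AAA\<^esub> p3 x (mon v) \<one>\<^bsub>A\<^esub>"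
  by (simp add: coR_pure D_mid p3_add_right)

lemma coR_top:
  assumes "x \<in> carrier A"
  shows "coR (pure x (mon top)) = (\<Oplus>\<^bsub>AAA\<^esub>w\<in>V. g w \<odot>\<^bsub>AAA\<^esub> p3 x (mon (co w)) (mon (pa w)))"
proof -
  note L = bilinD(1)[OF bilin_pure_tensor[OF vsA vsAA] assms]
  have "coR (pure x (mon top)) =
      (\<Oplus>\<^bsub>AAA\<^esub>w\<in>V. pure_tensor A AA x (g w \<odot>\<^bsub>AA\<^esub> pure (mon (co w)) (mon (pa w))))"
    using assms by (simp add: coR_pure D_top)
       (rule lin_map_finsum[OF vsAA vsAAA L], auto simp: AA_smult_closed)
  also have "\<dots> = (\<Oplus>\<^bsub>AAA\<^esub>w\<in>V. g w \<odot>\<^bsub>AAA\<^esub> p3 x (mon (co w)) (mon (pa w)))"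
    by (rule TT.finsum_cong') (auto simp: lin_mapD(3)[OF L] AAA_smult_closed assms)
  finally show ?thesis .
qed

lemma finsum_V_split:
  assumes "f \<in> V \<rightarrow> carrier AAA"
  shows "(\<Oplus>\<^bsub>AAA\<^esub>w\<in>V. f w) = f (\<lambda>_. 0) \<oplus>\<^bsub>AAA\<^esub> (f top \<oplus>\<^bsub>AAA\<^esub> (\<Oplus>\<^bsub>AAA\<^esub>w\<in>V - {\<lambda>_. 0, top}. f w))"
proof -
  have V: "V = insert (\<lambda>_. 0) (insert top (V - {\<lambda>_. 0, top}))" using zero_V top_V by auto
  have f: "f (\<lambda>_. 0) \<in> carrier AAA" "f top \<in> carrier AAA" "f \<in> V - {\<lambda>_. 0, top} \<rightarrow> carrier AAA"
    using assms zero_V top_V by auto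
  show ?thesis
    by (subst V, subst TT.finsum_insert, goal_cases)
       (use f top_nonzero in \<open>auto simp: finite_V TT.finsum_insert\<close>)
qed

text \<open>Expand both sides with the primitive elements in the middle. The terms $1 \otimes y \otimes z$,
  $y \otimes 1 \otimes z$ and $y \otimes z \otimes 1$ occur on both sides, and the boundary terms that are left over are
  both equal to $1 \otimes x_{a-1} \otimes 1$.\<close>

lemma coassoc_top: "coL (D (mon top)) = coR (D (mon top))"
proof -
  let ?M = "V - {\<lambda>_. 0, top}"
  define A1 where "A1 w = g w \<odot>\<^bsub>AAA\<^esub> p3 \<one>\<^bsub>A\<^esub> (mon (co w)) (mon (pa w))" for w
  define A2 where "A2 w = g w \<odot>\<^bsub>AAA\<^esub> p3 (mon (co w)) \<one>\<^bsub>A\<^esub> (mon (pa w))" for w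
  define A3 where "A3 w = g w \<odot>\<^bsub>AAA\<^esub> p3 (mon (co w)) (mon (pa w)) \<one>\<^bsub>A\<^esub>" for w
  have cl [simp]: "A1 w \<in> carrier AAA" "A2 w \<in> carrier AAA" "A3 w \<in> carrier AAA" for w
    by (auto simp: A1_def A2_def A3_def AAA_smult_closed)
  have sum: "F (D (mon top)) =
      g (\<lambda>_. 0) \<odot>\<^bsub>AAA\<^esub> F (pure (mon (co (\<lambda>_. 0))) (mon (pa (\<lambda>_. 0)))) \<oplus>\<^bsub>AAA\<^esub>
      (g top \<odot>\<^bsub>AAA\<^esub> F (pure (mon (co top)) (mon (pa top))) \<oplus>\<^bsub>AAA\<^esub>
       (\<Oplus>\<^bsub>AAA\<^esub>w\<in>?M. g w \<odot>\<^bsub>AAA\<^esub> F (pure (mon (co w)) (mon (pa w)))))"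
    if F: "lin_map AA AAA F" for F
  proof -
    have "F (D (mon top)) = (\<Oplus>\<^bsub>AAA\<^esub>w\<in>V. F (g w \<odot>\<^bsub>AA\<^esub> pure (mon (co w)) (mon (pa w))))"
      unfolding D_top by (rule lin_map_finsum[OF vsAA vsAAA F]) (auto simp: AA_smult_closed)
    also have "\<dots> = (\<Oplus>\<^bsub>AAA\<^esub>w\<in>V. g w \<odot>\<^bsub>AAA\<^esub> F (pure (mon (co w)) (mon (pa w))))"
      by (rule TT.finsum_cong') (auto simp: lin_mapD[OF F] AAA_smult_closed)
    finally show ?thesis
      by (subst (asm) finsum_V_split) (auto simp: lin_mapD[OF F] AAA_smult_closed)
  qed
  have smult_one: "1 \<odot>\<^bsub>AAA\<^esub> X = X" if "X \<in> carrier AAA" for X using TT.smult_one[of X] that by simp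
  have smult_add: "r \<odot>\<^bsub>AAA\<^esub> (X \<oplus>\<^bsub>AAA\<^esub> Y) = r \<odot>\<^bsub>AAA\<^esub> X \<oplus>\<^bsub>AAA\<^esub> r \<odot>\<^bsub>AAA\<^esub> Y"
    if "X \<in> carrier AAA" "Y \<in> carrier AAA" for r X Y using TT.smult_r_distr[of r X Y] that by simp
  have mid: "co w \<in> V" "co w \<noteq> (\<lambda>_. 0)" "co w \<noteq> top" "pa w \<in> V" "pa w \<noteq> (\<lambda>_. 0)" "pa w \<noteq> top"
    if w: "w \<in> ?M" for w
    using w co_eq_zero_iff[of w] co_co[of w] co_top by (auto simp: co_V perm_act_V pa_eq_zero_iff pa_eq_top_iff)
  have "coL (D (mon top)) = (\<Oplus>\<^bsub>AAA\<^esub>w\<in>V. A3 w) \<oplus>\<^bsub>AAA\<^esub> (A1 top \<oplus>\<^bsub>AAA\<^esub> (\<Oplus>\<^bsub>AAA\<^esub>w\<in>?M. A1 w \<oplus>\<^bsub>AAA\<^esub> A2 w))"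
  proof -
    have "(\<Oplus>\<^bsub>AAA\<^esub>w\<in>?M. g w \<odot>\<^bsub>AAA\<^esub> coL (pure (mon (co w)) (mon (pa w)))) = (\<Oplus>\<^bsub>AAA\<^esub>w\<in>?M. A1 w \<oplus>\<^bsub>AAA\<^esub> A2 w)"
      by (rule TT.finsum_cong') (auto simp: coL_mid mid smult_add A1_def A2_def AAA_smult_closed)
    moreover have "g top \<odot>\<^bsub>AAA\<^esub> coL (pure (mon (co top)) (mon (pa top))) = A1 top"
      by (simp add: co_top mon_zero coL_one A1_def)
    moreover have "g (\<lambda>_. 0) \<odot>\<^bsub>AAA\<^esub> coL (pure (mon (co (\<lambda>_. 0))) (mon (pa (\<lambda>_. 0)))) = (\<Oplus>\<^bsub>AAA\<^esub>w\<in>V. A3 w)"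
      unfolding g_zero co_zero perm_act_zero mon_zero coL_top[OF AR.one_closed] A3_def
      by (rule smult_one) (auto simp: AAA_smult_closed)
    ultimately show ?thesis unfolding sum[OF lin_map_coL] by simp
  qed
  moreover have "coR (D (mon top)) = A3 (\<lambda>_. 0) \<oplus>\<^bsub>AAA\<^esub> ((\<Oplus>\<^bsub>AAA\<^esub>w\<in>V. A1 w) \<oplus>\<^bsub>AAA\<^esub> (\<Oplus>\<^bsub>AAA\<^esub>w\<in>?M. A2 w \<oplus>\<^bsub>AAA\<^esub> A3 w))"
  proof -
    have "(\<Oplus>\<^bsub>AAA\<^esub>w\<in>?M. g w \<odot>\<^bsub>AAA\<^esub> coR (pure (mon (co w)) (mon (pa w)))) = (\<Oplus>\<^bsub>AAA\<^esub>w\<in>?M. A2 w \<oplus>\<^bsub>AAA\<^esub> A3 w)"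
      by (rule TT.finsum_cong') (auto simp: coR_mid mid smult_add A2_def A3_def AAA_smult_closed)
    moreover have "g (\<lambda>_. 0) \<odot>\<^bsub>AAA\<^esub> coR (pure (mon (co (\<lambda>_. 0))) (mon (pa (\<lambda>_. 0)))) = A3 (\<lambda>_. 0)"
      by (simp add: mon_zero coR_one A3_def)
    moreover have "g top \<odot>\<^bsub>AAA\<^esub> coR (pure (mon (co top)) (mon (pa top))) = (\<Oplus>\<^bsub>AAA\<^esub>w\<in>V. A1 w)"
      unfolding g_top co_top perm_act_top mon_zero coR_top[OF AR.one_closed] A1_def
      by (rule smult_one) (auto simp: AAA_smult_closed)
    ultimately show ?thesis unfolding sum[OF lin_map_coR] by simp
  qed
  moreover have "A3 top = A1 (\<lambda>_. 0)"
    by (simp add: A1_def A3_def g_top g_zero co_top co_zero mon_zero)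
  moreover have "(\<Oplus>\<^bsub>AAA\<^esub>w\<in>?M. A1 w) \<in> carrier AAA" "(\<Oplus>\<^bsub>AAA\<^esub>w\<in>?M. A2 w) \<in> carrier AAA"
    "(\<Oplus>\<^bsub>AAA\<^esub>w\<in>?M. A3 w) \<in> carrier AAA"
    by (auto intro!: TT.finsum_closed)
  ultimately show ?thesis
    by (simp add: finsum_V_split TT.finsum_addf TT.M.a_ac)
qed

lemma coassoc:
  assumes "x \<in> carrier A"
  shows "coL (D x) = coR (D x)"
proof (rule A_lin_map_eqI[OF vsAAA lin_map_comp[OF lin_map_D lin_map_coL]
      lin_map_comp[OF lin_map_D lin_map_coR] _ assms])
  fix v assume v: "v \<in> V"
  consider "v = (\<lambda>_. 0)" | "v = top" | "v \<noteq> (\<lambda>_. 0)" "v \<noteq> top" by blast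
  then show "coL (D (mon v)) = coR (D (mon v))"
  proof cases
    case 1
    show ?thesis unfolding 1 mon_zero by (simp add: D_one coL_one coR_one)
  next
    case 2
    then show ?thesis using coassoc_top by simp
  next
    case 3
    show ?thesis
      by (simp add: D_mid[OF v 3] lin_mapD(2)[OF lin_map_coL] lin_mapD(2)[OF lin_map_coR]
          coL_one coL_mid[OF v 3] coR_one coR_mid[OF v 3] TT.M.a_ac)
  qed
qed

lemma coalgebra_A: "coalgebra A D E"
  unfolding coalgebra_def
  using vsA lin_map_D lin_map_E coassoc counit_left counit_right by (simp add: coL_def coR_def)

subsection \<open>Frobenius structures\<close>

lemma frobenius_A: "frobenius_algebra A \<phi>"
  unfolding frobenius_algebra_def
proof (intro conjI ballI phi_dual)
  fix f assume "f \<in> dual_space A"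
  hence f: "lin_map A scalars f" by (rule dual_spaceD)
  \<comment> \<open>expand the functional in the basis dual to the monomials\<close>
  let ?r = "\<lambda>v. f (mon v) / qp (co v) v"
  let ?b = "\<Oplus>\<^bsub>A\<^esub>v\<in>V. ?r v \<bullet> mon (co v)"
  have b: "?b \<in> carrier A" by (auto simp: A_smult_closed)
  have "f x = \<phi> (?b \<cdot> x)" if x: "x \<in> carrier A" for x
  proof (rule A_lin_map_eqI[OF vspace_scalars f lin_map_comp[OF A_mult_lin(2)[OF b] lin_map_phi] _ x])
    fix u assume u: "u \<in> V"
    have L: "lin_map A scalars (\<lambda>y. \<phi> (y \<cdot> mon u))"
      by (rule lin_map_comp[OF A_mult_lin(1) lin_map_phi]) simp
    have "\<phi> (?b \<cdot> mon u) = (\<Sum>v\<in>V. \<phi> ((?r v \<bullet> mon (co v)) \<cdot> mon u))"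
      using lin_map_finsum[OF vsA vspace_scalars L, of "\<lambda>v. ?r v \<bullet> mon (co v)" V]
      by (simp add: finsum_scalars A_smult_closed)
    also have "\<dots> = (\<Sum>v\<in>V. if v = u then f (mon u) else 0)"
      by (rule sum.cong) (auto simp: lin_mapD(3)[OF L] phi_co_mon u qp_nonzero)
    also have "\<dots> = f (mon u)" using u by (simp add: finite_V)
    finally show "f (mon u) = \<phi> (?b \<cdot> mon u)" by simp
  qed
  with b show "\<exists>b\<in>carrier A. \<forall>x\<in>carrier A. f x = \<phi> (b \<cdot> x)" by blast
qed

lemma cofrobenius_A: "frobenius_coalgebra A D (mon top)"
  unfolding frobenius_coalgebra_def
proof (intro conjI equalityI subsetI)
  fix x assume x: "x \<in> carrier A"
  \<comment> \<open>the functional whose slice of the coproduct has the coordinates of \<open>x\<close>\<close>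
  let ?f0 = "qci_extend n a q scalars (\<lambda>v. crd (pa (co v)) x / g (co v))"
  have f0: "lin_map A scalars ?f0" by (rule lin_map_qci_extend[OF vspace_scalars]) simp
  define f where "f = restrict ?f0 (carrier A)"
  have f: "f \<in> dual_space A" unfolding f_def by (rule dual_spaceI[OF f0 vsA])
  have fm: "f (mon (co w)) = crd (pa w) x / g w" if w: "w \<in> V" for w
    unfolding f_def by (simp, subst qci_extend_mon[OF vspace_scalars]) (auto simp: co_V co_co[OF w])
  have "tensor_lift A A A (\<lambda>y z. f y \<bullet> z) (D (mon top)) =
      (\<Oplus>\<^bsub>A\<^esub>w\<in>V. g w \<bullet> (f (mon (co w)) \<bullet> mon (pa w)))"
    by (rule lift_D_top[OF vsA bilin_scale(1)[OF vsA dual_spaceD[OF f] lin_map_ident]])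
  also have "\<dots> = (\<Oplus>\<^bsub>A\<^esub>w\<in>V. crd (pa w) x \<bullet> mon (pa w))"
    by (rule A.M.finsum_cong') (auto simp: fm g_nonzero A_smult_smult A_smult_closed)
  also have "\<dots> = (\<Oplus>\<^bsub>A\<^esub>w\<in>pa ` V. crd w x \<bullet> mon w)"
    using bij_perm_act by (intro A.M.finsum_reindex[symmetric]) (auto simp: A_smult_closed bij_betw_def)
  also have "pa ` V = V" using bij_perm_act by (simp add: bij_betw_def)
  also have "(\<Oplus>\<^bsub>A\<^esub>w\<in>V. crd w x \<bullet> mon w) = x" by (rule basis_expansion[OF x, symmetric])
  finally show "x \<in> {tensor_lift A A A (\<lambda>y z. f y \<bullet> z) (D (mon top)) | f. f \<in> dual_space A}"
    using f by blast
next
  fix x assume "x \<in> {tensor_lift A A A (\<lambda>y z. f y \<bullet> z) (D (mon top)) | f. f \<in> dual_space A}"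
  then obtain f where f: "f \<in> dual_space A" "x = tensor_lift A A A (\<lambda>y z. f y \<bullet> z) (D (mon top))"
    by blast
  show "x \<in> carrier A" unfolding f(2)
    by (rule lin_mapD(1)[OF lin_map_lift_D[OF vsA bilin_scale(1)[OF vsA dual_spaceD[OF f(1)] lin_map_ident]]])
       simp
qed simp

subsection \<open>The antipode\<close>

text \<open>By duality the form $\phi$ picks out a single summand of $\Delta(x_{a-1})$; the coefficients of the coproduct are
  chosen such that it is the antipode.\<close>

lemma S_formula:
  assumes x: "x \<in> carrier A"
  shows "S x = tensor_lift A A A (\<lambda>y z. \<phi> (y \<cdot> x) \<bullet> z) (D (mon top))"
proof -
  have L: "lin_map A scalars (\<lambda>x. g w * \<phi> (mon (co w) \<cdot> x))" for w
    using lin_map_smult[OF vspace_scalars lin_map_comp[OF A_mult_lin(2) lin_map_phi], of "mon (co w)" "g w"]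
    by simp
  have "S x = (\<Oplus>\<^bsub>A\<^esub>w\<in>V. (g w * \<phi> (mon (co w) \<cdot> x)) \<bullet> mon (pa w))"
  proof (rule A_lin_map_eqI[OF vsA lin_map_S _ _ x])
    show "lin_map A A (\<lambda>x. \<Oplus>\<^bsub>A\<^esub>w\<in>V. (g w * \<phi> (mon (co w) \<cdot> x)) \<bullet> mon (pa w))"
      by (rule lin_map_finsum_coeffs[OF vsA L finite_V]) simp
    fix v assume v: "v \<in> V"
    have "(\<Oplus>\<^bsub>A\<^esub>w\<in>V. (g w * \<phi> (mon (co w) \<cdot> mon v)) \<bullet> mon (pa w)) =
        (g v * \<phi> (mon (co v) \<cdot> mon v)) \<bullet> mon (pa v)"
      by (rule finsum_V_single[OF vsA v]) (auto simp: phi_co_mon v A_smult_closed A_smult_zero)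
    also have "\<dots> = S (mon v)" by (simp add: phi_co_mon v g_qp S_mon)
    finally show "S (mon v) = (\<Oplus>\<^bsub>A\<^esub>w\<in>V. (g w * \<phi> (mon (co w) \<cdot> mon v)) \<bullet> mon (pa w))" by simp
  qed
  also have "\<dots> = (\<Oplus>\<^bsub>A\<^esub>w\<in>V. g w \<bullet> (\<phi> (mon (co w) \<cdot> x) \<bullet> mon (pa w)))"
    by (rule A.M.finsum_cong') (auto simp: A_smult_smult A_smult_closed)
  also have "\<dots> = tensor_lift A A A (\<lambda>y z. \<phi> (y \<cdot> x) \<bullet> z) (D (mon top))"
    by (rule lift_D_top[symmetric, OF vsA
          bilin_scale(1)[OF vsA lin_map_comp[OF A_mult_lin(1)[OF x] lin_map_phi] lin_map_ident]])
  finally show ?thesis .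
qed

lemma S_antihom:
  assumes "x \<in> carrier A" "y \<in> carrier A"
  shows "S (x \<cdot> y) = S y \<cdot> S x"
proof (rule A_bilin_eqI[OF vsA bilin_comp[OF bilin_mult lin_map_S]
      bilin_flip[OF bilin_comp_args[OF bilin_mult lin_map_S lin_map_S]] _ assms])
  fix u v assume u: "u \<in> V" and v: "v \<in> V"
  let ?w = "\<lambda>i. u i + v i"
  have pw: "(\<lambda>i. pa v i + pa u i) = pa ?w" by (simp add: perm_act_add add.commute)
  have R: "S (mon v) \<cdot> S (mon u) = (s v * s u) \<bullet> (mon (pa v) \<cdot> mon (pa u))"
    by (simp add: S_mon u v A_smult_mult A_smult_smult A_smult_closed mult.commute)
  show "S (mon u \<cdot> mon v) = S (mon v) \<cdot> S (mon u)"
  proof (cases "?w \<in> V")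
    case True
    then show ?thesis
      unfolding R mon_mult_V[OF u v] mon_mult_V[OF perm_act_V[OF v] perm_act_V[OF u]] pw
      using sc_mult[OF u v, of c]
      by (simp add: perm_act_V_iff lin_mapD(3)[OF lin_map_S] S_mon A_smult_smult mult_ac)
  next
    case False
    then show ?thesis
      unfolding R mon_mult_V[OF u v] mon_mult_V[OF perm_act_V[OF v] perm_act_V[OF u]] pw
      using lin_map_zero[OF vsA vsA lin_map_S] by (simp add: perm_act_V_iff A_smult_zero)
  qed
qed

lemma E_mult:
  assumes "x \<in> carrier A" "y \<in> carrier A"
  shows "E (x \<cdot> y) = E x * E y"
proof (rule A_bilin_eqI[OF vspace_scalars bilin_comp[OF bilin_mult lin_map_E] _ _ assms])
  show "bilin A A scalars (\<lambda>x y. E x * E y)"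
    using bilin_scale(1)[OF vspace_scalars lin_map_E lin_map_E] by simp
  fix u v assume u: "u \<in> V" and v: "v \<in> V"
  have e: "(\<lambda>i. u i + v i) = (\<lambda>_. 0) \<longleftrightarrow> u = (\<lambda>_. 0) \<and> v = (\<lambda>_. 0)"
    by (auto simp: fun_eq_iff)
  show "E (mon u \<cdot> mon v) = E (mon u) * E (mon v)"
    using lin_map_zero[OF vsA vspace_scalars lin_map_E] zero_V
    by (auto simp: mon_mult_V u v lin_mapD(3)[OF lin_map_E] E_mon e)
qed

lemma E_S:
  assumes "x \<in> carrier A"
  shows "E (S x) = E x"
  by (rule A_lin_map_eqI[OF vspace_scalars lin_map_comp[OF lin_map_S lin_map_E] lin_map_E _ assms])
     (auto simp: S_mon lin_mapD(3)[OF lin_map_E] E_mon perm_act_V pa_eq_zero_iff)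

text \<open>This is where symmetry of the algebra enters: with it and $S^2 = \mathrm{id}$, flipping the coproduct of the
  top element and applying the antipode to both legs returns the same coefficients.\<close>

lemma g_co:
  assumes w: "w \<in> V"
  shows "g (co w) * (s (pa (co w)) * s w) = g w"
proof -
  have "g (co w) * (s (pa (co w)) * s w) = (s (co w) * s (pa (co w))) * s w / qp (co (co w)) (co w)"
    by (simp add: g_coeff_def)
  also have "qp (co (co w)) (co w) = qp (co w) w"
    unfolding co_co[OF w] by (rule qp_sym[OF w co_V co_add(2)[OF w]])
  finally show ?thesis by (simp add: s_pa[OF co_V] g_coeff_def)
qed

text \<open>For primitive elements this is immediate. For the top element, reindex the sum by $v \mapsto a-1-v$.\<close>

lemma S_coantihom:
  assumes "x \<in> carrier A"
  shows "D (S x) = tensor_lift A A AA (\<lambda>y z. pure (S z) (S y)) (D x)"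
proof -
  note b = bilin_pure(2)[OF vsA vsA lin_map_S lin_map_S]
  note Sc = lin_mapD(1)[OF lin_map_S]
  show ?thesis
  proof (rule A_lin_map_eqI[OF vsAA lin_map_comp[OF lin_map_S lin_map_D] lin_map_lift_D[OF vsAA b] _ assms])
    fix v assume v: "v \<in> V"
    consider "v = (\<lambda>_. 0)" | "v = top" | "v \<noteq> (\<lambda>_. 0)" "v \<noteq> top" by blast
    then show "D (S (mon v)) = tensor_lift A A AA (\<lambda>y z. pure (S z) (S y)) (D (mon v))"
    proof cases
      case 1
      show ?thesis unfolding 1 lift_D_one[OF vsAA b] by (simp add: mon_zero S_one D_one)
    next
      case 2
      note P1 = lin_mapD(3)[OF bilinD(1)[OF bilin_pure_tensor[OF vsA vsA]]]
      note P2 = lin_mapD(3)[OF bilinD(2)[OF bilin_pure_tensor[OF vsA vsA]]]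
      have bij: "inj_on co V" by (rule inj_on_inverseI[of _ co]) (rule co_co)
      have co_image: "co ` V = V"
      proof (intro equalityI subsetI)
        fix v assume "v \<in> V"
        thus "v \<in> co ` V" using co_co[of v] co_V[of v] by (metis image_eqI)
      qed (use co_V in auto)
      have summand: "g (co w) \<odot>\<^bsub>AA\<^esub> pure (S (mon (pa (co w)))) (S (mon (co (co w)))) =
          g w \<odot>\<^bsub>AA\<^esub> pure (mon (co w)) (mon (pa w))" if w: "w \<in> V" for w
      proof -
        have "pure (S (mon (pa (co w)))) (S (mon (co (co w)))) =
            (s (pa (co w)) * s w) \<odot>\<^bsub>AA\<^esub> pure (mon (co w)) (mon (pa w))"
          by (simp add: S_mon perm_act_V co_V co_co w P1 P2 A_smult_closed AA_smult_smult mult.commute)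
        thus ?thesis using g_co[OF w] by (simp add: AA_smult_smult)
      qed
      have "tensor_lift A A AA (\<lambda>y z. pure (S z) (S y)) (D (mon top)) =
          (\<Oplus>\<^bsub>AA\<^esub>w\<in>V. g w \<odot>\<^bsub>AA\<^esub> pure (S (mon (pa w))) (S (mon (co w))))"
        by (rule lift_D_top[OF vsAA b])
      also have "\<dots> = (\<Oplus>\<^bsub>AA\<^esub>w\<in>co ` V. g w \<odot>\<^bsub>AA\<^esub> pure (S (mon (pa w))) (S (mon (co w))))"
        unfolding co_image ..
      also have "\<dots> = (\<Oplus>\<^bsub>AA\<^esub>w\<in>V. g (co w) \<odot>\<^bsub>AA\<^esub> pure (S (mon (pa (co w)))) (S (mon (co (co w)))))"
        by (rule T.finsum_reindex) (auto simp: bij AA_smult_closed Sc)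
      also have "\<dots> = D (mon top)"
        unfolding D_top by (rule T.finsum_cong') (auto simp: summand AA_smult_closed)
      finally show ?thesis unfolding 2 S_top by simp
    next
      case 3
      have pv: "pa v \<in> V" "pa v \<noteq> (\<lambda>_. 0)" "pa v \<noteq> top"
        using v 3 by (auto simp: perm_act_V pa_eq_zero_iff pa_eq_top_iff)
      note P1 = lin_mapD(3)[OF bilinD(1)[OF bilin_pure_tensor[OF vsA vsA]]]
      note P2 = lin_mapD(3)[OF bilinD(2)[OF bilin_pure_tensor[OF vsA vsA]]]
      show ?thesis unfolding lift_D_mid[OF vsAA b v 3]
        using T.smult_r_distr[of "s v" "pure \<one>\<^bsub>A\<^esub> (mon (pa v))" "pure (mon (pa v)) \<one>\<^bsub>A\<^esub>"]
        by (simp add: S_mon v S_one lin_mapD(3)[OF lin_map_D] D_mid[OF pv] P1 P2 T.M.a_comm AA_smult_closed)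
    qed
  qed
qed

theorem bi_frobenius_A: "bi_frobenius A D E \<phi> (mon top) S"
proof -
  have "E \<one>\<^bsub>A\<^esub> = 1" using E_mon[OF zero_V] by (simp add: mon_zero)
  thus ?thesis
    unfolding bi_frobenius_def
    using assoc_algebra_A fin_dim_A coalgebra_A phi_dual lin_map_S S_formula E_mult D_one
      frobenius_A cofrobenius_A S_one S_antihom E_S S_coantihom by simp
qed

lemma S_gen:
  assumes "i \<in> {1..n}"
  shows "S (gen i) = c i \<bullet> gen (\<pi> i)"
  using S_mon[OF unit_V[OF assms]] gen_eq_mon[OF assms] gen_eq_mon[of "\<pi> i"] \<pi>_in[of i] assms
  by (simp only: perm_act_unit sc_unit[OF assms])

lemma perm_antipode_S: "perm_antipode n a q S"
  unfolding perm_antipode_def using bij_perm_act S_mon by blast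

end

theorem corollary6p7:
  fixes n :: nat and a :: "nat \<Rightarrow> nat" and q :: "nat \<Rightarrow> nat \<Rightarrow> 'k::field"
  assumes "qci_data n a q"
    and "symmetric_algebra (qci n a q)"
  shows "((\<exists>\<Delta> \<epsilon> \<phi> t S. bi_frobenius (qci n a q) \<Delta> \<epsilon> \<phi> t S \<and> perm_antipode n a q S) \<longleftrightarrow>
          (\<exists>\<pi>. \<pi> permutes {1..n} \<and> compatible n a q \<pi> \<and> \<pi> \<circ> \<pi> = id)) \<and>
         (\<forall>\<pi>. \<pi> permutes {1..n} \<and> compatible n a q \<pi> \<and> \<pi> \<circ> \<pi> = id \<longrightarrow>
           (\<exists>c :: nat \<Rightarrow> 'k.
              (\<forall>i\<in>{1..n}. c i * c (\<pi> i) = h_coeff n a q (unit_vec i)) \<and>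
              q_perm n a q \<pi> * (\<Prod>i\<in>{1..n}. c i ^ (a i - 1)) = 1 \<and>
              bi_frobenius (qci n a q) (qci_comult n a q \<pi> c) (qci_counit n a q)
                (qci_dual_basis n a q (top_vec n a)) (qci_mon n a q (top_vec n a))
                (qci_antipode n a q \<pi> c) \<and>
              (\<forall>i\<in>{1..n}. qci_antipode n a q \<pi> c (qci_gen n a q i) =
                           c i \<odot>\<^bsub>qci n a q\<^esub> qci_gen n a q (\<pi> i))))"
proof -
  interpret quantum_ci n a q by unfold_locales (rule assms(1))
  have h: "h_coeff n a q (unit_vec i) = 1" if i: "i \<in> {1..n}" for i
  proof -
    have "(\<lambda>k. co_vec n a (unit_vec i) k + unit_vec i k) = top"
      using V_le_top[OF unit_V[OF i]] by (auto simp: co_vec_def)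
    from symmetric_qp[OF assms(2) co_V unit_V[OF i] this] show ?thesis
      using qp_nonzero by (simp add: h_coeff_def)
  qed
  have main: "\<exists>c :: nat \<Rightarrow> 'k. (\<forall>i\<in>{1..n}. c i * c (\<pi> i) = h_coeff n a q (unit_vec i)) \<and>
              q_perm n a q \<pi> * (\<Prod>i\<in>{1..n}. c i ^ (a i - 1)) = 1 \<and>
              bi_frobenius A (qci_comult n a q \<pi> c) (qci_counit n a q)
                (qci_dual_basis n a q top) (mon top) (qci_antipode n a q \<pi> c) \<and>
              (\<forall>i\<in>{1..n}. qci_antipode n a q \<pi> c (gen i) = c i \<odot>\<^bsub>A\<^esub> gen (\<pi> i)) \<and>
              perm_antipode n a q (qci_antipode n a q \<pi> c)"
    if \<pi>: "\<pi> permutes {1..n}" "compatible n a q \<pi>" "\<pi> \<circ> \<pi> = id" for \<pi>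
  proof -
    interpret quantum_ci_perm n a q \<pi> by unfold_locales (use \<pi> in auto)
    obtain c :: "nat \<Rightarrow> 'k" where c: "\<forall>i\<in>{1..n}. c i * c (\<pi> i) = 1"
      "q_perm n a q \<pi> * (\<Prod>i\<in>{1..n}. c i ^ (a i - 1)) = 1"
      using exists_scalars by blast
    interpret quantum_ci_antipode n a q \<pi> c
      by unfold_locales (use c symmetric_qp[OF assms(2)] in auto)
    show ?thesis
      using c h bi_frobenius_A S_gen perm_antipode_S by (intro exI[of _ c]) simp
  qed
  show ?thesis
  proof (intro conjI iffI allI impI)
    assume "\<exists>\<Delta> \<epsilon> \<phi> t S. bi_frobenius A \<Delta> \<epsilon> \<phi> t S \<and> perm_antipode n a q S"
    thus "\<exists>\<pi>. \<pi> permutes {1..n} \<and> compatible n a q \<pi> \<and> \<pi> \<circ> \<pi> = id"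
      using perm_antipode_imp_involution by blast
  next
    assume "\<exists>\<pi>. \<pi> permutes {1..n} \<and> compatible n a q \<pi> \<and> \<pi> \<circ> \<pi> = id"
    thus "\<exists>\<Delta> \<epsilon> \<phi> t S. bi_frobenius A \<Delta> \<epsilon> \<phi> t S \<and> perm_antipode n a q S"
      using main by blast
  next
    fix \<pi> assume "\<pi> permutes {1..n} \<and> compatible n a q \<pi> \<and> \<pi> \<circ> \<pi> = id"
    thus "\<exists>c :: nat \<Rightarrow> 'k.
              (\<forall>i\<in>{1..n}. c i * c (\<pi> i) = h_coeff n a q (unit_vec i)) \<and>
              q_perm n a q \<pi> * (\<Prod>i\<in>{1..n}. c i ^ (a i - 1)) = 1 \<and>
              bi_frobenius A (qci_comult n a q \<pi> c) (qci_counit n a q)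
                (qci_dual_basis n a q top) (mon top) (qci_antipode n a q \<pi> c) \<and>
              (\<forall>i\<in>{1..n}. qci_antipode n a q \<pi> c (gen i) = c i \<odot>\<^bsub>A\<^esub> gen (\<pi> i))"
      using main by blast
  qed
qed

end
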